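(* Let $k\ge2$, let $\varphi_k:(\mathbb{C}^{2k-2},0)\to(\mathbb{C}^{2k-1},0)$ be the complex minimal cross cap mapping of multiplicity $k$ (the normal form of a corank $1$ minimal stable map of multiplicity $k$), and let $V$ be its image. Then \[ \mathrm{Derlog}(V)=\langle \xi_e,\ \xi^1_j,\ \xi^2_j,\ \xi^3_j\rangle_{j=1}^{k-1}. \] That is, the module (over the ring of complex analytic function germs on $(\mathbb{C}^{2k-1},0)$) of vector fields liftable over $\varphi_k$ is generated by the vector fields $\xi^1_j,\xi^2_j,\xi^3_j$, $1\le j\le k-1$, given in the context, together with the Euler vector field $\xi_e$.
   Context: Everything is complex analytic; functions and vector fields are germs at $0$. The minimal cross cap mapping of multiplicity $k\ge2$ is $\varphi_k:(\mathbb{C}^{2k-2},0)\to(\mathbb{C}^{2k-1},0)$, \[ \varphi_k(u_1,\ldots,u_{k-2},v_1,\ldots,v_{k-1},y)=\Big(u_1,\ldots,u_{k-2},v_1,\ldots,v_{k-1},\,y^k+\sum_{i=1}^{k-2}u_iy^i,\ \sum_{i=1}^{k-1}v_iy^i\Big). \] The coordinates on the target are, in order, $U_1,\dots,U_{k-2},V_1,\dots,V_{k-1},W_1,W_2$; components of vector fields are listed in this order. A vector field germ $\xi$ on $(\mathbb{C}^p,0)$ is liftable over $f:(\mathbb{C}^n,0)\to(\mathbb{C}^p,0)$ if there is a vector field germ $\eta$ on $(\mathbb{C}^n,0)$ with $df\circ\eta=\xi\circ f$. For an analytic variety germ $V\subseteq(\mathbb{C}^p,0)$ with defining ideal $I(V)$,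 $\mathrm{Derlog}(V)$ is the module of vector field germs $\xi$ on $(\mathbb{C}^p,0)$ with $\xi(I(V))\subseteq I(V)$ (vector fields tangent to $V$). $\langle\cdots\rangle$ denotes the module generated by the listed elements over the ring of analytic function germs. Euler vector field: $\xi_e=((k-1)U_1,(k-2)U_2,\dots,2U_{k-2},(k-1)V_1,(k-2)V_2,\dots,V_{k-1},kW_1,kW_2)^T$. Dummy variable convention: $U_{k-1}=V_k=0$, $U_k=1$, and $U_r=V_r=0$ for $r\le 0$ and for $r>k$. Empty sums are $0$. For $1\le f\le3$, $1\le j\le k-1$, $\xi^f_j=(A^f_{1,j},\dots,A^f_{k-2,j},B^f_{1,j},\dots,B^f_{k-1,j},C^f_{1,j},C^f_{2,j})^T$, where (for $1\le i\le k-2$ in the $A$'s and $1\le i\le k-1$ in the $B$'s): First family: $A_{i,j}^1=(k-i)(k-j)U_iU_j$; $B_{i,j}^1=k\sum_{r=1}^{i-1}U_{i+j-r}V_r-k\sum_{r=1}^iU_rV_{i+j-r}-(i-1)(k-j)U_jV_i+kV_{i+j}W_1-kU_{i+j}W_2$; $C_{1,j}^1=k(k-j)U_jW_1$; $C_{2,j}^1=-kV_jW_1+(k-j)U_jW_2$. Second family: $A_{i,j}^2=-k(k+i-j+1)U_{k+i-j+1}W_1+k\sum_{r=1}^i(k+i-j-2r+1)U_rU_{k+i-j-r+1}-j(i+1)U_{i+1}U_{k-j}$; $B_{i,j}^2=-k(k+i-j+1)V_{k+i-j+1}W_1+k\sum_{r=1}^i(k+i-j-r+1)U_rV_{k+i-j-r+1}-k\sum_{r=1}^irU_{k+i-j-r+1}V_r-j(i+1)U_{k-j}V_{i+1}$;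 $C_{1,j}^2=k(k-j+1)U_{k-j+1}W_1+jU_1U_{k-j}$; $C_{2,j}^2=k(k-j+1)V_{k-j+1}W_1+jV_1U_{k-j}$. Third family: $A_{i,j}^3=-k(k+i-j+1)U_{k+i-j+1}W_2+k\sum_{r=1}^i(k+i-j-r+1)U_{k+i-j-r+1}V_r-k\sum_{r=1}^irU_rV_{k+i-j-r+1}-k(i+1)U_{i+1}V_{k-j}$; $B_{i,j}^3=-k(k+i-j+1)V_{k+i-j+1}W_2+k\sum_{r=1}^i(k+i-j-2r+1)V_rV_{k+i-j-r+1}-k(i+1)V_{i+1}V_{k-j}$; $C_{1,j}^3=k(k-j+1)U_{k-j+1}W_2+kU_1V_{k-j}$; $C_{2,j}^3=k(k-j+1)V_{k-j+1}W_2+kV_1V_{k-j}$. *)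

theory Defs
  imports "HOL-Analysis.Analysis"
begin

section \<open>Analytic germs at the origin of complex n-space\<close>

text \<open>
  Since the dimensions \<open>2 k - 2\<close> and \<open>2 k - 1\<close> occur together, points of complex \<open>n\<close>-space are
  functions \<open>nat \<Rightarrow> complex\<close> with coordinates \<open>x 1, \<dots>, x n\<close> that vanish outside \<open>{1..n}\<close>.
  A germ at \<open>0\<close> is given by a representative, and properties of germs are tested on a
  sufficiently small polydisc; all sets of germs below are closed under changing
  representatives away from \<open>0\<close>.
\<close>

definition cspace :: "nat \<Rightarrow> (nat \<Rightarrow> complex) set" where
  "cspace n = {x. \<forall>i. i \<notin> {1..n} \<longrightarrow> x i = 0}"

definition polydisc :: "nat \<Rightarrow> real \<Rightarrow> (nat \<Rightarrow> complex) set" where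
  "polydisc n r = {x \<in> cspace n. \<forall>i\<in>{1..n}. norm (x i) < r}"

definition near_0 :: "nat \<Rightarrow> ((nat \<Rightarrow> complex) \<Rightarrow> bool) \<Rightarrow> bool" where
  "near_0 n P \<longleftrightarrow> (\<exists>r>0. \<forall>x\<in>polydisc n r. P x)"

definition multi_indices :: "nat \<Rightarrow> (nat \<Rightarrow> nat) set" where
  "multi_indices n = {\<alpha>. \<forall>i. i \<notin> {1..n} \<longrightarrow> \<alpha> i = 0}"

definition analytic_germ :: "nat \<Rightarrow> ((nat \<Rightarrow> complex) \<Rightarrow> complex) \<Rightarrow> bool" where
  "analytic_germ n f \<longleftrightarrow>
     (\<exists>c. near_0 n (\<lambda>x. ((\<lambda>\<alpha>. c \<alpha> * (\<Prod>i=1..n. x i ^ \<alpha> i)) has_sum f x) (multi_indices n)))"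

definition partial_deriv ::
    "nat \<Rightarrow> ((nat \<Rightarrow> complex) \<Rightarrow> complex) \<Rightarrow> (nat \<Rightarrow> complex) \<Rightarrow> complex" where
  "partial_deriv i f x = deriv (\<lambda>t. f (x(i := t))) (x i)"

text \<open>Only the components \<open>1, \<dots>, n\<close> of a vector field on complex \<open>n\<close>-space are relevant.\<close>

type_synonym vfield = "(nat \<Rightarrow> complex) \<Rightarrow> (nat \<Rightarrow> complex)"

definition vector_field_germ :: "nat \<Rightarrow> vfield \<Rightarrow> bool" where
  "vector_field_germ n \<xi> \<longleftrightarrow> (\<forall>i\<in>{1..n}. analytic_germ n (\<lambda>x. \<xi> x i))"

definition apply_field ::
    "nat \<Rightarrow> vfield \<Rightarrow> ((nat \<Rightarrow> complex) \<Rightarrow> complex) \<Rightarrow> (nat \<Rightarrow> complex) \<Rightarrow> complex" where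
  "apply_field n \<xi> h x = (\<Sum>i=1..n. \<xi> x i * partial_deriv i h x)"

definition vanishing_ideal ::
    "nat \<Rightarrow> (nat \<Rightarrow> complex) set \<Rightarrow> ((nat \<Rightarrow> complex) \<Rightarrow> complex) set" where
  "vanishing_ideal n V = {h. analytic_germ n h \<and> near_0 n (\<lambda>x. x \<in> V \<longrightarrow> h x = 0)}"

definition Derlog :: "nat \<Rightarrow> (nat \<Rightarrow> complex) set \<Rightarrow> vfield set" where
  "Derlog n V = {\<xi>. vector_field_germ n \<xi> \<and>
     (\<forall>h\<in>vanishing_ideal n V. apply_field n \<xi> h \<in> vanishing_ideal n V)}"

definition liftable :: "nat \<Rightarrow> nat \<Rightarrow> vfield \<Rightarrow> vfield \<Rightarrow> bool" where
  "liftable n p f \<xi> \<longleftrightarrow> vector_field_germ p \<xi> \<and>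
     (\<exists>\<eta>. vector_field_germ n \<eta> \<and>
        near_0 n (\<lambda>x. \<forall>i\<in>{1..p}.
          (\<Sum>l=1..n. partial_deriv l (\<lambda>z. f z i) x * \<eta> x l) = \<xi> (f x) i))"

definition generated_module :: "nat \<Rightarrow> vfield set \<Rightarrow> vfield set" where
  "generated_module n G = {\<xi>. vector_field_germ n \<xi> \<and>
     (\<exists>S a. finite S \<and> S \<subseteq> G \<and> (\<forall>\<zeta>\<in>S. analytic_germ n (a \<zeta>)) \<and>
        near_0 n (\<lambda>x. \<forall>i\<in>{1..n}. \<xi> x i = (\<Sum>\<zeta>\<in>S. a \<zeta> x * \<zeta> x i)))}"

section \<open>The minimal cross cap mapping\<close>

text \<open>
  The tuple \<open>(A 1, \<dots>, A (k-2), B 1, \<dots>, B (k-1), C1, C2)\<close>, in the order of the target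
  coordinates \<open>U\<close>, \<open>V\<close>, \<open>W1\<close>, \<open>W2\<close>.  Indices are integers because \<open>A\<close> and \<open>B\<close> are below
  given by formulas involving differences of indices.
\<close>

definition target_tuple ::
    "int \<Rightarrow> (int \<Rightarrow> complex) \<Rightarrow> (int \<Rightarrow> complex) \<Rightarrow> complex \<Rightarrow> complex \<Rightarrow> nat \<Rightarrow> complex" where
  "target_tuple k A B C1 C2 m =
     (if 1 \<le> int m \<and> int m \<le> k - 2 then A (int m)
      else if k - 1 \<le> int m \<and> int m \<le> 2 * k - 3 then B (int m - (k - 2))
      else if int m = 2 * k - 2 then C1
      else if int m = 2 * k - 1 then C2
      else 0)"

definition cross_cap :: "nat \<Rightarrow> (nat \<Rightarrow> complex) \<Rightarrow> (nat \<Rightarrow> complex)" where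
  "cross_cap k x =
     (let u = (\<lambda>i. x i); v = (\<lambda>i. x (k - 2 + i)); y = x (2 * k - 2)
      in target_tuple (int k) (\<lambda>i. u (nat i)) (\<lambda>i. v (nat i))
           (y ^ k + (\<Sum>i=1..k-2. u i * y ^ i))
           (\<Sum>i=1..k-1. v i * y ^ i))"

definition cross_cap_image :: "nat \<Rightarrow> (nat \<Rightarrow> complex) set" where
  "cross_cap_image k = cross_cap k ` cspace (2 * k - 2)"

text \<open>
  The whole image of the polynomial mapping represents the image of the mapping germ:
  near \<open>0\<close> it has no points besides the images of points close to \<open>0\<close>.
\<close>

lemma cross_cap_image_germ:
  assumes k: "k \<ge> 2" and r: "r > 0"
  shows "\<exists>s>0. cross_cap_image k \<inter> polydisc (2 * k - 1) s
                 \<subseteq> cross_cap k ` polydisc (2 * k - 2) r"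
proof -
  define q where "q = min r 1"
  define s where "s = min r (q ^ k / k)"
  have q: "0 < q" "q \<le> 1" "q \<le> r" using r by (auto simp: q_def)
  have s: "s > 0" "s \<le> r" "s * k \<le> q ^ k" using r q k
    by (auto simp: s_def field_simps min_def)
  have qk: "q ^ k \<le> 1" using q by (simp add: power_le_one)
  have "x \<in> polydisc (2 * k - 2) r"
    if x: "x \<in> cspace (2 * k - 2)" and fx: "cross_cap k x \<in> polydisc (2 * k - 1) s" for x
  proof -
    have small: "norm (cross_cap k x i) < s" if "i \<in> {1..2 * k - 1}" for i
      using fx that by (auto simp: polydisc_def)
    have eq: "cross_cap k x i = x i" if "i \<in> {1..2 * k - 3}" for i
    proof (cases "i \<le> k - 2")
      case True
      then show ?thesis using that k by (auto simp: cross_cap_def target_tuple_def Let_def)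
    next
      case False
      have "k - 2 + nat (int i - (int k - 2)) = i" using False k by auto
      then show ?thesis using that k False
        by (auto simp: cross_cap_def target_tuple_def Let_def)
    qed
    have uv: "norm (x i) < s" if "i \<in> {1..2 * k - 3}" for i
      using small[of i] eq[of i] that by auto
    define y where "y = x (2 * k - 2)"
    define t where "t = norm y"
    define w where "w = cross_cap k x (2 * k - 2)"
    have w: "w = y ^ k + (\<Sum>i=1..k-2. x i * y ^ i)"
      using k by (auto simp: w_def y_def cross_cap_def target_tuple_def Let_def)
    have "2 * k - 2 \<in> {1..2 * k - 1}" using k by simp linarith
    then have w_small: "norm w < s" unfolding w_def by (rule small)
    define M where "M = max 1 (t ^ (k - 1))"
    have t0: "t \<ge> 0" by (simp add: t_def)
    have tM: "t ^ i \<le> M" if "i \<le> k - 2" for i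
    proof (cases "t \<le> 1")
      case True
      then have "t ^ i \<le> 1" using t0 by (simp add: power_le_one)
      then show ?thesis by (simp add: M_def)
    next
      case False
      then have "t ^ i \<le> t ^ (k - 1)" using that by (intro power_increasing) auto
      then show ?thesis by (auto simp: M_def)
    qed
    have M1: "M \<ge> 1" by (simp add: M_def)
    have "norm (\<Sum>i=1..k-2. x i * y ^ i) \<le> (\<Sum>i=1..k-2. s * M)"
    proof (rule sum_norm_le)
      fix i assume i: "i \<in> {1..k-2}"
      have "i \<in> {1..2 * k - 3}" using i k by simp linarith
      then have "norm (x i) \<le> s" using uv less_imp_le by blast
      then show "norm (x i * y ^ i) \<le> s * M"
        using tM[of i] i t0 s(1) by (auto simp: norm_mult norm_power t_def intro!: mult_mono)
    qed
    then have sum_le: "norm (\<Sum>i=1..k-2. x i * y ^ i) \<le> real (k - 2) * (s * M)" by simp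
    have "y ^ k = w - (\<Sum>i=1..k-2. x i * y ^ i)" using w by simp
    then have "t ^ k \<le> norm w + norm (\<Sum>i=1..k-2. x i * y ^ i)"
      using norm_triangle_ineq4[of w] by (simp add: t_def norm_power[symmetric])
    also have "\<dots> < s + real (k - 2) * (s * M)" using w_small sum_le by linarith
    also have "\<dots> \<le> s * M + real (k - 2) * (s * M)" using s(1) M1 by simp
    also have "\<dots> = real (k - 1) * s * M" using k by (simp add: of_nat_diff algebra_simps)
    also have "\<dots> \<le> real k * s * M" using s(1) M1 by (intro mult_right_mono) auto
    also have "\<dots> \<le> q ^ k * M" using s(3) M1 by (intro mult_right_mono) (auto simp: mult.commute)
    finally have tk: "t ^ k < q ^ k * M" .
    have "t < r"
    proof (cases "t \<le> 1")
      case True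
      then have "M = 1" using t0 by (simp add: M_def power_le_one max_absorb1)
      then have "t ^ k < q ^ k" using tk by simp
      then have "t < q" using q by (meson power_less_imp_less_base less_imp_le)
      then show ?thesis using q by simp
    next
      case False
      then have "M = t ^ (k - 1)" by (simp add: M_def one_le_power max_absorb2)
      then have "t ^ k < 1 * t ^ (k - 1)"
        using tk mult_right_mono[OF qk, of "t ^ (k - 1)"] t0 by simp
      moreover have "t ^ (k - 1) \<le> t ^ k" using False by (intro power_increasing) auto
      ultimately show ?thesis by simp
    qed
    then have y_small: "norm (x (2 * k - 2)) < r" by (simp add: t_def y_def)
    have "norm (x i) < r" if "i \<in> {1..2 * k - 2}" for i
    proof (cases "i = 2 * k - 2")
      case False
      then have "i \<in> {1..2 * k - 3}" using that by simp linarith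
      then show ?thesis using uv[of i] s(2) by linarith
    qed (use y_small in simp)
    then show ?thesis using x by (auto simp: polydisc_def)
  qed
  then show ?thesis using s(1) by (intro exI[of _ s]) (auto simp: cross_cap_image_def)
qed

section \<open>The vector fields\<close>

text \<open>
  The coordinates on the target, extended to all indices by the dummy variable convention:
  \<open>Uc k X (k - 1) = Vc k X k = 0\<close>, \<open>Uc k X k = 1\<close>, and \<open>0\<close> for all indices outside \<open>{1..k}\<close>.
\<close>

definition Uc :: "int \<Rightarrow> (nat \<Rightarrow> complex) \<Rightarrow> int \<Rightarrow> complex" where
  "Uc k X r = (if 1 \<le> r \<and> r \<le> k - 2 then X (nat r) else if r = k then 1 else 0)"

definition Vc :: "int \<Rightarrow> (nat \<Rightarrow> complex) \<Rightarrow> int \<Rightarrow> complex" where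
  "Vc k X r = (if 1 \<le> r \<and> r \<le> k - 1 then X (nat (k - 2 + r)) else 0)"

definition W1 :: "int \<Rightarrow> (nat \<Rightarrow> complex) \<Rightarrow> complex" where
  "W1 k X = X (nat (2 * k - 2))"

definition W2 :: "int \<Rightarrow> (nat \<Rightarrow> complex) \<Rightarrow> complex" where
  "W2 k X = X (nat (2 * k - 1))"

definition euler_field :: "int \<Rightarrow> vfield" where
  "euler_field k X = target_tuple k
     (\<lambda>i. of_int (k - i) * Uc k X i)
     (\<lambda>i. of_int (k - i) * Vc k X i)
     (of_int k * W1 k X)
     (of_int k * W2 k X)"

definition field1 :: "int \<Rightarrow> int \<Rightarrow> vfield" where
  "field1 k j X = target_tuple k
     (\<lambda>i. of_int ((k - i) * (k - j)) * Uc k X i * Uc k X j)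
     (\<lambda>i. of_int k * (\<Sum>r=1..i-1. Uc k X (i + j - r) * Vc k X r)
        - of_int k * (\<Sum>r=1..i. Uc k X r * Vc k X (i + j - r))
        - of_int ((i - 1) * (k - j)) * Uc k X j * Vc k X i
        + of_int k * Vc k X (i + j) * W1 k X
        - of_int k * Uc k X (i + j) * W2 k X)
     (of_int (k * (k - j)) * Uc k X j * W1 k X)
     (- of_int k * Vc k X j * W1 k X + of_int (k - j) * Uc k X j * W2 k X)"

definition field2 :: "int \<Rightarrow> int \<Rightarrow> vfield" where
  "field2 k j X = target_tuple k
     (\<lambda>i. - of_int (k * (k + i - j + 1)) * Uc k X (k + i - j + 1) * W1 k X
        + of_int k * (\<Sum>r=1..i. of_int (k + i - j - 2 * r + 1) * Uc k X r * Uc k X (k + i - j - r + 1))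
        - of_int (j * (i + 1)) * Uc k X (i + 1) * Uc k X (k - j))
     (\<lambda>i. - of_int (k * (k + i - j + 1)) * Vc k X (k + i - j + 1) * W1 k X
        + of_int k * (\<Sum>r=1..i. of_int (k + i - j - r + 1) * Uc k X r * Vc k X (k + i - j - r + 1))
        - of_int k * (\<Sum>r=1..i. of_int r * Uc k X (k + i - j - r + 1) * Vc k X r)
        - of_int (j * (i + 1)) * Uc k X (k - j) * Vc k X (i + 1))
     (of_int (k * (k - j + 1)) * Uc k X (k - j + 1) * W1 k X + of_int j * Uc k X 1 * Uc k X (k - j))
     (of_int (k * (k - j + 1)) * Vc k X (k - j + 1) * W1 k X + of_int j * Vc k X 1 * Uc k X (k - j))"

definition field3 :: "int \<Rightarrow> int \<Rightarrow> vfield" where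
  "field3 k j X = target_tuple k
     (\<lambda>i. - of_int (k * (k + i - j + 1)) * Uc k X (k + i - j + 1) * W2 k X
        + of_int k * (\<Sum>r=1..i. of_int (k + i - j - r + 1) * Uc k X (k + i - j - r + 1) * Vc k X r)
        - of_int k * (\<Sum>r=1..i. of_int r * Uc k X r * Vc k X (k + i - j - r + 1))
        - of_int (k * (i + 1)) * Uc k X (i + 1) * Vc k X (k - j))
     (\<lambda>i. - of_int (k * (k + i - j + 1)) * Vc k X (k + i - j + 1) * W2 k X
        + of_int k * (\<Sum>r=1..i. of_int (k + i - j - 2 * r + 1) * Vc k X r * Vc k X (k + i - j - r + 1))
        - of_int (k * (i + 1)) * Vc k X (i + 1) * Vc k X (k - j))
     (of_int (k * (k - j + 1)) * Uc k X (k - j + 1) * W2 k X + of_int k * Uc k X 1 * Vc k X (k - j))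
     (of_int (k * (k - j + 1)) * Vc k X (k - j + 1) * W2 k X + of_int k * Vc k X 1 * Vc k X (k - j))"

definition cross_cap_fields :: "nat \<Rightarrow> vfield set" where
  "cross_cap_fields k =
     {euler_field (int k)} \<union> (\<Union>j\<in>{1..int k - 1}. {field1 (int k) j, field2 (int k) j, field3 (int k) j})"

end

theory Submission
  imports Defs "HOL-Complex_Analysis.Complex_Analysis" "Jordan_Normal_Form.Char_Poly"
begin

text \<open>
  Write \<open>P = y\<^bsup>k\<^esup> + \<Sum> u\<^sub>i y\<^bsup>i\<^esup>\<close> and \<open>Q = \<Sum> v\<^sub>i y\<^bsup>i\<^esup>\<close>. A field \<open>(a, b, c)\<close> lifts iff
  \<open>c\<^sub>1 - \<Sum> a\<^sub>i y\<^bsup>i\<^esup> = P' g\<close> and \<open>c\<^sub>2 - \<Sum> b\<^sub>i y\<^bsup>i\<^esup> = Q' g\<close> on the source for some germ \<open>g\<close>. Adding \<open>W\<^sub>2\<close> as a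
  free variable turns this into
  \<open>c\<^sub>1 - \<Sum> a\<^sub>i y\<^bsup>i\<^esup> = P' g + (W\<^sub>2 - Q) h\<^sub>1\<close> and \<open>c\<^sub>2 - \<Sum> b\<^sub>i y\<^bsup>i\<^esup> = Q' g + (W\<^sub>2 - Q) h\<^sub>2\<close>
  over the germs in \<open>(u, v, y, W\<^sub>2)\<close>, which by Weierstrass division form a free module with basis
  \<open>1, y, \<dots>, y\<^bsup>k-1\<^esup>\<close> over the germs on the target. Each generator corresponds to an explicit triple
  \<open>(g, h\<^sub>1, h\<^sub>2)\<close> of polynomials in \<open>y\<close>, and these triples together with the Koszul relation
  \<open>(W\<^sub>2 - Q, - P', - Q')\<close> and \<open>(1, 0, 0)\<close> are triangular with respect to the monomial basis of all triples.
  The multiples of \<open>(1, 0, 0)\<close> are excluded by the coefficient of \<open>y\<^bsup>k-1\<^esup>\<close> in \<open>P'\<close>.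

  A field tangent to the image annihilates an equation of the image, obtained from the characteristic
  polynomial of multiplication by \<open>Q\<close>; comparing with the derivative of this equation along the
  parametrization gives \<open>(c\<^sub>1 - \<Sum> a\<^sub>i y\<^bsup>i\<^esup>) Q' = (c\<^sub>2 - \<Sum> b\<^sub>i y\<^bsup>i\<^esup>) P'\<close>, and the field lifts because \<open>P', Q'\<close> is a
  regular sequence.
\<close>

section \<open>Analytic germs as bounded separately holomorphic functions\<close>

text \<open>The germs on the source of \<open>cross_cap\<close> are finitely generated but not free
  over those on the target, whose dimension is larger by one. With \<open>W2\<close> as a free
  variable both dimensions agree and the module becomes free; the price is the pair of unknowns
  \<open>h1\<close>, \<open>h2\<close>. The triples then have rank \<open>3 * k\<close>, matched by
  the \<open>3 * (k - 1) + 1\<close> fields, the Koszul relation and \<open>(1, 0, 0)\<close>. The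
  second family and \<open>(1, 0, 0)\<close> supply the powers of \<open>y\<close> in the slot of
  \<open>g\<close>, the Euler field and the first family those in the slot of \<open>h2\<close>, the
  third family and the Koszul relation those in the slot of \<open>h1\<close>. All leading
  coefficients are nonzero constants.

  For tangent fields an equation of the image helps only if its \<open>W2\<close>-derivative is not
  identically zero there. The successive derivatives of the characteristic polynomial end in a
  nonzero constant, so the one just before the first that does not vanish on the image has this
  property.

  Quotients, composites and division are awkward on the level of coefficients; hence analyticity is
  mostly tested by boundedness and holomorphy in each variable.\<close>

definition at_0 :: "nat \<Rightarrow> (nat \<Rightarrow> complex) filter" where
  "at_0 n = (INF r\<in>{0<..}. principal (polydisc n r))"

lemma polydisc_mono: "r \<le> s \<Longrightarrow> polydisc n r \<subseteq> polydisc n s"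
  by (fastforce simp: polydisc_def)

text \<open>In filter form, finitely many germ identities combine by \<open>eventually_elim\<close>,
  and pulling them back along a map becomes a \<open>filterlim\<close> statement. The filter is not
  punctured: the centre lies in every polydisc.\<close>

lemma near_0_eventually: "near_0 n P \<longleftrightarrow> eventually P (at_0 n)"
proof -
  have "eventually P (at_0 n) \<longleftrightarrow> (\<exists>r\<in>{0<..}. eventually P (principal (polydisc n r)))"
    unfolding at_0_def
  proof (rule eventually_INF_base)
    fix a b :: real assume "a \<in> {0<..}" "b \<in> {0<..}"
    then show "\<exists>x\<in>{0<..}. principal (polydisc n x) \<le> inf (principal (polydisc n a)) (principal (polydisc n b))"
      using polydisc_mono[of "min a b" a n] polydisc_mono[of "min a b" b n]
      by (intro bexI[of _ "min a b"]) auto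
  qed auto
  then show ?thesis by (auto simp: near_0_def eventually_principal)
qed

lemma eventually_at_0: "eventually P (at_0 n) \<longleftrightarrow> (\<exists>r>0. \<forall>x\<in>polydisc n r. P x)"
  using near_0_eventually[of n P] by (simp add: near_0_def)

lemma eventually_polydisc: "r > 0 \<Longrightarrow> eventually (\<lambda>x. x \<in> polydisc n r) (at_0 n)"
  by (auto simp: eventually_at_0)

lemma polydisc_update:
  "x \<in> polydisc n r \<Longrightarrow> i \<in> {1..n} \<Longrightarrow> norm t < r \<Longrightarrow> x(i := t) \<in> polydisc n r"
  by (auto simp: polydisc_def cspace_def)

lemma zero_in_polydisc: "r > 0 \<Longrightarrow> (\<lambda>_. 0) \<in> polydisc n r"
  by (auto simp: polydisc_def cspace_def)

lemma polydisc_norm: "x \<in> polydisc n r \<Longrightarrow> r > 0 \<Longrightarrow> norm (x i) < r"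
  by (cases "i \<in> {1..n}") (auto simp: polydisc_def cspace_def)

lemma polydisc_Suc: "polydisc n r \<subseteq> polydisc (Suc n) r" if "r > 0"
proof
  fix x assume x: "x \<in> polydisc n r"
  then have "x \<in> cspace (Suc n)" by (auto simp: polydisc_def cspace_def)
  then show "x \<in> polydisc (Suc n) r"
    using polydisc_norm[OF x that] by (simp add: polydisc_def)
qed

text \<open>The majorant \<open>M\<close> makes the finite partial sums converge uniformly on a
  closed disc around \<open>t\<close>; locally uniform limits of holomorphic functions may be
  differentiated termwise, also along the net of finite subsets.\<close>

lemma has_sum_has_field_derivative:
  fixes F F' :: "'a \<Rightarrow> complex \<Rightarrow> complex"
  assumes S: "open S" "t \<in> S" and M: "M summable_on I"
    and deriv: "\<And>a s. a \<in> I \<Longrightarrow> s \<in> S \<Longrightarrow> (F a has_field_derivative F' a s) (at s)"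
    and bound: "\<And>a s. a \<in> I \<Longrightarrow> s \<in> S \<Longrightarrow> norm (F a s) \<le> M a"
    and sum: "\<And>s. s \<in> S \<Longrightarrow> ((\<lambda>a. F a s) has_sum f s) I"
  obtains f' where "(f has_field_derivative f') (at t)" "((\<lambda>a. F' a t) has_sum f') I"
proof -
  obtain e where e: "e > 0" "cball t e \<subseteq> S" using S open_contains_cball by blast
  have ul: "uniform_limit (cball t e) (\<lambda>X s. \<Sum>a\<in>X. F a s) f (finite_subsets_at_top I)"
    by (rule Weierstrass_m_test_general'[OF _ _ M]) (use e bound sum in auto)
  have "((\<lambda>s. \<Sum>a\<in>X. F a s) has_field_derivative (\<Sum>a\<in>X. F' a w)) (at w)"
    if "X \<subseteq> I" "w \<in> cball t e" for X w
    using that e by (intro DERIV_sum deriv) auto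
  moreover from this have "continuous_on (cball t e) (\<lambda>s. \<Sum>a\<in>X. F a s)" if "X \<subseteq> I" for X
    using that by (meson DERIV_isCont continuous_at_imp_continuous_on)
  ultimately have ev: "eventually (\<lambda>X. continuous_on (cball t e) (\<lambda>s. \<Sum>a\<in>X. F a s) \<and>
     (\<forall>w\<in>ball t e. ((\<lambda>s. \<Sum>a\<in>X. F a s) has_field_derivative (\<Sum>a\<in>X. F' a w)) (at w)))
     (finite_subsets_at_top I)"
    by (intro eventually_finite_subsets_at_top_weakI) auto
  obtain g' where g': "\<And>w. w \<in> ball t e \<Longrightarrow> (f has_field_derivative (g' w)) (at w) \<and>
      ((\<lambda>X. \<Sum>a\<in>X. F' a w) \<longlongrightarrow> g' w) (finite_subsets_at_top I)"
    by (rule has_complex_derivative_uniform_limit[OF ev ul _ e(1)]) auto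
  show ?thesis
    using that[of "g' t"] g'[of t] e(1) by (auto simp: has_sum_def)
qed

lemma holomorphic_on_has_sum:
  fixes F :: "'a \<Rightarrow> complex \<Rightarrow> complex"
  assumes S: "open S" and M: "M summable_on I"
    and hol: "\<And>a. a \<in> I \<Longrightarrow> F a holomorphic_on S"
    and bound: "\<And>a s. a \<in> I \<Longrightarrow> s \<in> S \<Longrightarrow> norm (F a s) \<le> M a"
    and sum: "\<And>s. s \<in> S \<Longrightarrow> ((\<lambda>a. F a s) has_sum f s) I"
  shows "f holomorphic_on S"
proof -
  have "\<exists>f'. (f has_field_derivative f') (at t)" if t: "t \<in> S" for t
  proof -
    have d: "(F a has_field_derivative deriv (F a) s) (at s)" if "a \<in> I" "s \<in> S" for a s
      using hol[OF that(1)] S that(2) by (rule holomorphic_derivI)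
    obtain f' where "(f has_field_derivative f') (at t)"
      by (rule has_sum_has_field_derivative[OF S t M d bound sum]) auto
    then show ?thesis ..
  qed
  then show ?thesis by (metis S field_differentiable_def holomorphic_on_open)
qed

text \<open>A substitute for joint analyticity that only speaks of one variable at a time. The bound
  is part of the notion because Cauchy estimates and majorants for series of such functions depend
  on it.\<close>

definition bholo :: "nat \<Rightarrow> real \<Rightarrow> real \<Rightarrow> ((nat \<Rightarrow> complex) \<Rightarrow> complex) \<Rightarrow> bool" where
  "bholo n r M f \<longleftrightarrow> (\<forall>x\<in>polydisc n r. norm (f x) \<le> M \<and>
     (\<forall>i\<in>{1..n}. (\<lambda>t. f (x(i := t))) holomorphic_on ball 0 r))"

lemma bholoD:
  assumes "bholo n r M f" "x \<in> polydisc n r"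
  shows "norm (f x) \<le> M"
    and "i \<in> {1..n} \<Longrightarrow> (\<lambda>t. f (x(i := t))) holomorphic_on ball 0 r"
  using assms by (auto simp: bholo_def)

text \<open>The bounds \<open>M a\<close> serve as a majorant that is uniform on the polydisc. This
  is how the coefficients in the division theorem become analytic.\<close>

lemma bholo_has_sum:
  assumes F: "\<And>a. a \<in> I \<Longrightarrow> bholo n r (M a) (F a)" and M: "M summable_on I"
    and sum: "\<And>x. x \<in> polydisc n r \<Longrightarrow> ((\<lambda>a. F a x) has_sum f x) I"
  shows "bholo n r (infsum M I) f"
  unfolding bholo_def
proof (intro ballI conjI)
  fix x assume x: "x \<in> polydisc n r"
  show "norm (f x) \<le> infsum M I"
  proof -
    have "(M has_sum infsum M I) I" using M by simp
    then show ?thesis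
      by (rule norm_infsum_le[OF sum[OF x]]) (rule bholoD(1)[OF F x])
  qed
  fix i assume i: "i \<in> {1..n}"
  show "(\<lambda>t. f (x(i := t))) holomorphic_on ball 0 r"
  proof (rule holomorphic_on_has_sum[OF _ M])
    show "(\<lambda>t. F a (x(i := t))) holomorphic_on ball 0 r" if "a \<in> I" for a
      using bholoD(2)[OF F[OF that] x i] .
    show "norm (F a (x(i := s))) \<le> M a" if "a \<in> I" "s \<in> ball 0 r" for a s
      using bholoD(1)[OF F[OF that(1)] polydisc_update[OF x i]] that by auto
    show "((\<lambda>a. F a (x(i := s))) has_sum f (x(i := s))) I" if "s \<in> ball 0 r" for s
      using sum polydisc_update[OF x i] that by auto
  qed auto
qed

lemma norm_monomial_le:
  assumes "x \<in> polydisc n r"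
  shows "norm (\<Prod>i=1..n. x i ^ \<alpha> i :: complex) \<le> (\<Prod>i=1..n. r ^ \<alpha> i)"
  unfolding prod_norm[symmetric] norm_power
  using assms by (intro prod_mono conjI power_mono) (auto simp: polydisc_def less_imp_le)

lemma bholo_monomial:
  "bholo n r (norm c * (\<Prod>i=1..n. r ^ \<alpha> i)) (\<lambda>x. c * (\<Prod>i=1..n. x i ^ \<alpha> i))"
  unfolding bholo_def
proof (intro ballI conjI)
  fix x assume "x \<in> polydisc n r"
  then show "norm (c * (\<Prod>i=1..n. x i ^ \<alpha> i)) \<le> norm c * (\<Prod>i=1..n. r ^ \<alpha> i)"
    unfolding norm_mult by (intro mult_left_mono norm_monomial_le) auto
  fix j assume "j \<in> {1..n}"
  have "(\<lambda>t. (x(j := t)) i) holomorphic_on ball 0 r" for i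
    by (cases "i = j") (auto intro: holomorphic_intros)
  then show "(\<lambda>t. c * (\<Prod>i=1..n. (x(j := t)) i ^ \<alpha> i)) holomorphic_on ball 0 r"
    by (intro holomorphic_intros)
qed

text \<open>Evaluating at the point \<open>(r, \<dots>, r)\<close> yields absolute convergence on the polydisc of radius \<open>r\<close>.\<close>

lemma power_series_abs_summable:
  assumes R: "\<And>x. x \<in> polydisc n R \<Longrightarrow> ((\<lambda>\<alpha>. c \<alpha> * (\<Prod>i=1..n. x i ^ \<alpha> i)) has_sum f x) (multi_indices n)"
    and r: "0 < r" "r < R"
  shows "(\<lambda>\<alpha>. norm (c \<alpha>) * (\<Prod>i=1..n. r ^ \<alpha> i)) summable_on multi_indices n"
proof -
  define p :: "nat \<Rightarrow> complex" where "p = (\<lambda>i. if i \<in> {1..n} then of_real r else 0)"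
  have "p \<in> polydisc n R" using r by (auto simp: p_def polydisc_def cspace_def)
  then have "(\<lambda>\<alpha>. c \<alpha> * (\<Prod>i=1..n. p i ^ \<alpha> i)) summable_on multi_indices n"
    using R has_sum_imp_summable by blast
  then have "(\<lambda>\<alpha>. norm (c \<alpha> * (\<Prod>i=1..n. p i ^ \<alpha> i))) summable_on multi_indices n"
    by (simp add: summable_on_iff_abs_summable_on_complex)
  moreover have "norm (c \<alpha> * (\<Prod>i=1..n. p i ^ \<alpha> i)) = norm (c \<alpha>) * (\<Prod>i=1..n. r ^ \<alpha> i)" for \<alpha>
    using r by (simp add: norm_mult prod_norm[symmetric] norm_power p_def)
  ultimately show ?thesis by simp
qed

lemma bholo_power_series:
  assumes R: "\<And>x. x \<in> polydisc n R \<Longrightarrow> ((\<lambda>\<alpha>. c \<alpha> * (\<Prod>i=1..n. x i ^ \<alpha> i)) has_sum f x) (multi_indices n)"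
    and r: "0 < r" "r < R"
  shows "\<exists>M. bholo n r M f"
proof -
  have "bholo n r (infsum (\<lambda>\<alpha>. norm (c \<alpha>) * (\<Prod>i=1..n. r ^ \<alpha> i)) (multi_indices n)) f"
    using bholo_monomial power_series_abs_summable[OF R r] R polydisc_mono[of r R n] r
    by (intro bholo_has_sum) auto
  then show ?thesis ..
qed

text \<open>Cauchy's estimate on discs of radius \<open>r / 4\<close> around points of
  \<open>cball 0 (r / 2)\<close>, which stay inside \<open>ball 0 r\<close>. The estimate wants the
  values in an open ball, hence \<open>M + 1\<close>.\<close>

lemma bounded_holomorphic_lipschitz:
  assumes h: "h holomorphic_on ball 0 r" and M: "\<And>t. t \<in> ball 0 r \<Longrightarrow> norm (h t) \<le> M"
    and r: "r > 0"
  shows "norm (deriv h 0) \<le> 4 * (M + 1) / r"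
    and "norm s \<le> r / 2 \<Longrightarrow> norm (h s - h 0) \<le> 4 * (M + 1) / r * norm s"
proof -
  have d: "norm (deriv h z) \<le> 4 * (M + 1) / r" if z: "norm z \<le> r / 2" for z
  proof -
    have sub: "cball z (r/4) \<subseteq> ball 0 r"
    proof
      fix w assume "w \<in> cball z (r/4)"
      then have "norm (w - z) \<le> r/4" by (simp add: dist_norm norm_minus_commute)
      then have "norm w \<le> r/2 + r/4" using z norm_triangle_sub[of w z] by simp
      then show "w \<in> ball 0 r" using r by simp
    qed
    have "norm ((deriv ^^ 1) h z) \<le> fact 1 * (M + 1) / (r/4) ^ 1"
    proof (rule Cauchy_higher_deriv_bound[where y=0])
      show "h holomorphic_on ball z (r/4)"
        using h holomorphic_on_subset ball_subset_cball sub by blast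
      show "continuous_on (cball z (r/4)) h"
        using h holomorphic_on_imp_continuous_on continuous_on_subset sub by blast
      fix w assume "w \<in> ball z (r/4)"
      then have "w \<in> ball 0 r" using ball_subset_cball sub by blast
      then show "h w \<in> ball 0 (M + 1)" using M[of w] by simp
    qed (use r in auto)
    then show ?thesis by (simp add: field_simps)
  qed
  show "norm (deriv h 0) \<le> 4 * (M + 1) / r" using d[of 0] r by simp
  assume s: "norm s \<le> r / 2"
  have "norm (h s - h 0) \<le> 4 * (M + 1) / r * norm (s - 0)"
  proof (rule field_differentiable_bound[where S="cball 0 (r/2)" and f'="deriv h"])
    fix z :: complex assume "z \<in> cball 0 (r/2)"
    then have "norm z \<le> r/2" by simp
    then show "norm (deriv h z) \<le> 4 * (M + 1) / r" by (rule d)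
    have "norm z < r" using \<open>norm z \<le> r/2\<close> r by linarith
    then show "(h has_field_derivative deriv h z) (at z within cball 0 (r / 2))"
      using holomorphic_derivI[OF h open_ball] by (simp add: has_field_derivative_at_within)
  next
    show "s \<in> cball 0 (r/2)" using s by simp
    show "0 \<in> cball (0::complex) (r/2)" using r by simp
  qed simp
  then show "norm (h s - h 0) \<le> 4 * (M + 1) / r * norm s" by simp
qed

text \<open>The quotient \<open>(f x - f (x(i := 0))) / x i\<close>, continued holomorphically across \<open>x i = 0\<close>.\<close>

definition coord_quot :: "nat \<Rightarrow> ((nat \<Rightarrow> complex) \<Rightarrow> complex) \<Rightarrow> (nat \<Rightarrow> complex) \<Rightarrow> complex" where
  "coord_quot i f x = (if x i = 0 then deriv (\<lambda>t. f (x(i := t))) 0 else (f x - f (x(i := 0))) / x i)"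

lemma coord_quot_eq: "f x = f (x(i := 0)) + x i * coord_quot i f x"
  by (cases "x i = 0") (auto simp: coord_quot_def fun_upd_idem)

lemma coord_quot_holomorphic_same:
  assumes "(\<lambda>t. f (x(i := t))) holomorphic_on ball 0 r"
  shows "(\<lambda>t. coord_quot i f (x(i := t))) holomorphic_on ball 0 r"
proof -
  let ?g = "\<lambda>t. f (x(i := t))"
  have "(\<lambda>z. if z = 0 then deriv ?g 0 else ?g z / z - ?g 0 / (z - 0)) holomorphic_on ball 0 r"
    by (rule pole_theorem_open[OF assms]) auto
  moreover have "(\<lambda>z. if z = 0 then deriv ?g 0 else ?g z / z - ?g 0 / (z - 0)) = (\<lambda>t. coord_quot i f (x(i := t)))"
    by (auto simp: coord_quot_def diff_divide_distrib)
  ultimately show ?thesis by simp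
qed

text \<open>Where \<open>norm (x i) \<le> r / 2\<close> the Lipschitz estimate bounds the difference
  quotient; farther out the numerator is at most \<open>2 * M\<close> and dividing by
  \<open>x i\<close> costs at most \<open>2 / r\<close>.\<close>

lemma coord_quot_bound:
  assumes f: "bholo n r M f" and i: "i \<in> {1..n}" and x: "x \<in> polydisc n r" and r: "r > 0"
  shows "norm (coord_quot i f x) \<le> 4 * (M + 1) / r"
proof -
  let ?g = "\<lambda>t. f (x(i := t))"
  have g: "?g holomorphic_on ball 0 r" using bholoD(2)[OF f x i] .
  have gM: "norm (?g t) \<le> M" if "t \<in> ball 0 r" for t
    using bholoD(1)[OF f polydisc_update[OF x i]] that by auto
  have xg: "?g (x i) = f x" by (simp add: fun_upd_idem)
  have xr: "norm (x i) < r" using x r polydisc_norm by auto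
  have b1: "norm (deriv ?g 0) \<le> 4 * (M + 1) / r"
    by (rule bounded_holomorphic_lipschitz(1)[OF g _ r]) (rule gM)
  have b2: "norm (?g s - ?g 0) \<le> 4 * (M + 1) / r * norm s" if "norm s \<le> r / 2" for s
    by (rule bounded_holomorphic_lipschitz(2)[OF g _ r that]) (rule gM)
  show ?thesis
  proof (cases "x i = 0")
    case True
    then show ?thesis using b1 by (simp add: coord_quot_def)
  next
    case False
    have "norm (f x - ?g 0) \<le> 4 * (M + 1) / r * norm (x i)"
    proof (cases "norm (x i) \<le> r / 2")
      case True
      then show ?thesis using b2[OF True] xg by simp
    next
      case far: False
      have M0: "0 \<le> M" using gM[of 0] r norm_ge_zero order_trans by (metis centre_in_ball)
      have "norm (f x - ?g 0) \<le> 2 * M"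
        using norm_triangle_ineq4[of "f x" "?g 0"] gM[of 0] gM[of "x i"] xg r xr by simp
      also have "\<dots> \<le> 4 * (M + 1) / r * (r / 2)" using r by (simp add: field_simps)
      also have "\<dots> \<le> 4 * (M + 1) / r * norm (x i)"
        using far r M0 by (intro mult_left_mono) auto
      finally show ?thesis .
    qed
    then show ?thesis using False by (simp add: coord_quot_def norm_divide divide_le_eq)
  qed
qed

text \<open>The delicate case is holomorphy in a variable \<open>l\<close> other than
  \<open>i\<close> at a point with \<open>x i = 0\<close>, where the value is a derivative. It is
  the limit of genuine quotients with \<open>x i\<close> nonzero, and the limit is uniform in the
  variable \<open>l\<close> because the bound on \<open>coord_quot\<close> gives a Lipschitz
  constant independent of it.\<close>

lemma bholo_coord_quot:
  assumes f: "bholo n r M f" and i: "i \<in> {1..n}" and r: "r > 0"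
  shows "bholo n r (4 * (M + 1) / r) (coord_quot i f)"
  unfolding bholo_def
proof (intro ballI conjI)
  fix x assume x: "x \<in> polydisc n r"
  show "norm (coord_quot i f x) \<le> 4 * (M + 1) / r" by (rule coord_quot_bound[OF f i x r])
  fix l assume l: "l \<in> {1..n}"
  show "(\<lambda>t. coord_quot i f (x(l := t))) holomorphic_on ball 0 r"
  proof (cases "l = i")
    case True
    then show ?thesis using coord_quot_holomorphic_same bholoD(2)[OF f x i] by simp
  next
    case li: False
    have hol: "(\<lambda>t. f (x(l := t, i := s))) holomorphic_on ball 0 r" if "norm s < r" for s
      using bholoD(2)[OF f polydisc_update[OF x i that] l] li by (simp add: fun_upd_twist)
    have quot: "(\<lambda>t. coord_quot i f (x(l := t, i := s))) holomorphic_on ball 0 r" if "norm s < r" "s \<noteq> 0" for s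
      using that hol[OF that(1)] hol[of 0] r
      by (auto simp: coord_quot_def intro!: holomorphic_intros)
    show ?thesis
    proof (cases "x i = 0")
      case False
      have "norm (x i) < r" using x r polydisc_norm by auto
      from quot[OF this False] show ?thesis
        using li by (simp add: fun_upd_twist fun_upd_idem)
    next
      case True
      define M' where "M' = 4 * (M + 1) / r"
      \<comment> \<open>Nonzero values of the \<open>i\<close>-th coordinate tending to 0 and
        staying within \<open>r / 2\<close>, where the Lipschitz estimate is valid.\<close>
      define s where "s N = complex_of_real (r / 2) / of_nat (Suc N)" for N
      have sr: "norm (s N) \<le> r / 2" for N
      proof -
        have "norm (s N) = (r / 2) / real (Suc N)"
          using r by (simp add: s_def norm_divide del: of_nat_Suc)
        also have "\<dots> \<le> (r / 2) / 1" using r by (intro divide_left_mono) auto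
        finally show ?thesis by simp
      qed
      have s0: "s N \<noteq> 0" for N using r by (simp add: s_def del: of_nat_Suc)
      have lim: "s \<longlonglongrightarrow> 0"
        unfolding s_def using LIMSEQ_Suc[OF lim_const_over_n[of "complex_of_real (r / 2)"]] .
      have close: "norm (coord_quot i f (x(l := t, i := s N)) - coord_quot i f (x(l := t)))
          \<le> 4 * (M' + 1) / r * norm (s N)" if t: "norm t < r" for t N
      proof -
        have xt: "x(l := t) \<in> polydisc n r" using polydisc_update[OF x l t] .
        have 1: "(\<lambda>z. coord_quot i f (x(l := t, i := z))) holomorphic_on ball 0 r"
          using coord_quot_holomorphic_same bholoD(2)[OF f xt i] by blast
        have "norm (coord_quot i f (x(l := t, i := s N)) - coord_quot i f (x(l := t, i := 0)))
          \<le> 4 * (M' + 1) / r * norm (s N)"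
        proof (rule bounded_holomorphic_lipschitz(2)[OF 1 _ r sr])
          fix z :: complex assume "z \<in> ball 0 r"
          then show "norm (coord_quot i f (x(l := t, i := z))) \<le> M'"
            using coord_quot_bound[OF f i polydisc_update[OF xt i] r] by (simp add: M'_def)
        qed
        moreover have "x(l := t, i := 0) = x(l := t)" using True li by auto
        ultimately show ?thesis by simp
      qed
      have unif: "uniform_limit (ball 0 r) (\<lambda>N t. coord_quot i f (x(l := t, i := s N)))
          (\<lambda>t. coord_quot i f (x(l := t))) sequentially"
      proof (rule uniform_limitI)
        fix e :: real assume e: "e > 0"
        have "(\<lambda>N. 4 * (M' + 1) / r * norm (s N)) \<longlonglongrightarrow> 0"
          using tendsto_mult_right_zero[OF tendsto_norm_zero[OF lim]] .
        then have "eventually (\<lambda>N. 4 * (M' + 1) / r * norm (s N) < e) sequentially"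
          using e by (rule order_tendstoD)
        then show "\<forall>\<^sub>F N in sequentially. \<forall>t\<in>ball 0 r.
           dist (coord_quot i f (x(l := t, i := s N))) (coord_quot i f (x(l := t))) < e"
        proof (rule eventually_mono, intro ballI)
          fix N t assume *: "4 * (M' + 1) / r * norm (s N) < e" and "t \<in> ball (0::complex) r"
          then have "norm t < r" by simp
          from order_le_less_trans[OF close[OF this] *]
          show "dist (coord_quot i f (x(l := t, i := s N))) (coord_quot i f (x(l := t))) < e"
            unfolding dist_norm .
        qed
      qed
      show ?thesis
      proof (rule holomorphic_uniform_sequence)
        show "(\<lambda>t. coord_quot i f (x(l := t, i := s N))) holomorphic_on ball 0 r" for N
          using quot[OF _ s0] sr[of N] r by force
        fix z :: complex assume "z \<in> ball 0 r"
        then obtain d where "d > 0" "cball z d \<subseteq> ball 0 r"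
          using open_contains_cball[of "ball (0::complex) r"] open_ball by blast
        then show "\<exists>d>0. cball z d \<subseteq> ball 0 r \<and>
           uniform_limit (cball z d) (\<lambda>N t. coord_quot i f (x(l := t, i := s N)))
             (\<lambda>t. coord_quot i f (x(l := t))) sequentially"
          using uniform_limit_on_subset[OF unif] by blast
      qed auto
    qed
  qed
qed

lemma bholo_cong:
  assumes "bholo n r M f" "\<And>x. x \<in> polydisc n r \<Longrightarrow> f x = g x"
  shows "bholo n r M g"
  unfolding bholo_def
proof (intro ballI conjI)
  fix x assume x: "x \<in> polydisc n r"
  show "norm (g x) \<le> M" using bholoD(1)[OF assms(1) x] assms(2)[OF x] by simp
  fix i assume i: "i \<in> {1..n}"
  have "f (x(i := t)) = g (x(i := t))" if "t \<in> ball 0 r" for t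
    using assms(2)[OF polydisc_update[OF x i]] that by simp
  then show "(\<lambda>t. g (x(i := t))) holomorphic_on ball 0 r"
    by (rule holomorphic_transform[OF bholoD(2)[OF assms(1) x i]])
qed

lemma bholo_subset:
  assumes "bholo n r M f" "s \<le> r" shows "bholo n s M f"
  unfolding bholo_def
proof (intro ballI conjI)
  fix x assume "x \<in> polydisc n s"
  then have x: "x \<in> polydisc n r" using polydisc_mono assms(2) by blast
  show "norm (f x) \<le> M" using bholoD(1)[OF assms(1) x] .
  fix i assume "i \<in> {1..n}"
  then show "(\<lambda>t. f (x(i := t))) holomorphic_on ball 0 s"
    using bholoD(2)[OF assms(1) x] assms(2) by (meson holomorphic_on_subset subset_ball)
qed

lemma bholo_fewer_vars:
  assumes "bholo (Suc n) r M f" "r > 0" shows "bholo n r M f"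
  using assms polydisc_Suc[OF assms(2), of n] by (fastforce simp: bholo_def)

lemma bholo_restrict:
  assumes f: "bholo n r M f" and i: "i \<in> {1..n}" and r: "r > 0"
  shows "bholo n r M (\<lambda>x. f (x(i := 0)))"
  unfolding bholo_def
proof (intro ballI conjI)
  fix x assume x: "x \<in> polydisc n r"
  have x0: "x(i := 0) \<in> polydisc n r" using polydisc_update[OF x i, of 0] r by simp
  show "norm (f (x(i := 0))) \<le> M" using bholoD(1)[OF f x0] .
  fix l assume l: "l \<in> {1..n}"
  show "(\<lambda>t. f ((x(l := t))(i := 0))) holomorphic_on ball 0 r"
    using bholoD(2)[OF f x0 l] by (cases "l = i") (auto simp: fun_upd_twist)
qed

section \<open>Taylor coefficients in one variable and the resulting power series in several
  variables\<close>

definition taylor_coeff :: "nat \<Rightarrow> nat \<Rightarrow> ((nat \<Rightarrow> complex) \<Rightarrow> complex) \<Rightarrow> (nat \<Rightarrow> complex) \<Rightarrow> complex" where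
  "taylor_coeff i m f x = (deriv ^^ m) (\<lambda>t. f (x(i := t))) 0 / fact m"

lemma taylor_coeff_update [simp]: "taylor_coeff i m f (x(i := t)) = taylor_coeff i m f x"
  by (simp add: taylor_coeff_def)

text \<open>Comparing coefficients in \<open>g t = g 0 + t * h t\<close> shifts the index by one. By
  iteration, holomorphy of the coefficients in the remaining variables is inherited from
  \<open>coord_quot\<close>.\<close>

lemma taylor_coeff_Suc:
  assumes hol: "(\<lambda>t. f (x(i := t))) holomorphic_on ball 0 r" and r: "r > 0"
  shows "taylor_coeff i (Suc m) f x = taylor_coeff i m (coord_quot i f) x"
proof -
  let ?g = "\<lambda>t. f (x(i := t))" and ?h = "\<lambda>t. coord_quot i f (x(i := t))"
  have h: "?h has_fps_expansion fps_expansion ?h 0"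
    using coord_quot_holomorphic_same[OF hol] r by (intro has_fps_expansion_fps_expansion[of "ball 0 r"]) auto
  have g: "?g has_fps_expansion fps_expansion ?g 0"
    using hol r by (intro has_fps_expansion_fps_expansion[of "ball 0 r"]) auto
  have "(\<lambda>t. ?g 0 + t * ?h t) has_fps_expansion fps_const (?g 0) + fps_X * fps_expansion ?h 0"
    by (intro fps_expansion_intros h)
  moreover have "(\<lambda>t. ?g 0 + t * ?h t) = ?g"
  proof
    fix t show "?g 0 + t * ?h t = ?g t" using coord_quot_eq[of f "x(i := t)" i] by simp
  qed
  ultimately have "fps_expansion ?g 0 = fps_const (?g 0) + fps_X * fps_expansion ?h 0"
    using fps_expansion_unique_complex[OF g] by simp
  then have "fps_nth (fps_expansion ?g 0) (Suc m) = fps_nth (fps_expansion ?h 0) m" by simp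
  then show ?thesis by (simp add: fps_expansion_def taylor_coeff_def del: funpow.simps)
qed

lemma taylor_coeff_bound:
  assumes f: "bholo n r M f" and i: "i \<in> {1..n}" and x: "x \<in> polydisc n r" and \<rho>: "0 < \<rho>" "\<rho> < r"
  shows "norm (taylor_coeff i m f x) \<le> M / \<rho> ^ m"
proof -
  let ?g = "\<lambda>t. f (x(i := t))"
  have sub: "cball 0 \<rho> \<subseteq> ball (0::complex) r" using \<rho> by auto
  have hol: "?g holomorphic_on ball 0 r" using bholoD(2)[OF f x i] .
  have "norm ((deriv ^^ m) ?g 0) \<le> fact m * M / \<rho> ^ m"
  proof (rule Cauchy_inequality)
    show "?g holomorphic_on ball 0 \<rho>" using hol \<rho> by (meson holomorphic_on_subset less_imp_le subset_ball)
    show "continuous_on (cball 0 \<rho>) ?g"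
      using hol holomorphic_on_imp_continuous_on continuous_on_subset sub by blast
    fix t :: complex assume "norm (0 - t) = \<rho>"
    then show "norm (?g t) \<le> M" using bholoD(1)[OF f polydisc_update[OF x i]] \<rho> by simp
  qed (use \<rho> in auto)
  then show ?thesis by (simp add: taylor_coeff_def norm_divide divide_le_eq field_simps)
qed

lemma bholo_taylor_coeff_ex:
  assumes f: "bholo n r M f" and i: "i \<in> {1..n}" and r: "r > 0"
  shows "\<exists>M'. bholo n r M' (taylor_coeff i m f)"
  using f
proof (induction m arbitrary: f M)
  case 0
  have "taylor_coeff i 0 f = (\<lambda>x. f (x(i := 0)))" by (auto simp: taylor_coeff_def)
  then show ?case using bholo_restrict[OF 0 i r] by (auto simp del: fun_upd_apply)
next
  case (Suc m)
  obtain M' where M': "bholo n r M' (taylor_coeff i m (coord_quot i f))"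
    using Suc.IH[OF bholo_coord_quot[OF Suc.prems i r]] by auto
  have "taylor_coeff i m (coord_quot i f) x = taylor_coeff i (Suc m) f x" if "x \<in> polydisc n r" for x
    using taylor_coeff_Suc[OF bholoD(2)[OF Suc.prems that i] r] by simp
  from bholo_cong[OF M' this] show ?case by blast
qed

text \<open>Holomorphy comes from the iterated quotients, whose own bounds grow like
  \<open>(4 / r) ^ m\<close>; the sharper bound is supplied by Cauchy's inequality.\<close>

lemma bholo_taylor_coeff:
  assumes f: "bholo n r M f" and i: "i \<in> {1..n}" and \<rho>: "0 < \<rho>" "\<rho> < r"
  shows "bholo n r (M / \<rho> ^ m) (taylor_coeff i m f)"
proof -
  have "r > 0" using \<rho> by simp
  from bholo_taylor_coeff_ex[OF f i this] taylor_coeff_bound[OF f i _ \<rho>]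
  show ?thesis unfolding bholo_def by blast
qed

lemma taylor_series:
  assumes f: "bholo n r M f" and i: "i \<in> {1..n}" and x: "x \<in> polydisc n r" and r: "r > 0"
  shows "((\<lambda>m. taylor_coeff i m f x * x i ^ m) has_sum f x) UNIV"
proof (rule norm_summable_imp_has_sum)
  let ?g = "\<lambda>t. f (x(i := t))"
  have xr: "norm (x i) < r" using polydisc_norm[OF x r] .
  have "(\<lambda>m. (deriv ^^ m) ?g 0 / fact m * (x i - 0) ^ m) sums ?g (x i)"
    by (rule holomorphic_power_series[OF bholoD(2)[OF f x i]]) (use xr in simp)
  then show "(\<lambda>m. taylor_coeff i m f x * x i ^ m) sums f x" by (simp add: taylor_coeff_def)
  obtain \<rho> where \<rho>: "norm (x i) < \<rho>" "\<rho> < r" using xr dense by blast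
  then have \<rho>0: "\<rho> > 0" using norm_ge_zero[of "x i"] by linarith
  show "summable (\<lambda>m. norm (taylor_coeff i m f x * x i ^ m))"
  proof (rule summable_comparison_test')
    show "summable (\<lambda>m. M * (norm (x i) / \<rho>) ^ m)"
      using \<rho> \<rho>0 by (intro summable_mult summable_geometric) auto
    fix m
    have "norm (taylor_coeff i m f x * x i ^ m) \<le> M / \<rho> ^ m * norm (x i) ^ m"
      unfolding norm_mult norm_power
      by (intro mult_right_mono taylor_coeff_bound[OF f i x \<rho>0 \<rho>(2)]) auto
    then show "norm (norm (taylor_coeff i m f x * x i ^ m)) \<le> M * (norm (x i) / \<rho>) ^ m"
      by (simp add: power_divide)
  qed
qed

lemma bij_betw_multi_indices_Suc:
  "bij_betw (\<lambda>(m, \<alpha>). \<alpha>(Suc n := m)) (UNIV \<times> multi_indices n) (multi_indices (Suc n))"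
  by (rule bij_betw_byWitness[where f' = "\<lambda>\<alpha>. (\<alpha> (Suc n), \<alpha>(Suc n := 0))"])
     (auto simp: multi_indices_def fun_eq_iff)

lemma prod_update_Suc:
  "(\<Prod>i=1..Suc n. x i ^ (\<alpha>(Suc n := m)) i) = (\<Prod>i=1..n. x i ^ \<alpha> i) * x (Suc n) ^ m"
proof -
  have "(\<Prod>i=1..n. x i ^ (\<alpha>(Suc n := m)) i) = (\<Prod>i=1..n. x i ^ \<alpha> i)"
    by (intro prod.cong) auto
  then show ?thesis by (simp add: prod.atLeast_Suc_atMost_Suc_shift)
qed

lemma multi_geometric_summable:
  fixes q :: "nat \<Rightarrow> real"
  assumes "\<And>i. i \<in> {1..n} \<Longrightarrow> 0 \<le> q i \<and> q i < 1"
  shows "(\<lambda>\<alpha>. \<Prod>i=1..n. q i ^ \<alpha> i) summable_on multi_indices n"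
  using assms
proof (induction n)
  case 0
  have "multi_indices 0 = {\<lambda>_. 0}" by (auto simp: multi_indices_def)
  then show ?case by simp
next
  case (Suc n)
  let ?G = "\<lambda>\<alpha>. \<Prod>i=1..n. q i ^ \<alpha> i"
  have G: "?G summable_on multi_indices n" using Suc by auto
  have G0: "?G \<alpha> \<ge> 0" for \<alpha> using Suc.prems by (intro prod_nonneg) auto
  have q: "0 \<le> q (Suc n)" "q (Suc n) < 1" using Suc.prems by auto
  have "(\<lambda>p. norm (case p of (m, \<alpha>) \<Rightarrow> ?G \<alpha> * q (Suc n) ^ m)) summable_on UNIV \<times> multi_indices n"
    unfolding Infinite_Sum.abs_summable_on_Sigma_iff
  proof (intro conjI ballI)
    fix m show "(\<lambda>\<alpha>. norm (case (m, \<alpha>) of (m, \<alpha>) \<Rightarrow> ?G \<alpha> * q (Suc n) ^ m)) summable_on multi_indices n"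
      using G0 q summable_on_cmult_left[OF G] by (simp add: abs_mult)
  next
    have "(\<lambda>m. norm (infsum (\<lambda>\<alpha>. norm (case (m, \<alpha>) of (m, \<alpha>) \<Rightarrow> ?G \<alpha> * q (Suc n) ^ m)) (multi_indices n)))
      = (\<lambda>m. infsum ?G (multi_indices n) * q (Suc n) ^ m)"
      using G0 q by (simp add: abs_mult infsum_cmult_left' infsum_nonneg)
    moreover have "(\<lambda>m. q (Suc n) ^ m) summable_on UNIV"
      using q by (intro norm_summable_imp_summable_on) (auto simp: summable_geometric_iff)
    ultimately show "(\<lambda>m. norm (infsum (\<lambda>\<alpha>. norm (case (m, \<alpha>) of (m, \<alpha>) \<Rightarrow> ?G \<alpha> * q (Suc n) ^ m)) (multi_indices n))) summable_on UNIV"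
      by (simp add: summable_on_cmult_right)
  qed
  then have "(\<lambda>p. case p of (m, \<alpha>) \<Rightarrow> ?G \<alpha> * q (Suc n) ^ m) summable_on UNIV \<times> multi_indices n"
    by (rule Infinite_Sum.abs_summable_summable)
  then show ?case
    unfolding summable_on_reindex_bij_betw[OF bij_betw_multi_indices_Suc, symmetric]
    by (simp only: prod_update_Suc case_prod_unfold)
qed

text \<open>Induction on the number of variables: expand in the last variable and apply the
  hypothesis to the Taylor coefficients. The coefficient estimate belongs to the statement, since it
  is what makes the double series absolutely summable in the inductive step.\<close>

lemma bholo_imp_power_series:
  assumes f: "bholo n r M f" and \<rho>: "0 < \<rho>" "\<rho> < r"
  obtains c where "\<And>\<alpha>. \<alpha> \<in> multi_indices n \<Longrightarrow> norm (c \<alpha>) * (\<Prod>i=1..n. \<rho> ^ \<alpha> i) \<le> M"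
    "\<And>x. x \<in> polydisc n \<rho> \<Longrightarrow> ((\<lambda>\<alpha>. c \<alpha> * (\<Prod>i=1..n. x i ^ \<alpha> i)) has_sum f x) (multi_indices n)"
proof -
  have "\<exists>c. (\<forall>\<alpha>\<in>multi_indices n. norm (c \<alpha>) * (\<Prod>i=1..n. \<rho> ^ \<alpha> i) \<le> M) \<and>
    (\<forall>x\<in>polydisc n \<rho>. ((\<lambda>\<alpha>. c \<alpha> * (\<Prod>i=1..n. x i ^ \<alpha> i)) has_sum f x) (multi_indices n))"
    using f
  proof (induction n arbitrary: f M)
    case 0
    have 1: "multi_indices 0 = {\<lambda>_. 0}" by (auto simp: multi_indices_def)
    have 2: "polydisc 0 s = {\<lambda>_. 0}" for s by (auto simp: polydisc_def cspace_def)
    show ?case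
      using bholoD(1)[OF 0, of "\<lambda>_. 0"]
      by (intro exI[of _ "\<lambda>_. f (\<lambda>_. 0)"]) (auto simp: 1 2 has_sum_finite_iff)
  next
    case (Suc n)
    have r: "r > 0" using \<rho> by simp
    let ?a = "\<lambda>m. taylor_coeff (Suc n) m f"
    have i: "Suc n \<in> {1..Suc n}" by simp
    have "bholo n r (M / \<rho> ^ m) (?a m)" for m
      by (rule bholo_fewer_vars[OF bholo_taylor_coeff[OF Suc.prems i \<rho>] r])
    note IH = Suc.IH[OF this]
    have "\<exists>C. \<forall>m. (\<forall>\<alpha>\<in>multi_indices n. norm (C m \<alpha>) * (\<Prod>i=1..n. \<rho> ^ \<alpha> i) \<le> M / \<rho> ^ m) \<and>
      (\<forall>x\<in>polydisc n \<rho>. ((\<lambda>\<alpha>. C m \<alpha> * (\<Prod>i=1..n. x i ^ \<alpha> i)) has_sum ?a m x) (multi_indices n))"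
      by (rule choice) (use IH in blast)
    then obtain C where
      C1: "\<And>m \<alpha>. \<alpha> \<in> multi_indices n \<Longrightarrow> norm (C m \<alpha>) * (\<Prod>i=1..n. \<rho> ^ \<alpha> i) \<le> M / \<rho> ^ m" and
      C2: "\<And>m x. x \<in> polydisc n \<rho> \<Longrightarrow> ((\<lambda>\<alpha>. C m \<alpha> * (\<Prod>i=1..n. x i ^ \<alpha> i)) has_sum ?a m x) (multi_indices n)"
      by blast
    define c where "c \<alpha> = C (\<alpha> (Suc n)) (\<alpha>(Suc n := 0))" for \<alpha>
    have c1: "norm (c \<alpha>) * (\<Prod>i=1..Suc n. \<rho> ^ \<alpha> i) \<le> M" if \<alpha>: "\<alpha> \<in> multi_indices (Suc n)" for \<alpha>
    proof -
      have \<alpha>': "\<alpha>(Suc n := 0) \<in> multi_indices n" using \<alpha> by (auto simp: multi_indices_def)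
      have "norm (c \<alpha>) * (\<Prod>i=1..n. \<rho> ^ (\<alpha>(Suc n := 0)) i) \<le> M / \<rho> ^ \<alpha> (Suc n)"
        unfolding c_def using C1[OF \<alpha>'] .
      moreover have "(\<Prod>i=1..n. \<rho> ^ (\<alpha>(Suc n := 0)) i) = (\<Prod>i=1..n. \<rho> ^ \<alpha> i)"
        by (intro prod.cong) auto
      ultimately show ?thesis using \<rho> by (simp add: field_simps)
    qed
    moreover have "((\<lambda>\<alpha>. c \<alpha> * (\<Prod>i=1..Suc n. x i ^ \<alpha> i)) has_sum f x) (multi_indices (Suc n))"
      if x: "x \<in> polydisc (Suc n) \<rho>" for x
    proof -
      have xr: "x \<in> polydisc (Suc n) r" using x polydisc_mono[of \<rho> r] \<rho> by auto
      let ?x = "x(Suc n := 0)"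
      have "?x i = 0" if "i \<notin> {1..n}" for i
        using that x by (cases "i = Suc n") (simp_all add: polydisc_def cspace_def le_Suc_eq)
      then have x': "?x \<in> polydisc n \<rho>" using x by (simp add: polydisc_def cspace_def)
      have xi: "norm (x i) < \<rho>" for i using polydisc_norm[OF x \<rho>(1)] .
      have M0: "M \<ge> 0" using bholoD(1)[OF Suc.prems xr] norm_ge_zero order_trans by blast
      have term_eq: "c (case p of (m, \<alpha>) \<Rightarrow> \<alpha>(Suc n := m)) * (\<Prod>i=1..Suc n. x i ^ (case p of (m, \<alpha>) \<Rightarrow> \<alpha>(Suc n := m)) i) =
          C (fst p) (snd p) * (\<Prod>i=1..n. x i ^ snd p i) * x (Suc n) ^ fst p"
        if "p \<in> UNIV \<times> multi_indices n" for p
      proof -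
        obtain m \<alpha> where p: "p = (m, \<alpha>)" by (cases p)
        have "\<alpha>(Suc n := 0) = \<alpha>" using that by (auto simp: p multi_indices_def)
        then have "c (\<alpha>(Suc n := m)) = C m \<alpha>" by (simp add: c_def)
        then show ?thesis unfolding p by (simp only: prod.case prod_update_Suc fst_conv snd_conv mult.assoc)
      qed
      \<comment> \<open>The coefficient bound dominates the terms by a product of geometric series
        in \<open>norm (x i) / \<rho>\<close>; this licenses summing over the old multi-indices
        first and over the last exponent afterwards.\<close>
      have "(\<lambda>\<alpha>. c \<alpha> * (\<Prod>i=1..Suc n. x i ^ \<alpha> i)) summable_on multi_indices (Suc n)"
      proof (rule Infinite_Sum.abs_summable_summable, rule summable_on_comparison_test)
        show "(\<lambda>\<alpha>. M * (\<Prod>i=1..Suc n. (norm (x i) / \<rho>) ^ \<alpha> i)) summable_on multi_indices (Suc n)"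
          using xi \<rho> by (intro summable_on_cmult_right multi_geometric_summable) auto
        fix \<alpha> assume \<alpha>: "\<alpha> \<in> multi_indices (Suc n)"
        have p: "(\<Prod>i=1..Suc n. \<rho> ^ \<alpha> i) > 0" using \<rho> by (intro prod_pos) auto
        have "norm (c \<alpha> * (\<Prod>i=1..Suc n. x i ^ \<alpha> i)) =
           (norm (c \<alpha>) * (\<Prod>i=1..Suc n. \<rho> ^ \<alpha> i)) * (\<Prod>i=1..Suc n. (norm (x i) / \<rho>) ^ \<alpha> i)"
          using p \<rho>(1) unfolding norm_mult prod_norm[symmetric] norm_power power_divide prod_dividef
          by (simp del: prod.cl_ivl_Suc)
        also have "\<dots> \<le> M * (\<Prod>i=1..Suc n. (norm (x i) / \<rho>) ^ \<alpha> i)"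
          using \<rho> by (intro mult_right_mono c1[OF \<alpha>] prod_nonneg) auto
        finally show "norm (c \<alpha> * (\<Prod>i=1..Suc n. x i ^ \<alpha> i)) \<le> M * (\<Prod>i=1..Suc n. (norm (x i) / \<rho>) ^ \<alpha> i)" .
      qed auto
      then have summable: "(\<lambda>p. C (fst p) (snd p) * (\<Prod>i=1..n. x i ^ snd p i) * x (Suc n) ^ fst p)
          summable_on UNIV \<times> multi_indices n"
        unfolding summable_on_reindex_bij_betw[OF bij_betw_multi_indices_Suc, symmetric]
        by (rule summable_on_cong[THEN iffD1, rotated]) (rule term_eq)
      have "((\<lambda>p. C (fst p) (snd p) * (\<Prod>i=1..n. x i ^ snd p i) * x (Suc n) ^ fst p) has_sum f x) (UNIV \<times> multi_indices n)"
      proof (rule has_sum_SigmaI[OF _ _ summable])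
        fix m
        have "((\<lambda>\<alpha>. C m \<alpha> * (\<Prod>i=1..n. ?x i ^ \<alpha> i) * x (Suc n) ^ m) has_sum ?a m ?x * x (Suc n) ^ m) (multi_indices n)"
          by (intro has_sum_cmult_left C2[OF x'])
        moreover have "(\<Prod>i=1..n. ?x i ^ \<alpha> i) = (\<Prod>i=1..n. x i ^ \<alpha> i)" for \<alpha>
          by (intro prod.cong) auto
        ultimately show "((\<lambda>\<alpha>. C (fst (m, \<alpha>)) (snd (m, \<alpha>)) * (\<Prod>i=1..n. x i ^ snd (m, \<alpha>) i) * x (Suc n) ^ fst (m, \<alpha>))
            has_sum ?a m x * x (Suc n) ^ m) (multi_indices n)" by simp
      next
        show "((\<lambda>m. ?a m x * x (Suc n) ^ m) has_sum f x) UNIV"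
          by (rule taylor_series[OF Suc.prems i xr r])
      qed
      then show ?thesis
        unfolding has_sum_reindex_bij_betw[OF bij_betw_multi_indices_Suc, symmetric]
        by (rule has_sum_cong[THEN iffD1, rotated]) (rule term_eq[symmetric])
    qed
    ultimately show ?case by blast
  qed
  then show ?thesis using that by blast
qed

text \<open>Each direction gives up half of the radius, once to turn convergence into a bound and
  once for the Cauchy estimates; for germs this is harmless.\<close>

theorem analytic_germ_iff_bholo: "analytic_germ n f \<longleftrightarrow> (\<exists>r>0. \<exists>M. bholo n r M f)"
proof
  assume "analytic_germ n f"
  then obtain c R where "R > 0" and
    c: "\<And>x. x \<in> polydisc n R \<Longrightarrow> ((\<lambda>\<alpha>. c \<alpha> * (\<Prod>i=1..n. x i ^ \<alpha> i)) has_sum f x) (multi_indices n)"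
    by (auto simp: analytic_germ_def near_0_def)
  have "\<exists>M. bholo n (R / 2) M f"
    by (rule bholo_power_series[of n R c f]) (use c \<open>R > 0\<close> in auto)
  then show "\<exists>r>0. \<exists>M. bholo n r M f"
    using \<open>R > 0\<close> by (intro exI[of _ "R / 2"]) auto
next
  assume "\<exists>r>0. \<exists>M. bholo n r M f"
  then obtain r M where r: "r > 0" and f: "bholo n r M f" by blast
  have "0 < r / 2" "r / 2 < r" using r by auto
  obtain c where "\<And>\<alpha>. \<alpha> \<in> multi_indices n \<Longrightarrow> norm (c \<alpha>) * (\<Prod>i=1..n. (r / 2) ^ \<alpha> i) \<le> M"
    and "\<And>x. x \<in> polydisc n (r / 2) \<Longrightarrow>
     ((\<lambda>\<alpha>. c \<alpha> * (\<Prod>i=1..n. x i ^ \<alpha> i)) has_sum f x) (multi_indices n)"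
    by (rule bholo_imp_power_series[OF f \<open>0 < r / 2\<close> \<open>r / 2 < r\<close>]) (rule that)
  then show "analytic_germ n f" unfolding analytic_germ_def near_0_def
    using \<open>0 < r / 2\<close> by blast
qed

section \<open>Operations on analytic germs\<close>

lemma analytic_germE:
  assumes "analytic_germ n f"
  obtains r M where "r > 0" "bholo n r M f"
  using assms analytic_germ_iff_bholo by blast

lemma analytic_germI: "bholo n r M f \<Longrightarrow> r > 0 \<Longrightarrow> analytic_germ n f"
  using analytic_germ_iff_bholo by blast

lemma bholo_const: "bholo n r (norm c) (\<lambda>_. c)"
  by (simp add: bholo_def)

lemma bholo_coord: "r > 0 \<Longrightarrow> bholo n r r (\<lambda>x. x i)"
  unfolding bholo_def
proof (intro ballI conjI)
  fix x j assume "r > 0" "x \<in> polydisc n r"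
  then show "norm (x i) \<le> r" using polydisc_norm less_imp_le by blast
  show "(\<lambda>t. (x(j := t)) i) holomorphic_on ball 0 r"
    by (cases "i = j") (auto intro: holomorphic_intros)
qed

lemma bholo_add:
  assumes "bholo n r M f" "bholo n r M' g"
  shows "bholo n r (M + M') (\<lambda>x. f x + g x)"
  unfolding bholo_def
proof (intro ballI conjI)
  fix x assume x: "x \<in> polydisc n r"
  show "norm (f x + g x) \<le> M + M'"
    using bholoD(1)[OF assms(1) x] bholoD(1)[OF assms(2) x] by (rule norm_triangle_mono)
  fix i assume "i \<in> {1..n}"
  then show "(\<lambda>t. f (x(i := t)) + g (x(i := t))) holomorphic_on ball 0 r"
    using bholoD(2)[OF assms(1) x] bholoD(2)[OF assms(2) x] by (intro holomorphic_intros)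
qed

lemma bholo_mult:
  assumes "bholo n r M f" "bholo n r M' g"
  shows "bholo n r (M * M') (\<lambda>x. f x * g x)"
  unfolding bholo_def
proof (intro ballI conjI)
  fix x assume x: "x \<in> polydisc n r"
  have "M \<ge> 0" using bholoD(1)[OF assms(1) x] norm_ge_zero order_trans by blast
  then show "norm (f x * g x) \<le> M * M'"
    unfolding norm_mult using bholoD(1)[OF assms(1) x] bholoD(1)[OF assms(2) x]
    by (intro mult_mono) auto
  fix i assume "i \<in> {1..n}"
  then show "(\<lambda>t. f (x(i := t)) * g (x(i := t))) holomorphic_on ball 0 r"
    using bholoD(2)[OF assms(1) x] bholoD(2)[OF assms(2) x] by (intro holomorphic_intros)
qed

lemma analytic_germ_common_radius:
  assumes "analytic_germ n f" "analytic_germ n g"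
  obtains r M M' where "r > 0" "bholo n r M f" "bholo n r M' g"
proof -
  obtain r M where f: "r > 0" "bholo n r M f" using assms(1) by (rule analytic_germE)
  obtain s M' where g: "s > 0" "bholo n s M' g" using assms(2) by (rule analytic_germE)
  show ?thesis
    using that[of "min r s" M M'] f g bholo_subset by simp
qed

lemma analytic_germ_const [simp]: "analytic_germ n (\<lambda>_. c)"
  using bholo_const[of n 1 c] by (rule analytic_germI) simp

lemma analytic_germ_coord [simp]: "analytic_germ n (\<lambda>x. x i)"
  using bholo_coord[of 1 n i] by (rule analytic_germI) simp_all

lemma analytic_germ_add: "analytic_germ n f \<Longrightarrow> analytic_germ n g \<Longrightarrow> analytic_germ n (\<lambda>x. f x + g x)"
  by (erule (1) analytic_germ_common_radius) (blast intro: analytic_germI bholo_add)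

lemma analytic_germ_mult: "analytic_germ n f \<Longrightarrow> analytic_germ n g \<Longrightarrow> analytic_germ n (\<lambda>x. f x * g x)"
  by (erule (1) analytic_germ_common_radius) (blast intro: analytic_germI bholo_mult)

lemma analytic_germ_minus: "analytic_germ n f \<Longrightarrow> analytic_germ n (\<lambda>x. - f x)"
  using analytic_germ_mult[of n "\<lambda>_. -1" f] by simp

lemma analytic_germ_diff: "analytic_germ n f \<Longrightarrow> analytic_germ n g \<Longrightarrow> analytic_germ n (\<lambda>x. f x - g x)"
  using analytic_germ_add[of n f "\<lambda>x. - g x"] analytic_germ_minus[of n g] by simp

lemma analytic_germ_sum:
  "(\<And>a. a \<in> A \<Longrightarrow> analytic_germ n (f a)) \<Longrightarrow> analytic_germ n (\<lambda>x. \<Sum>a\<in>A. f a x)"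
  by (induction A rule: infinite_finite_induct) (auto intro: analytic_germ_add)

lemma analytic_germ_prod:
  "(\<And>a. a \<in> A \<Longrightarrow> analytic_germ n (f a)) \<Longrightarrow> analytic_germ n (\<lambda>x. \<Prod>a\<in>A. f a x)"
  by (induction A rule: infinite_finite_induct) (auto intro: analytic_germ_mult)

lemma analytic_germ_power: "analytic_germ n f \<Longrightarrow> analytic_germ n (\<lambda>x. f x ^ m)"
  by (induction m) (auto intro: analytic_germ_mult)

lemmas analytic_germ_intros = analytic_germ_const analytic_germ_coord analytic_germ_add analytic_germ_mult
  analytic_germ_minus analytic_germ_diff analytic_germ_sum analytic_germ_prod analytic_germ_power

lemma analytic_germ_cong:
  assumes "analytic_germ n f" and ev: "eventually (\<lambda>x. f x = g x) (at_0 n)"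
  shows "analytic_germ n g"
proof -
  obtain r M where f: "r > 0" "bholo n r M f" using assms(1) by (rule analytic_germE)
  obtain s where s: "s > 0" "\<And>x. x \<in> polydisc n s \<Longrightarrow> f x = g x"
    using ev by (auto simp: eventually_at_0)
  have "bholo n (min r s) M g"
    using bholo_cong[OF bholo_subset[OF f(2)], of "min r s" g] s(2) polydisc_mono[of "min r s" s n] by auto
  then show ?thesis by (rule analytic_germI) (use f s in simp)
qed

lemma has_sum_finite_sum:
  fixes f :: "'b \<Rightarrow> 'a \<Rightarrow> 'c :: topological_comm_monoid_add"
  assumes "\<And>i. i \<in> B \<Longrightarrow> (f i has_sum s i) A"
  shows "((\<lambda>x. \<Sum>i\<in>B. f i x) has_sum (\<Sum>i\<in>B. s i)) A"
  using assms by (induction B rule: infinite_finite_induct) (auto intro: has_sum_add)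

text \<open>The parameter set is an arbitrary open set because coordinate lines on a disc, rescaled
  rays and complex lines over a convex set all occur as curves.\<close>

definition holo_curve :: "nat \<Rightarrow> real \<Rightarrow> complex set \<Rightarrow> (complex \<Rightarrow> nat \<Rightarrow> complex) \<Rightarrow> bool" where
  "holo_curve n r S \<gamma> \<longleftrightarrow> open S \<and> (\<forall>i\<in>{1..n}. (\<lambda>t. \<gamma> t i) holomorphic_on S) \<and> (\<forall>t\<in>S. \<gamma> t \<in> polydisc n r)"

text \<open>The chain rule holds for monomials and passes to absolutely convergent series.\<close>

lemma analytic_germ_curve:
  assumes "analytic_germ n f"
  obtains r where "r > 0"
    "\<And>S \<gamma> t. holo_curve n r S \<gamma> \<Longrightarrow> t \<in> S \<Longrightarrow>
      ((\<lambda>t. f (\<gamma> t)) has_field_derivative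
         (\<Sum>i=1..n. partial_deriv i f (\<gamma> t) * deriv (\<lambda>t. \<gamma> t i) t)) (at t)"
proof -
  obtain c R where R: "R > 0" and
    c: "\<And>x. x \<in> polydisc n R \<Longrightarrow> ((\<lambda>\<alpha>. c \<alpha> * (\<Prod>i=1..n. x i ^ \<alpha> i)) has_sum f x) (multi_indices n)"
    using assms by (auto simp: analytic_germ_def near_0_def)
  define r where "r = R / 2"
  have r: "0 < r" "r < R" using R by (auto simp: r_def)
  define M where "M \<alpha> = norm (c \<alpha>) * (\<Prod>i=1..n. r ^ \<alpha> i)" for \<alpha>
  have M: "M summable_on multi_indices n"
    unfolding M_def by (rule power_series_abs_summable[OF c r])
  \<comment> \<open>The partial derivative of a monomial. When \<open>\<alpha> i = 0\<close> the
    truncated exponent is harmless, as the factor \<open>of_nat (\<alpha> i)\<close> is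
    zero.\<close>
  define D where "D \<alpha> i x = c \<alpha> * (of_nat (\<alpha> i) * x i ^ (\<alpha> i - 1) * (\<Prod>l\<in>{1..n} - {i}. x l ^ \<alpha> l))"
    for \<alpha> i and x :: "nat \<Rightarrow> complex"
  have mono: "((\<lambda>t. c \<alpha> * (\<Prod>i=1..n. \<gamma> t i ^ \<alpha> i)) has_field_derivative
      (\<Sum>i=1..n. D \<alpha> i (\<gamma> t) * \<gamma>' i)) (at t)"
    if "\<And>i. i \<in> {1..n} \<Longrightarrow> ((\<lambda>t. \<gamma> t i) has_field_derivative \<gamma>' i) (at t)" for \<gamma> \<gamma>' t \<alpha>
  proof -
    have "((\<lambda>t. \<Prod>i=1..n. \<gamma> t i ^ \<alpha> i) has_field_derivative
       (\<Sum>i=1..n. (of_nat (\<alpha> i) * (\<gamma>' i * \<gamma> t i ^ (\<alpha> i - 1))) * (\<Prod>l\<in>{1..n} - {i}. \<gamma> t l ^ \<alpha> l))) (at t)"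
      using DERIV_power[OF that] by (intro has_field_derivative_prod) simp
    from DERIV_cmult[OF this, of "c \<alpha>"] show ?thesis
      by (rule DERIV_cong) (simp add: D_def sum_distrib_left mult_ac)
  qed
  have along: "\<exists>f'. ((\<lambda>t. f (\<gamma> t)) has_field_derivative f') (at t) \<and>
     ((\<lambda>\<alpha>. \<Sum>i=1..n. D \<alpha> i (\<gamma> t) * deriv (\<lambda>t. \<gamma> t i) t) has_sum f') (multi_indices n)"
    if C: "holo_curve n r S \<gamma>" and t: "t \<in> S" for S \<gamma> t
  proof -
    have S: "open S" and hol: "\<And>i. i \<in> {1..n} \<Longrightarrow> (\<lambda>t. \<gamma> t i) holomorphic_on S"
      and \<gamma>: "\<And>t. t \<in> S \<Longrightarrow> \<gamma> t \<in> polydisc n r"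
      using C by (simp_all add: holo_curve_def)
    have \<gamma>R: "\<gamma> t \<in> polydisc n R" if "t \<in> S" for t
      using \<gamma>[OF that] polydisc_mono[of r R n] r by auto
    obtain f' where "((\<lambda>t. f (\<gamma> t)) has_field_derivative f') (at t)"
      "((\<lambda>\<alpha>. \<Sum>i=1..n. D \<alpha> i (\<gamma> t) * deriv (\<lambda>t. \<gamma> t i) t) has_sum f') (multi_indices n)"
    proof (rule has_sum_has_field_derivative[OF S t M])
      show "((\<lambda>t. c \<alpha> * (\<Prod>i=1..n. \<gamma> t i ^ \<alpha> i)) has_field_derivative
         (\<Sum>i=1..n. D \<alpha> i (\<gamma> s) * deriv (\<lambda>t. \<gamma> t i) s)) (at s)" if "s \<in> S" for \<alpha> s
        by (rule mono) (rule holomorphic_derivI[OF hol S that])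
      show "norm (c \<alpha> * (\<Prod>i=1..n. \<gamma> s i ^ \<alpha> i)) \<le> M \<alpha>" if "s \<in> S" for \<alpha> s
        unfolding M_def norm_mult by (intro mult_left_mono norm_monomial_le \<gamma> that) auto
      show "((\<lambda>\<alpha>. c \<alpha> * (\<Prod>i=1..n. \<gamma> s i ^ \<alpha> i)) has_sum f (\<gamma> s)) (multi_indices n)" if "s \<in> S" for s
        using c[OF \<gamma>R[OF that]] .
    qed blast
    then show ?thesis by blast
  qed
  \<comment> \<open>Applied to a coordinate line, termwise differentiation identifies the sum of the
    \<open>D \<alpha> i\<close> with \<open>partial_deriv\<close>.\<close>
  have partial: "((\<lambda>\<alpha>. D \<alpha> i x) has_sum partial_deriv i f x) (multi_indices n)"
    if i: "i \<in> {1..n}" and x: "x \<in> polydisc n r" for i x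
  proof -
    have coord: "(\<lambda>t. (x(i := t)) j) holomorphic_on S" for j S
      by (cases "i = j") (auto intro: holomorphic_intros)
    have xi: "x i \<in> ball 0 r" using polydisc_norm[OF x r(1)] by simp
    have "\<exists>f'. ((\<lambda>t. f (x(i := t))) has_field_derivative f') (at (x i)) \<and>
      ((\<lambda>\<alpha>. \<Sum>j=1..n. D \<alpha> j (x(i := x i)) * deriv (\<lambda>t. (x(i := t)) j) (x i)) has_sum f') (multi_indices n)"
      by (rule along[of "ball 0 r" "\<lambda>t. x(i := t)"])
         (use coord xi polydisc_update[OF x i] in \<open>auto simp: holo_curve_def simp del: fun_upd_apply\<close>)
    then obtain f' where f': "((\<lambda>t. f (x(i := t))) has_field_derivative f') (at (x i))"
      "((\<lambda>\<alpha>. \<Sum>j=1..n. D \<alpha> j (x(i := x i)) * deriv (\<lambda>t. (x(i := t)) j) (x i)) has_sum f') (multi_indices n)"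
      by blast
    have d: "deriv (\<lambda>t. (x(i := t)) j) (x i) = (if j = i then 1 else 0)" for j
      by (cases "i = j") auto
    have "((\<lambda>\<alpha>. D \<alpha> i x) has_sum f') (multi_indices n)"
      using f'(2) i unfolding d by (simp add: if_distrib sum.delta cong: if_cong)
    moreover have "partial_deriv i f x = f'"
      using f'(1) by (simp add: partial_deriv_def DERIV_imp_deriv)
    ultimately show ?thesis by simp
  qed
  show ?thesis
  proof (rule that[OF r(1)])
    fix S \<gamma> t
    assume *: "holo_curve n r S \<gamma>" "t \<in> S"
    then have in_r: "\<gamma> t \<in> polydisc n r" by (simp add: holo_curve_def)
    obtain f' where f': "((\<lambda>t. f (\<gamma> t)) has_field_derivative f') (at t)"
      "((\<lambda>\<alpha>. \<Sum>i=1..n. D \<alpha> i (\<gamma> t) * deriv (\<lambda>t. \<gamma> t i) t) has_sum f') (multi_indices n)"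
      using along[OF *] by blast
    have "((\<lambda>\<alpha>. \<Sum>i=1..n. D \<alpha> i (\<gamma> t) * deriv (\<lambda>t. \<gamma> t i) t) has_sum
        (\<Sum>i=1..n. partial_deriv i f (\<gamma> t) * deriv (\<lambda>t. \<gamma> t i) t)) (multi_indices n)"
      by (intro has_sum_finite_sum has_sum_cmult_left partial in_r)
    with f' show "((\<lambda>t. f (\<gamma> t)) has_field_derivative
         (\<Sum>i=1..n. partial_deriv i f (\<gamma> t) * deriv (\<lambda>t. \<gamma> t i) t)) (at t)"
      using has_sum_unique by blast
  qed
qed

lemma analytic_germ_curve_holomorphic:
  assumes "analytic_germ n f"
  obtains r where "r > 0" "\<And>S \<gamma>. holo_curve n r S \<gamma> \<Longrightarrow> (\<lambda>t. f (\<gamma> t)) holomorphic_on S"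
proof -
  obtain r where r: "r > 0" and
    *: "\<And>S \<gamma> t. holo_curve n r S \<gamma> \<Longrightarrow> t \<in> S \<Longrightarrow>
      ((\<lambda>t. f (\<gamma> t)) has_field_derivative
         (\<Sum>i=1..n. partial_deriv i f (\<gamma> t) * deriv (\<lambda>t. \<gamma> t i) t)) (at t)"
    using analytic_germ_curve[OF assms] by blast
  have "(\<lambda>t. f (\<gamma> t)) holomorphic_on S" if "holo_curve n r S \<gamma>" for S \<gamma>
  proof -
    have "open S" using that by (simp add: holo_curve_def)
    then show ?thesis using *[OF that] by (auto simp: holomorphic_on_open)
  qed
  then show ?thesis by (rule that[OF r])
qed

section \<open>Continuity at the centre, germ maps and composition\<close>

lemma polydisc_scale:
  assumes "x \<in> polydisc n \<delta>" "norm c * \<delta> \<le> r" "\<delta> > 0" "r > 0" "norm c > 0"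
  shows "(\<lambda>i. c * x i) \<in> polydisc n r"
proof -
  have "norm (c * x i) < r" for i
  proof -
    have "norm c * norm (x i) < norm c * \<delta>"
      using polydisc_norm[OF assms(1,3)] assms(5) by (intro mult_strict_left_mono) auto
    then show ?thesis using assms(2) by (simp add: norm_mult)
  qed
  then show ?thesis using assms(1) by (simp add: polydisc_def cspace_def)
qed

text \<open>On the ray through \<open>x\<close>, rescaled so that the parameter disc has radius 1,
  \<open>f\<close> is bounded by \<open>M\<close>, and \<open>x\<close> itself sits at the parameter
  \<open>\<delta> / r\<close>. The one-variable Lipschitz estimate then gives continuity at
  0.\<close>

lemma analytic_germ_tendsto:
  assumes "analytic_germ n f"
  shows "(f \<longlongrightarrow> f (\<lambda>_. 0)) (at_0 n)"
proof (rule tendstoI)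
  fix e :: real assume e: "e > 0"
  obtain s M where s: "s > 0" and f: "bholo n s M f" using assms by (rule analytic_germE)
  obtain r' where r': "r' > 0" and hol: "\<And>S \<gamma>. holo_curve n r' S \<gamma> \<Longrightarrow> (\<lambda>t. f (\<gamma> t)) holomorphic_on S"
    using analytic_germ_curve_holomorphic[OF assms] by blast
  define r where "r = min s r'"
  have r: "r > 0" "r \<le> s" "r \<le> r'" using s r' by (auto simp: r_def)
  have M0: "M \<ge> 0" using bholoD(1)[OF f zero_in_polydisc[OF s]] norm_ge_zero order_trans by blast
  \<comment> \<open>The first entry of the minimum keeps \<open>\<delta> / r\<close> in the range of
    the Lipschitz estimate, the second makes the estimate at most \<open>e / 2\<close>.\<close>
  define \<delta> where "\<delta> = r * min (1/2) (e / (8 * (M + 1)))"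
  have \<delta>: "\<delta> > 0" "\<delta> / r \<le> 1/2" "4 * (M + 1) * (\<delta> / r) < e"
  proof -
    show "\<delta> > 0" using r e M0 by (simp add: \<delta>_def)
    have \<delta>r: "\<delta> / r = min (1/2) (e / (8 * (M + 1)))" using r by (simp add: \<delta>_def)
    show "\<delta> / r \<le> 1/2" unfolding \<delta>r by (rule min.cobounded1)
    have "\<delta> / r \<le> e / (8 * (M + 1))" unfolding \<delta>r by (rule min.cobounded2)
    then have "4 * (M + 1) * (\<delta> / r) \<le> 4 * (M + 1) * (e / (8 * (M + 1)))"
      using M0 by (intro mult_left_mono) auto
    also have "\<dots> = e / 2" using M0 by (simp add: divide_simps)
    finally show "4 * (M + 1) * (\<delta> / r) < e" using e by simp
  qed
  have "dist (f x) (f (\<lambda>_. 0)) < e" if x: "x \<in> polydisc n \<delta>" for x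
  proof -
    define h where "h t = f (\<lambda>i. (t * of_real (r / \<delta>)) * x i)" for t
    have inr: "(\<lambda>i. (t * of_real (r / \<delta>)) * x i) \<in> polydisc n r" if "t \<in> ball 0 1" for t
    proof (cases "t = 0")
      case True
      then show ?thesis using zero_in_polydisc[OF r(1)] by simp
    next
      case False
      have "norm (t * of_real (r / \<delta>)) * \<delta> \<le> r"
        using that r \<delta> by (simp add: norm_mult norm_divide mult_left_le_one_le)
      then show ?thesis using False r \<delta> by (intro polydisc_scale[OF x]) auto
    qed
    have "h holomorphic_on ball 0 1" unfolding h_def
      by (rule hol) (use inr polydisc_mono[OF r(3), of n] in \<open>auto simp: holo_curve_def intro!: holomorphic_intros\<close>)
    moreover have "norm (h t) \<le> M" if "t \<in> ball 0 1" for t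
      using bholoD(1)[OF f] inr[OF that] polydisc_mono[OF r(2), of n] by (auto simp: h_def)
    moreover have norm_\<delta>r: "norm (of_real (\<delta> / r) :: complex) = \<delta> / r"
      unfolding norm_of_real using \<delta> r by simp
    moreover have "\<delta> / r \<le> 1 / 2" by (rule \<delta>(2))
    ultimately have "norm (h (of_real (\<delta> / r)) - h 0) \<le> 4 * (M + 1) / 1 * norm (of_real (\<delta> / r) :: complex)"
      by (intro bounded_holomorphic_lipschitz(2)) (simp_all only:)
    also have "\<dots> < e" unfolding norm_\<delta>r using \<delta>(3) by simp
    finally show ?thesis using \<delta> r by (simp add: h_def dist_norm)
  qed
  then show "eventually (\<lambda>x. dist (f x) (f (\<lambda>_. 0)) < e) (at_0 n)"
    using \<delta>(1) by (auto simp: eventually_at_0)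
qed

lemma eventually_cspace: "eventually (\<lambda>x. x \<in> cspace n) (at_0 n)"
  by (auto simp: eventually_at_0 polydisc_def intro: exI[of _ 1])

lemma eventually_in_polydisc:
  assumes "\<And>i. i \<in> {1..m} \<Longrightarrow> ((\<lambda>x. G x i) \<longlongrightarrow> 0) F" "eventually (\<lambda>x. G x \<in> cspace m) F" "r > 0"
  shows "eventually (\<lambda>x. G x \<in> polydisc m r) F"
proof -
  have "eventually (\<lambda>x. \<forall>i\<in>{1..m}. norm (G x i) < r) F"
    using tendstoD[OF assms(1) assms(3)] by (intro eventually_ball_finite) (simp_all add: dist_norm)
  with assms(2) show ?thesis by eventually_elim (simp add: polydisc_def)
qed

text \<open>The clause on \<open>cspace\<close> is what puts values into polydiscs of
  \<open>m\<close>-space, whose points vanish outside \<open>{1..m}\<close>; together with fixing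
  the centre it lets germ identities be pulled back.\<close>

definition germ_map :: "nat \<Rightarrow> nat \<Rightarrow> ((nat \<Rightarrow> complex) \<Rightarrow> nat \<Rightarrow> complex) \<Rightarrow> bool" where
  "germ_map n m G \<longleftrightarrow> (\<forall>i\<in>{1..m}. analytic_germ n (\<lambda>x. G x i) \<and> G (\<lambda>_. 0) i = 0) \<and>
     (\<forall>x\<in>cspace n. G x \<in> cspace m)"

text \<open>With \<open>n < m\<close> the updated coordinate may be a new one, which covers passing
  to a graph; with \<open>n = m\<close> the lemma covers shears and restrictions to a
  hyperplane.\<close>

lemma germ_map_update:
  assumes "n \<le> m" "i \<in> {1..m}" "analytic_germ n R" "R (\<lambda>_. 0) = 0"
  shows "germ_map n m (\<lambda>x. x(i := R x))"
proof -
  have "analytic_germ n (\<lambda>x. (x(i := R x)) j)" for j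
    using assms(3) by (cases "j = i") auto
  then show ?thesis using assms by (auto simp: germ_map_def cspace_def)
qed

lemma filterlim_germ_map:
  assumes G: "germ_map n m G"
  shows "filterlim G (at_0 m) (at_0 n)"
proof -
  have ev: "eventually (\<lambda>x. G x \<in> polydisc m r) (at_0 n)" if "r > 0" for r
  proof (rule eventually_in_polydisc[OF _ _ that])
    fix i assume "i \<in> {1..m}"
    then have "analytic_germ n (\<lambda>x. G x i)" "G (\<lambda>_. 0) i = 0" using G by (auto simp: germ_map_def)
    then show "((\<lambda>x. G x i) \<longlongrightarrow> 0) (at_0 n)" using analytic_germ_tendsto by metis
  next
    show "eventually (\<lambda>x. G x \<in> cspace m) (at_0 n)"
      using eventually_cspace by (rule eventually_mono) (use G in \<open>simp add: germ_map_def\<close>)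
  qed
  show ?thesis
    unfolding filterlim_iff eventually_at_0[of _ m]
  proof (intro allI impI, elim exE conjE)
    fix P r assume "(0::real) < r" and P: "\<forall>x\<in>polydisc m r. P x"
    from ev[OF this(1)] show "eventually (\<lambda>x. P (G x)) (at_0 n)"
      by (rule eventually_mono) (use P in blast)
  qed
qed

lemma eventually_germ_map: "eventually P (at_0 m) \<Longrightarrow> germ_map n m G \<Longrightarrow> eventually (\<lambda>x. P (G x)) (at_0 n)"
  by (rule eventually_compose_filterlim[OF _ filterlim_germ_map])

text \<open>Freezing all variables but one turns \<open>G\<close> into a curve, along which
  \<open>f\<close> is holomorphic; the bound is simply that of \<open>f\<close>.\<close>

lemma analytic_germ_compose:
  assumes f: "analytic_germ m f" and G: "germ_map n m G"
  shows "analytic_germ n (\<lambda>x. f (G x))"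
proof -
  obtain s M where s: "s > 0" and fM: "bholo m s M f" using f by (rule analytic_germE)
  obtain r' where r': "r' > 0" and hol: "\<And>S \<gamma>. holo_curve m r' S \<gamma> \<Longrightarrow> (\<lambda>t. f (\<gamma> t)) holomorphic_on S"
    using analytic_germ_curve_holomorphic[OF f] by blast
  have "eventually (\<lambda>x. G x \<in> polydisc m (min s r')) (at_0 n)"
    using eventually_germ_map[OF eventually_polydisc G] s r' by simp
  then obtain \<delta> where \<delta>: "\<delta> > 0" "\<And>x. x \<in> polydisc n \<delta> \<Longrightarrow> G x \<in> polydisc m (min s r')"
    by (auto simp: eventually_at_0)
  have "\<exists>\<rho>>0. \<exists>N. bholo n \<rho> N (\<lambda>x. G x i)" if "i \<in> {1..m}" for i
    using G that analytic_germ_iff_bholo unfolding germ_map_def by blast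
  then obtain \<rho> where \<rho>: "\<And>i. i \<in> {1..m} \<Longrightarrow> \<rho> i > 0 \<and> (\<exists>N. bholo n (\<rho> i) N (\<lambda>x. G x i))"
    by metis
  \<comment> \<open>A common radius on which every component of \<open>G\<close> is holomorphic in
    each variable and the values of \<open>G\<close> stay where \<open>f\<close> is
    controlled.\<close>
  define r where "r = Min (insert \<delta> (\<rho> ` {1..m}))"
  have "r > 0" using \<delta>(1) \<rho> by (auto simp: r_def)
  moreover have "r \<le> a" if "a \<in> insert \<delta> (\<rho> ` {1..m})" for a
    unfolding r_def using that by (intro Min_le) auto
  ultimately have r: "r > 0" "r \<le> \<delta>" "\<And>i. i \<in> {1..m} \<Longrightarrow> r \<le> \<rho> i" by blast+
  have inG: "G x \<in> polydisc m s" "G x \<in> polydisc m r'" if "x \<in> polydisc n r" for x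
  proof -
    have "G x \<in> polydisc m (min s r')" using \<delta>(2) polydisc_mono[OF r(2)] that by blast
    then show "G x \<in> polydisc m s" "G x \<in> polydisc m r'"
      using polydisc_mono[of "min s r'" s m] polydisc_mono[of "min s r'" r' m] by auto
  qed
  have "bholo n r M (\<lambda>x. f (G x))"
    unfolding bholo_def
  proof (intro ballI conjI)
    fix x assume x: "x \<in> polydisc n r"
    show "norm (f (G x)) \<le> M" using bholoD(1)[OF fM inG(1)[OF x]] .
    fix l assume l: "l \<in> {1..n}"
    show "(\<lambda>t. f (G (x(l := t)))) holomorphic_on ball 0 r"
    proof (rule hol, unfold holo_curve_def, intro conjI ballI)
      fix i assume i: "i \<in> {1..m}"
      then obtain N where "bholo n (\<rho> i) N (\<lambda>x. G x i)" using \<rho> by blast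
      from bholo_subset[OF this r(3)[OF i]]
      show "(\<lambda>t. G (x(l := t)) i) holomorphic_on ball 0 r" using x l by (rule bholoD(2))
    next
      fix t :: complex assume "t \<in> ball 0 r"
      then show "G (x(l := t)) \<in> polydisc m r'" using inG(2) polydisc_update[OF x l] by simp
    qed simp
  qed
  then show ?thesis using r(1) by (rule analytic_germI)
qed

section \<open>Division by a coordinate, partial derivatives and cancellation\<close>

lemma analytic_germ_coord_quot:
  assumes "analytic_germ n f" "i \<in> {1..n}"
  shows "analytic_germ n (coord_quot i f)"
  using assms(1) by (rule analytic_germE) (blast intro: analytic_germI bholo_coord_quot assms(2))

lemma analytic_germ_fewer_vars: "analytic_germ (Suc n) f \<Longrightarrow> analytic_germ n f"
  by (erule analytic_germE) (blast intro: analytic_germI bholo_fewer_vars)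

text \<open>The partial derivative is a difference quotient of \<open>f (x(i := x i + s))\<close> in the additional
  variable \<open>s\<close>, evaluated at \<open>s = 0\<close>.\<close>

lemma analytic_germ_partial_deriv:
  assumes f: "analytic_germ n f" and i: "i \<in> {1..n}"
  shows "analytic_germ n (partial_deriv i f)"
proof -
  define G :: "(nat \<Rightarrow> complex) \<Rightarrow> nat \<Rightarrow> complex"
    where "G x l = (if l = i then x i + x (Suc n) else if l \<in> {1..n} then x l else 0)" for x l
  have "analytic_germ (Suc n) (\<lambda>x. G x l)" for l
    unfolding G_def by (cases "l = i"; cases "l \<in> {1..n}") (auto intro: analytic_germ_intros)
  then have "germ_map (Suc n) n G" using i by (auto simp: germ_map_def G_def cspace_def)
  then have "analytic_germ (Suc n) (\<lambda>x. f (G x))" by (rule analytic_germ_compose[OF f])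
  then have "analytic_germ (Suc n) (coord_quot (Suc n) (\<lambda>x. f (G x)))"
    by (rule analytic_germ_coord_quot) simp
  then have "analytic_germ n (coord_quot (Suc n) (\<lambda>x. f (G x)))"
    by (rule analytic_germ_fewer_vars)
  then show ?thesis
  proof (rule analytic_germ_cong)
    have "coord_quot (Suc n) (\<lambda>x. f (G x)) x = partial_deriv i f x" if "x \<in> cspace n" for x
    proof -
      have 0: "x l = 0" if "l \<notin> {1..n}" for l using \<open>x \<in> cspace n\<close> that by (simp add: cspace_def)
      have "G (x(Suc n := t)) = x(i := x i + t)" for t
        using 0 i by (auto simp: G_def fun_eq_iff)
      then have "coord_quot (Suc n) (\<lambda>x. f (G x)) x = deriv (\<lambda>t. f (x(i := x i + t))) 0"
        using 0[of "Suc n"] by (simp add: coord_quot_def)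
      also have "\<dots> = partial_deriv i f x"
        unfolding partial_deriv_def by (subst deriv_shift_0) (simp add: o_def)
      finally show ?thesis .
    qed
    then show "eventually (\<lambda>x. coord_quot (Suc n) (\<lambda>x. f (G x)) x = partial_deriv i f x) (at_0 n)"
      using eventually_cspace by (rule eventually_mono[rotated])
  qed
qed

lemma analytic_germ_factor_coord:
  assumes f: "analytic_germ n f" and i: "i \<in> {1..n}"
    and z: "eventually (\<lambda>x. x i = 0 \<longrightarrow> f x = 0) (at_0 n)"
  obtains g where "analytic_germ n g" "eventually (\<lambda>x. f x = x i * g x) (at_0 n)"
proof (rule that[OF analytic_germ_coord_quot[OF f i]])
  obtain r where r: "r > 0" "\<And>x. x \<in> polydisc n r \<Longrightarrow> x i = 0 \<Longrightarrow> f x = 0"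
    using z by (auto simp: eventually_at_0)
  have "f x = x i * coord_quot i f x" if "x \<in> polydisc n r" for x
    using coord_quot_eq[of f x i] r(2)[OF polydisc_update[OF that i, of 0]] r(1) by simp
  then show "eventually (\<lambda>x. f x = x i * coord_quot i f x) (at_0 n)"
    using r(1) by (auto simp: eventually_at_0)
qed

text \<open>Restrict to complex lines and use the identity theorem in one variable.\<close>

lemma analytic_germ_domain:
  assumes f: "analytic_germ n f" and g: "analytic_germ n g"
    and fg: "eventually (\<lambda>x. f x * g x = 0) (at_0 n)"
  shows "eventually (\<lambda>x. f x = 0) (at_0 n) \<or> eventually (\<lambda>x. g x = 0) (at_0 n)"
proof (rule disjCI)
  assume ng: "\<not> eventually (\<lambda>x. g x = 0) (at_0 n)"
  obtain r1 where r1: "r1 > 0" and holf: "\<And>S \<gamma>. holo_curve n r1 S \<gamma> \<Longrightarrow> (\<lambda>t. f (\<gamma> t)) holomorphic_on S"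
    using analytic_germ_curve_holomorphic[OF f] by blast
  obtain r2 where r2: "r2 > 0" and holg: "\<And>S \<gamma>. holo_curve n r2 S \<gamma> \<Longrightarrow> (\<lambda>t. g (\<gamma> t)) holomorphic_on S"
    using analytic_germ_curve_holomorphic[OF g] by blast
  obtain r3 where r3: "r3 > 0" "\<And>x. x \<in> polydisc n r3 \<Longrightarrow> f x * g x = 0"
    using fg by (auto simp: eventually_at_0)
  define r where "r = min r1 (min r2 r3)"
  have r: "r > 0" "r \<le> r1" "r \<le> r2" "r \<le> r3" using r1 r2 r3 by (auto simp: r_def)
  note sub = polydisc_mono[OF r(2), of n] polydisc_mono[OF r(3), of n] polydisc_mono[OF r(4), of n]
  obtain a where a: "a \<in> polydisc n r" "g a \<noteq> 0"
    using ng r(1) by (auto simp: eventually_at_0)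
  have "f b = 0" if b: "b \<in> polydisc n r" for b
  proof -
    define \<gamma> where "\<gamma> t = (\<lambda>i. a i + t * (b i - a i))" for t
    \<comment> \<open>All parameters for which the complex line through \<open>a\<close> and
      \<open>b\<close> stays in the polydisc. As an intersection of preimages of discs under affine
      maps, this set is convex and thus connected.\<close>
    define S where "S = (\<Inter>i\<in>{1..n}. {t. norm (a i + t * (b i - a i)) < r})"
    have S: "open S" "convex S"
    proof -
      show "open S" unfolding S_def by (intro open_INT ballI open_Collect_less continuous_intros) auto
      have "{t. norm (a i + t * (b i - a i)) < r} = (\<lambda>t. a i + t * (b i - a i)) -` ball 0 r" for i
        by auto
      moreover have "convex ((\<lambda>t. a i + t * (b i - a i)) -` ball 0 r)" for i
      proof -
        have "convex ((\<lambda>t. t * (b i - a i)) -` ((\<lambda>z. z - a i) ` ball 0 r))"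
          by (intro convex_linear_vimage bounded_linear.linear bounded_linear_mult_left
              convex_translation_subtract) simp
        moreover have "(\<lambda>t. t * (b i - a i)) -` ((\<lambda>z. z - a i) ` ball 0 r) = (\<lambda>t. a i + t * (b i - a i)) -` ball 0 r"
          by (force simp: image_iff algebra_simps)
        ultimately show ?thesis by simp
      qed
      ultimately show "convex S" unfolding S_def by (auto intro!: convex_INT)
    qed
    have in_r: "\<gamma> t \<in> polydisc n r" if "t \<in> S" for t
      using that a b by (auto simp: polydisc_def cspace_def \<gamma>_def S_def)
    have "(\<lambda>t. \<gamma> t i) holomorphic_on S" for i
      unfolding \<gamma>_def by (intro holomorphic_intros)
    then have "holo_curve n r1 S \<gamma>" "holo_curve n r2 S \<gamma>"
      using S(1) in_r sub by (auto simp: holo_curve_def)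
    then have f\<gamma>: "(\<lambda>t. f (\<gamma> t)) holomorphic_on S" and g\<gamma>: "(\<lambda>t. g (\<gamma> t)) holomorphic_on S"
      using holf holg by blast+
    have S01: "0 \<in> S" "1 \<in> S" using a b by (auto simp: S_def polydisc_def)
    \<comment> \<open>On this open set, which contains the parameter 0 of \<open>a\<close>, the
      product relation forces \<open>f\<close> to vanish; the identity theorem on \<open>S\<close>
      carries this to the parameter 1 of \<open>b\<close>.\<close>
    define U where "U = {t\<in>S. g (\<gamma> t) \<noteq> 0}"
    have "open U"
    proof -
      have "open ((\<lambda>t. g (\<gamma> t)) -` (- {0}) \<inter> S)"
        by (rule continuous_on_open_vimage[THEN iffD1, rule_format, OF S(1)])
           (use g\<gamma> holomorphic_on_imp_continuous_on in auto)
      moreover have "(\<lambda>t. g (\<gamma> t)) -` (- {0}) \<inter> S = U" by (auto simp: U_def)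
      ultimately show ?thesis by simp
    qed
    moreover have "0 \<in> U" using a S01 by (simp add: U_def \<gamma>_def)
    ultimately have lim: "0 islimpt U"
      using interior_limit_point[of 0 U] by (simp add: interior_open)
    have "f (\<gamma> 1) = 0"
    proof (rule analytic_continuation[OF f\<gamma> S(1) convex_connected[OF S(2)] _ S01(1) lim _ S01(2)])
      show "U \<subseteq> S" by (auto simp: U_def)
      fix t assume "t \<in> U"
      then have "t \<in> S" "g (\<gamma> t) \<noteq> 0" by (auto simp: U_def)
      then show "f (\<gamma> t) = 0" using r3(2)[of "\<gamma> t"] in_r[of t] sub by auto
    qed
    then show "f b = 0" by (simp add: \<gamma>_def)
  qed
  then show "eventually (\<lambda>x. f x = 0) (at_0 n)" using r(1) by (auto simp: eventually_at_0)
qed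

section \<open>Defects of the generating vector fields\<close>

definition capP :: "nat \<Rightarrow> (nat \<Rightarrow> complex) \<Rightarrow> complex \<Rightarrow> complex" where
  "capP k x t = t ^ k + (\<Sum>i=1..k-2. x i * t ^ i)"

definition capQ :: "nat \<Rightarrow> (nat \<Rightarrow> complex) \<Rightarrow> complex \<Rightarrow> complex" where
  "capQ k x t = (\<Sum>i=1..k-1. x (k - 2 + i) * t ^ i)"

definition dcapP :: "nat \<Rightarrow> (nat \<Rightarrow> complex) \<Rightarrow> complex \<Rightarrow> complex" where
  "dcapP k x t = of_nat k * t ^ (k - 1) + (\<Sum>i=1..k-2. of_nat i * x i * t ^ (i - 1))"

definition dcapQ :: "nat \<Rightarrow> (nat \<Rightarrow> complex) \<Rightarrow> complex \<Rightarrow> complex" where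
  "dcapQ k x t = (\<Sum>i=1..k-1. of_nat i * x (k - 2 + i) * t ^ (i - 1))"

text \<open>Lifting \<open>\<xi>\<close> means solving \<open>defect1 = dcapP * g\<close> and \<open>defect2 = dcapQ * g\<close> for the
  \<open>y\<close>-component \<open>g\<close> of the lift.\<close>

definition defect1 :: "nat \<Rightarrow> (nat \<Rightarrow> complex) \<Rightarrow> complex \<Rightarrow> complex" where
  "defect1 k c t = c (2 * k - 2) - (\<Sum>l=1..k-2. c l * t ^ l)"

definition defect2 :: "nat \<Rightarrow> (nat \<Rightarrow> complex) \<Rightarrow> complex \<Rightarrow> complex" where
  "defect2 k c t = c (2 * k - 1) - (\<Sum>l=1..k-1. c (k - 2 + l) * t ^ l)"

section \<open>Integer indices, dummy variables and convolution sums\<close>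

lemma sum_nat_int: "(\<Sum>l=a..b. f l) = (\<Sum>i=int a..int b. f (nat i))"
  by (rule sum.reindex_bij_witness[of _ nat int]) auto

lemma defect1_target_tuple:
  assumes "k \<ge> 2"
  shows "defect1 k (target_tuple (int k) A B C1 C2) t = C1 - (\<Sum>i=1..int k-2. A i * t ^ nat i)"
proof -
  have "(\<Sum>l=1..k-2. target_tuple (int k) A B C1 C2 l * t ^ l) = (\<Sum>l=1..k-2. A (int l) * t ^ l)"
    using assms by (intro sum.cong) (auto simp: target_tuple_def)
  also have "\<dots> = (\<Sum>i=1..int k-2. A i * t ^ nat i)"
    using assms unfolding sum_nat_int by (intro sum.cong) (auto simp: of_nat_diff)
  finally show ?thesis using assms by (simp add: defect1_def target_tuple_def of_nat_diff)
qed

lemma defect2_target_tuple: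
  assumes "k \<ge> 2"
  shows "defect2 k (target_tuple (int k) A B C1 C2) t = C2 - (\<Sum>i=1..int k-1. B i * t ^ nat i)"
proof -
  have "(\<Sum>l=1..k-1. target_tuple (int k) A B C1 C2 (k - 2 + l) * t ^ l) = (\<Sum>l=1..k-1. B (int l) * t ^ l)"
    using assms by (intro sum.cong) (auto simp: target_tuple_def of_nat_diff)
  also have "\<dots> = (\<Sum>i=1..int k-1. B i * t ^ nat i)"
    using assms unfolding sum_nat_int by (intro sum.cong) (auto simp: of_nat_diff)
  finally show ?thesis using assms by (simp add: defect2_def target_tuple_def of_nat_diff)
qed

lemma Uc_support: "r \<notin> {1..k} \<Longrightarrow> Uc k X r = 0" if "k \<ge> 2"
  using that by (auto simp: Uc_def)

lemma Vc_support: "r \<notin> {1..k} \<Longrightarrow> Vc k X r = 0"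
  by (auto simp: Vc_def)

text \<open>The dummy values \<open>U_k = 1\<close> and \<open>U_{k-1} = 0\<close> absorb the
  leading monomial and the missing one into a uniform sum.\<close>

lemma capP_Uc:
  assumes "k \<ge> 2" shows "capP k X t = (\<Sum>r=1..int k. Uc (int k) X r * t ^ nat r)"
proof -
  have "{1..int k} = {1..int k - 2} \<union> {int k - 1, int k}" using assms by auto
  then have "(\<Sum>r=1..int k. Uc (int k) X r * t ^ nat r) =
      (\<Sum>r=1..int k - 2. Uc (int k) X r * t ^ nat r) + t ^ k"
    by (subst sum.union_disjoint[of "{1..int k - 2}" "{int k - 1, int k}", symmetric] | simp add: Uc_def)+
  also have "(\<Sum>r=1..int k - 2. Uc (int k) X r * t ^ nat r) = (\<Sum>i=1..k-2. X i * t ^ i)"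
    unfolding sum_nat_int using assms by (intro sum.cong) (auto simp: Uc_def of_nat_diff)
  finally show ?thesis by (simp add: capP_def)
qed

lemma dcapP_Uc:
  assumes "k \<ge> 2" shows "dcapP k X t = (\<Sum>r=1..int k. of_int r * Uc (int k) X r * t ^ nat (r - 1))"
proof -
  have "{1..int k} = {1..int k - 2} \<union> {int k - 1, int k}" using assms by auto
  then have "(\<Sum>r=1..int k. of_int r * Uc (int k) X r * t ^ nat (r - 1)) =
      (\<Sum>r=1..int k - 2. of_int r * Uc (int k) X r * t ^ nat (r - 1)) + of_nat k * t ^ nat (int k - 1)"
    by (subst sum.union_disjoint[of "{1..int k - 2}" "{int k - 1, int k}", symmetric] | simp add: Uc_def)+
  also have "(\<Sum>r=1..int k - 2. of_int r * Uc (int k) X r * t ^ nat (r - 1)) = (\<Sum>i=1..k-2. of_nat i * X i * t ^ (i - 1))"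
    unfolding sum_nat_int using assms by (intro sum.cong) (auto simp: Uc_def of_nat_diff nat_diff_distrib)
  also have "nat (int k - 1) = k - 1" using assms by auto
  finally show ?thesis by (simp add: dcapP_def)
qed

lemma sum_Vc:
  assumes "k \<ge> 2"
  shows "(\<Sum>r=1..int k. f r * Vc (int k) X r) = (\<Sum>i=1..k-1. f (int i) * X (k - 2 + i))"
proof -
  have "(\<Sum>r=1..int k. f r * Vc (int k) X r) = (\<Sum>r=1..int k - 1. f r * Vc (int k) X r)"
    by (rule sum.mono_neutral_right) (auto simp: Vc_def)
  also have "\<dots> = (\<Sum>i=1..k-1. f (int i) * X (k - 2 + i))"
    unfolding sum_nat_int using assms
    by (intro sum.cong) (auto simp: Vc_def of_nat_diff nat_add_distrib nat_diff_distrib)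
  finally show ?thesis .
qed

lemma capQ_Vc: "k \<ge> 2 \<Longrightarrow> capQ k X t = (\<Sum>r=1..int k. Vc (int k) X r * t ^ nat r)"
  using sum_Vc[of k "\<lambda>r. t ^ nat r" X] by (simp add: capQ_def mult.commute)

lemma dcapQ_Vc:
  assumes "k \<ge> 2" shows "dcapQ k X t = (\<Sum>r=1..int k. of_int r * Vc (int k) X r * t ^ nat (r - 1))"
proof -
  have "(\<Sum>r=1..int k. (of_int r * t ^ nat (r - 1)) * Vc (int k) X r) =
    (\<Sum>i=1..k-1. (of_nat i * t ^ (i - 1)) * X (k - 2 + i))"
    using sum_Vc[OF assms, of "\<lambda>r. of_int r * t ^ nat (r - 1)" X]
    by (simp add: nat_diff_distrib)
  then show ?thesis by (simp add: dcapQ_def mult_ac)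
qed

text \<open>The substitution is \<open>m = b + i - r\<close>.\<close>

lemma convolution_regroup:
  fixes f :: "int \<Rightarrow> int \<Rightarrow> complex"
  assumes supp: "\<And>r m. f r m \<noteq> 0 \<Longrightarrow> 1 \<le> r \<and> r \<le> K \<and> m \<le> K" and b: "b \<ge> 0" and e: "e \<ge> 0"
  shows "(\<Sum>i=0..2*K. (\<Sum>r=1..i-e. f r (b + i - r)) * t ^ nat i) =
    (\<Sum>r=1..K. \<Sum>m=b+e..K. f r m * t ^ nat (r + m - b))"
proof -
  have "(\<Sum>i=0..2*K. (\<Sum>r=1..i-e. f r (b + i - r)) * t ^ nat i) =
    (\<Sum>(i, r)\<in>(SIGMA i:{0..2*K}. {1..i-e}). f r (b + i - r) * t ^ nat i)"
    by (simp add: sum_distrib_right sum.Sigma)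
  \<comment> \<open>The condition \<open>r \<le> i - e\<close> becomes \<open>m \<ge> b + e\<close>.
    The two index sets correspond to each other only on the support of \<open>f\<close>, so the
    vanishing terms are discarded first.\<close>
  also have "\<dots> = (\<Sum>(r, m)\<in>{1..K} \<times> {b+e..K}. f r m * t ^ nat (r + m - b))"
    by (rule sum.reindex_bij_witness_not_neutral
      [of "{p \<in> (SIGMA i:{0..2*K}. {1..i-e}). f (snd p) (b + fst p - snd p) = 0}"
          "{p \<in> {1..K} \<times> {b+e..K}. f (fst p) (snd p) = 0}" _
        "\<lambda>(r, m). (r + m - b, r)" "\<lambda>(i, r). (r, b + i - r)"])
       (use b e in \<open>auto dest: supp intro: finite_subset[of _ "SIGMA i:{0..2*K}. {1..i-e}"] finite_subset[of _ "{1..K} \<times> {b+e..K}"]\<close>)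
  also have "\<dots> = (\<Sum>r=1..K. \<Sum>m=b+e..K. f r m * t ^ nat (r + m - b))"
    by (simp add: sum.cartesian_product)
  finally show ?thesis .
qed

lemma sum_shift_tail:
  fixes G :: "int \<Rightarrow> complex"
  assumes "\<And>m. m > K \<Longrightarrow> G m = 0" "b \<ge> 0" "c \<ge> 0" "K \<ge> 0"
  shows "(\<Sum>i=c..2*K. G (b + i) * t ^ nat i) = (\<Sum>m=b+c..K. G m * t ^ nat (m - b))"
proof -
  have "(\<Sum>i=c..2*K. G (b + i) * t ^ nat i) = (\<Sum>m=b+c..b+2*K. G m * t ^ nat (m - b))"
    by (rule sum.reindex_bij_witness[of _ "\<lambda>m. m - b" "\<lambda>i. b + i"]) auto
  also have "\<dots> = (\<Sum>m=b+c..K. G m * t ^ nat (m - b))"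
    by (rule sum.mono_neutral_right) (use assms in auto)
  finally show ?thesis .
qed

lemma product_of_sums:
  fixes F G :: "int \<Rightarrow> complex"
  assumes "\<And>r. r \<in> {1..K} \<Longrightarrow> l \<le> r" "b \<le> c"
  shows "(\<Sum>r=1..K. F r * t ^ nat (r - l)) * (\<Sum>m=c..K. G m * t ^ nat (m - b)) =
    (\<Sum>r=1..K. \<Sum>m=c..K. F r * G m * t ^ nat (r + m - b - l))"
proof -
  have "t ^ nat (r - l) * t ^ nat (m - b) = t ^ nat (r + m - b - l)" if "r \<in> {1..K}" "m \<in> {c..K}" for r m
    using assms(1)[OF that(1)] that(2) assms(2)
    by (simp add: power_add[symmetric] nat_add_distrib[symmetric] algebra_simps)
  then show ?thesis
    unfolding sum_product by (intro sum.cong refl) (simp add: mult.assoc mult.left_commute[of "t ^ nat (_ - l)"])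
qed

text \<open>Reflection \<open>r \<mapsto> N - r\<close> permutes the support and negates the
  summand, so the sum equals its own negative.\<close>

lemma sum_antisym:
  fixes g :: "int \<Rightarrow> complex"
  assumes supp: "\<And>r. g r \<noteq> 0 \<Longrightarrow> 1 \<le> r \<and> r \<le> K" and anti: "\<And>r. g (N - r) = - g r"
  shows "(\<Sum>r=1..K. g r) = 0"
proof -
  have "(\<Sum>r=1..K. g r) = (\<Sum>r=1..K. g (N - r))"
  proof (rule sum.reindex_bij_witness_not_neutral
      [of "{r \<in> {1..K}. g r = 0}" "{r \<in> {1..K}. g (N - r) = 0}" _ "\<lambda>r. N - r" "\<lambda>r. N - r"])
    fix r assume r: "r \<in> {1..K} - {r \<in> {1..K}. g r = 0}"
    then have "g (N - r) \<noteq> 0" using anti[of r] by simp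
    then show "N - r \<in> {1..K} - {r \<in> {1..K}. g (N - r) = 0}" using supp[of "N - r"] r by auto
  next
    fix r assume r: "r \<in> {1..K} - {r \<in> {1..K}. g (N - r) = 0}"
    then show "N - r \<in> {1..K} - {r \<in> {1..K}. g r = 0}" using supp[of "N - r"] by auto
  qed (auto intro: finite_subset[of _ "{1..K}"])
  also have "\<dots> = - (\<Sum>r=1..K. g r)" by (simp add: anti sum_negf)
  finally show ?thesis by simp
qed

text \<open>A defect is a polynomial in \<open>t\<close> with constant term \<open>C\<close> and
  remaining coefficients \<open>- A i\<close>. Padding it with zero coefficients up to
  \<open>2 * K\<close> gives the range on which the convolution identities hold, since products of
  two polynomials of degree \<open>K\<close> occur.\<close>

lemma defect_sum:
  fixes H A :: "int \<Rightarrow> complex"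
  assumes "0 \<le> L" "L \<le> 2 * K" "\<And>i. i > L \<Longrightarrow> H i = 0" "\<And>i. i \<in> {1..L} \<Longrightarrow> A i = - H i"
  shows "H 0 - (\<Sum>i=1..L. A i * t ^ nat i) = (\<Sum>i=0..2*K. H i * t ^ nat i)"
proof -
  have "(\<Sum>i=0..2*K. H i * t ^ nat i) = (\<Sum>i=0..L. H i * t ^ nat i)"
    by (rule sum.mono_neutral_right) (use assms in auto)
  also have "{0..L} = insert 0 {1..L}" using assms(1) by auto
  also have "(\<Sum>i\<in>insert 0 {1..L}. H i * t ^ nat i) = H 0 + (\<Sum>i=1..L. H i * t ^ nat i)"
    by simp
  also have "(\<Sum>i=1..L. H i * t ^ nat i) = - (\<Sum>i=1..L. A i * t ^ nat i)"
    unfolding sum_negf[symmetric] by (intro sum.cong) (use assms(4) in auto)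
  finally show ?thesis by simp
qed

text \<open>The common pattern behind the \<open>U\<close>- and \<open>V\<close>-components of the second and the third family:
  \<open>F = U\<close>, \<open>w = W1\<close> in the second and \<open>F = V\<close>, \<open>w = W2\<close> in the third, with \<open>a = k - j\<close>.\<close>

definition family_term :: "int \<Rightarrow> (int \<Rightarrow> complex) \<Rightarrow> (int \<Rightarrow> complex) \<Rightarrow> complex \<Rightarrow> int \<Rightarrow> complex" where
  "family_term a F G w i = of_int (a + 1 + i) * G (a + 1 + i) * w
     - (\<Sum>r=1..i. of_int (a + 1 + i - r) * F r * G (a + 1 + i - r))
     + (\<Sum>r=1..i. of_int r * F (a + 1 + i - r) * G r)"

context
  fixes K a :: int and F G :: "int \<Rightarrow> complex" and w t :: complex
  assumes F: "\<And>r. r \<notin> {1..K} \<Longrightarrow> F r = 0" and G: "\<And>r. r \<notin> {1..K} \<Longrightarrow> G r = 0"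
    and K: "K \<ge> 2" and a: "1 \<le> a" "a \<le> K"
begin

text \<open>Summation against powers of \<open>t\<close> turns both convolutions into products of
  polynomials. The factor \<open>w - F(t)\<close> is the reason for treating two families at once:
  it is zero for \<open>F = U\<close>, \<open>w = W1\<close> and equals \<open>graph_eq\<close> for
  \<open>F = V\<close>, \<open>w = W2\<close>.\<close>

lemma family_term_sum:
  "(\<Sum>i=0..2*K. family_term a F G w i * t ^ nat i) =
     (w - (\<Sum>r=1..K. F r * t ^ nat r)) * (\<Sum>m=a+1..K. of_int m * G m * t ^ nat (m - (a + 1)))
     + (\<Sum>r=1..K. of_int r * G r * t ^ nat (r - 1)) * (\<Sum>m=a+1..K. F m * t ^ nat (m - a))"
proof -
  have c1: "(\<Sum>i=0..2*K. (\<Sum>r=1..i-0. of_int (a+1+i-r) * F r * G (a+1+i-r)) * t ^ nat i) =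
      (\<Sum>r=1..K. \<Sum>m=(a+1)+0..K. of_int m * F r * G m * t ^ nat (r + m - (a+1)))"
    by (rule convolution_regroup) (use F G a in fastforce)+
  have c2: "(\<Sum>i=0..2*K. (\<Sum>r=1..i-0. of_int r * F (a+1+i-r) * G r) * t ^ nat i) =
      (\<Sum>r=1..K. \<Sum>m=(a+1)+0..K. of_int r * F m * G r * t ^ nat (r + m - (a+1)))"
    by (rule convolution_regroup) (use F G a in fastforce)+
  have s: "(\<Sum>i=0..2*K. (of_int (a + 1 + i) * G (a + 1 + i)) * t ^ nat i) =
      (\<Sum>m=(a+1)+0..K. of_int m * G m * t ^ nat (m - (a + 1)))"
    by (rule sum_shift_tail) (use G a K in auto)
  have p1: "(\<Sum>r=1..K. F r * t ^ nat (r - 0)) * (\<Sum>m=a+1..K. of_int m * G m * t ^ nat (m - (a + 1))) =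
      (\<Sum>r=1..K. \<Sum>m=a+1..K. F r * (of_int m * G m) * t ^ nat (r + m - (a+1) - 0))"
    by (rule product_of_sums) auto
  have p2: "(\<Sum>r=1..K. of_int r * G r * t ^ nat (r - 1)) * (\<Sum>m=a+1..K. F m * t ^ nat (m - a)) =
      (\<Sum>r=1..K. \<Sum>m=a+1..K. (of_int r * G r) * F m * t ^ nat (r + m - a - 1))"
    by (rule product_of_sums) auto
  have e: "family_term a F G w i * t ^ nat i = w * ((of_int (a + 1 + i) * G (a + 1 + i)) * t ^ nat i)
     - (\<Sum>r=1..i. of_int (a + 1 + i - r) * F r * G (a + 1 + i - r)) * t ^ nat i
     + (\<Sum>r=1..i. of_int r * F (a + 1 + i - r) * G r) * t ^ nat i" for i
    by (simp only: family_term_def ring_distribs mult_ac)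
  have "(\<Sum>i=0..2*K. family_term a F G w i * t ^ nat i) =
      w * (\<Sum>m=a+1..K. of_int m * G m * t ^ nat (m - (a + 1)))
      - (\<Sum>r=1..K. \<Sum>m=a+1..K. of_int m * F r * G m * t ^ nat (r + m - (a+1)))
      + (\<Sum>r=1..K. \<Sum>m=a+1..K. of_int r * F m * G r * t ^ nat (r + m - (a+1)))"
    unfolding e sum.distrib sum_subtractf sum_distrib_left[symmetric]
      c1[unfolded diff_0_right add_0_right] c2[unfolded diff_0_right add_0_right] s[unfolded add_0_right] ..
  also have "(\<Sum>r=1..K. \<Sum>m=a+1..K. of_int m * F r * G m * t ^ nat (r + m - (a+1))) =
      (\<Sum>r=1..K. F r * t ^ nat r) * (\<Sum>m=a+1..K. of_int m * G m * t ^ nat (m - (a + 1)))"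
    using p1 by (simp add: mult_ac)
  also have "(\<Sum>r=1..K. \<Sum>m=a+1..K. of_int r * F m * G r * t ^ nat (r + m - (a+1))) =
      (\<Sum>r=1..K. of_int r * G r * t ^ nat (r - 1)) * (\<Sum>m=a+1..K. F m * t ^ nat (m - a))"
    unfolding p2 by (intro sum.cong refl) (simp add: mult_ac diff_diff_eq)
  finally show ?thesis by (simp add: left_diff_distrib)
qed

text \<open>The combined summand is antisymmetric under \<open>r \<mapsto> a + 1 + i - r\<close>, so
  its sum over \<open>{1..K}\<close> is zero. For \<open>i = K - 1\<close> the upper limit misses
  exactly the term \<open>r = K\<close>, which is the boundary value on the right.\<close>

lemma family_sums_eq:
  assumes "i \<ge> K - 1"
  shows "- (\<Sum>r=1..i. of_int (a + 1 + i - r) * F r * G (a + 1 + i - r))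
     + (\<Sum>r=1..i. of_int r * F (a + 1 + i - r) * G r) =
     (if i = K - 1 then of_int a * F K * G a - of_int K * F a * G K else 0)"
proof -
  define g where "g r = of_int (a + 1 + i - r) * F r * G (a + 1 + i - r) - of_int r * F (a + 1 + i - r) * G r" for r
  have g: "g r = 0" if "r \<notin> {1..K}" for r using F[OF that] G[OF that] by (simp add: g_def)
  have total: "(\<Sum>r=1..K. g r) = 0"
    by (rule sum_antisym[where N = "a + 1 + i"]) (use g in \<open>force, simp add: g_def algebra_simps\<close>)
  have "(\<Sum>r=1..i. g r) = (if i = K - 1 then - g K else 0)"
  proof (cases "i = K - 1")
    case True
    then have "{1..K} = insert K {1..i}" using K by auto
    then show ?thesis using total True by (simp add: eq_neg_iff_add_eq_0 add.commute)
  next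
    case False
    have "(\<Sum>r=1..i. g r) = (\<Sum>r=1..K. g r)"
      by (rule sum.mono_neutral_right) (use False assms g in auto)
    then show ?thesis using total False by simp
  qed
  then show ?thesis unfolding g_def sum_subtractf by (auto simp: algebra_simps)
qed

lemma family_term_zero: "i \<ge> K \<Longrightarrow> family_term a F G w i = 0"
  using family_sums_eq[of i] G[of "a + 1 + i"] a by (simp add: family_term_def)

lemma family_term_last: "family_term a F G w (K - 1) = of_int a * F K * G a - of_int K * F a * G K"
  using family_sums_eq[of "K - 1"] G[of "a + K"] a by (simp add: family_term_def)

end

lemma derivative_sum_shift:
  fixes G :: "int \<Rightarrow> complex"
  assumes "\<And>r. r \<notin> {1..K} \<Longrightarrow> G r = 0" "K \<ge> 0"
  shows "(\<Sum>i=0..2*K. (of_int (i + 1) * G (i + 1)) * t ^ nat i) = (\<Sum>r=1..K. of_int r * G r * t ^ nat (r - 1))"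
  using sum_shift_tail[of K "\<lambda>m. of_int m * G m" 1 0 t] assms by (simp add: add.commute)

lemma family_defect_sum:
  fixes F G :: "int \<Rightarrow> complex"
  assumes F: "\<And>r. r \<notin> {1..K} \<Longrightarrow> F r = 0" and G: "\<And>r. r \<notin> {1..K} \<Longrightarrow> G r = 0"
    and K: "K \<ge> 2" and a: "1 \<le> a" "a \<le> K"
  shows "(\<Sum>i=0..2*K. (of_int K * family_term a F G w i + c * (of_int (i + 1) * G (i + 1))) * t ^ nat i) =
    (\<Sum>r=1..K. of_int r * G r * t ^ nat (r - 1)) * (c + of_int K * (\<Sum>m=a+1..K. F m * t ^ nat (m - a)))
    + (w - (\<Sum>r=1..K. F r * t ^ nat r)) * (of_int K * (\<Sum>m=a+1..K. of_int m * G m * t ^ nat (m - (a + 1))))"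
proof -
  have "(\<Sum>i=0..2*K. (of_int K * family_term a F G w i + c * (of_int (i + 1) * G (i + 1))) * t ^ nat i) =
     of_int K * (\<Sum>i=0..2*K. family_term a F G w i * t ^ nat i)
     + c * (\<Sum>i=0..2*K. (of_int (i + 1) * G (i + 1)) * t ^ nat i)"
    by (simp add: distrib_right sum.distrib sum_distrib_left mult.assoc del: of_int_add)
  also have "(\<Sum>i=0..2*K. (of_int (i + 1) * G (i + 1)) * t ^ nat i) = (\<Sum>r=1..K. of_int r * G r * t ^ nat (r - 1))"
    by (rule derivative_sum_shift) (use G K in auto)
  also note family_term_sum[where F = F and G = G, OF F G K a]
  finally show ?thesis by (simp add: algebra_simps)
qed

section \<open>Defects of the generators at points with \<open>W1 = P(t)\<close>, where
  \<open>W2\<close> remains free\<close>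

context
  fixes k :: nat and X :: "nat \<Rightarrow> complex" and t :: complex
  assumes k: "k \<ge> 2" and W1: "X (2 * k - 2) = capP k X t"
begin

private abbreviation (input) "K \<equiv> int k"
private abbreviation (input) "U \<equiv> Uc (int k) X"
private abbreviation (input) "V \<equiv> Vc (int k) X"

private lemma K2: "K \<ge> 2" using k by simp
private lemmas U0 = Uc_support[OF K2, of _ X]
private lemmas V0 = Vc_support[of _ "int k" X]

private lemma U_top: "U K = 1" "U (K - 1) = 0" "V K = 0" "U 0 = 0" "V 0 = 0" using k by (auto simp: Uc_def Vc_def)

private lemma W1_eq: "W1 K X = capP k X t" "W2 K X = X (2 * k - 1)"
proof -
  have "nat (2 * int k - 2) = 2 * k - 2" "nat (2 * int k - 1) = 2 * k - 1" using k by auto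
  then show "W1 K X = capP k X t" "W2 K X = X (2 * k - 1)" using W1 by (simp_all add: W1_def W2_def)
qed

text \<open>Euler's relation: \<open>P\<close> is weighted homogeneous of degree \<open>k\<close>
  when \<open>t\<close> has weight 1 and \<open>U_i\<close> has weight \<open>k - i\<close>.\<close>

lemma euler_U: "of_nat k * capP k X t - (\<Sum>i=1..K-2. of_int (K - i) * U i * t ^ nat i) = t * dcapP k X t"
proof -
  have "(\<Sum>i=1..K-2. of_int (K - i) * U i * t ^ nat i) = (\<Sum>i=1..K. of_int (K - i) * U i * t ^ nat i)"
    by (rule sum.mono_neutral_left) (auto simp: Uc_def)
  also have "of_nat k * capP k X t - \<dots> = (\<Sum>i=1..K. of_int i * U i * t ^ nat i)"
    by (simp add: capP_Uc[OF k] sum_distrib_left sum_subtractf[symmetric] algebra_simps)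
  also have "\<dots> = t * dcapP k X t"
    unfolding dcapP_Uc[OF k] sum_distrib_left
  proof (intro sum.cong refl)
    fix i assume "i \<in> {1..K}"
    then have "nat i = Suc (nat (i - 1))" by auto
    then show "of_int i * U i * t ^ nat i = t * (of_int i * U i * t ^ nat (i - 1))" by (simp add: mult_ac)
  qed
  finally show ?thesis .
qed

lemma t_dcapQ: "t * dcapQ k X t = (\<Sum>i=1..K. of_int i * V i * t ^ nat i)"
  unfolding dcapQ_Vc[OF k] sum_distrib_left
proof (intro sum.cong refl)
  fix i assume "i \<in> {1..K}"
  then have "nat i = Suc (nat (i - 1))" by auto
  then show "t * (of_int i * V i * t ^ nat (i - 1)) = of_int i * V i * t ^ nat i" by (simp add: mult_ac)
qed

lemma euler_V: "of_nat k * capQ k X t - (\<Sum>i=1..K-1. of_int (K - i) * V i * t ^ nat i) = t * dcapQ k X t"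
proof -
  have "(\<Sum>i=1..K-1. of_int (K - i) * V i * t ^ nat i) = (\<Sum>i=1..K. of_int (K - i) * V i * t ^ nat i)"
    by (rule sum.mono_neutral_left) (auto simp: Vc_def)
  also have "of_nat k * capQ k X t - \<dots> = (\<Sum>i=1..K. of_int i * V i * t ^ nat i)"
    by (simp add: capQ_Vc[OF k] sum_distrib_left sum_subtractf[symmetric] algebra_simps)
  finally show ?thesis by (simp add: t_dcapQ)
qed

lemma euler_field_defects:
  "defect1 k (euler_field K X) t = dcapP k X t * t"
  "defect2 k (euler_field K X) t = dcapQ k X t * t + (X (2 * k - 1) - capQ k X t) * of_nat k"
  using euler_U euler_V
  by (simp_all add: euler_field_def defect1_target_tuple[OF k] defect2_target_tuple[OF k] W1_eq algebra_simps)

text \<open>The product with \<open>w - F(t)\<close> in \<open>family_defect_sum\<close> drops out,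
  because here \<open>w\<close> is \<open>P(t)\<close> and \<open>F\<close> is \<open>U\<close>;
  only a multiple of the derivatives by a common \<open>g\<close> is left.\<close>

lemma field2_defects:
  assumes j: "1 \<le> j" "j \<le> K - 1"
  defines "g \<equiv> of_int j * U (K - j) + of_nat k * (\<Sum>m=K-j+1..K. U m * t ^ nat (m - (K - j)))"
  shows "defect1 k (field2 K j X) t = dcapP k X t * g"
    and "defect2 k (field2 K j X) t = dcapQ k X t * g"
proof -
  define a where "a = K - j"
  have a: "1 \<le> a" "a \<le> K" using j by (auto simp: a_def)
  have j_eq: "j = K - a" by (simp add: a_def)
  define H where "H G i = of_int K * family_term a U G (capP k X t) i + of_int j * U a * (of_int (i + 1) * G (i + 1))" for G i
  have idx: "K + i - j + 1 = a + 1 + i" "K + i - j - r + 1 = a + 1 + i - r" "K - j = a" "K - j + 1 = a + 1"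
     "K + i - j - 2 * r + 1 = a + 1 + i - 2 * r" for i r by (auto simp: a_def)
  have sum_H: "(\<Sum>i=0..2*K. H G i * t ^ nat i) = (\<Sum>r=1..K. of_int r * G r * t ^ nat (r - 1)) * g"
    if G: "\<And>r. r \<notin> {1..K} \<Longrightarrow> G r = 0" for G
    unfolding H_def
    by (subst family_defect_sum[where F = U and G = G, OF U0 G K2 a]) (auto simp: g_def a_def capP_Uc[OF k])
  \<comment> \<open>There is no \<open>U\<close>-component for the power \<open>K - 1\<close>, so
    this coefficient has to cancel. The boundary term is \<open>(a - K) * U a\<close>, and the
    summand \<open>j * U a\<close> of \<open>g\<close>, multiplied by the leading coefficient of
    \<open>P'\<close>, compensates for it because \<open>j = K - a\<close>.\<close>
  have U_last: "H U i = 0" if "i > K - 2" for i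
  proof (cases "i = K - 1")
    case True
    have E: "family_term a U U (capP k X t) i = of_int a * U a - of_int K * U a"
      unfolding True using family_term_last[where F = U and G = U, OF U0 U0 K2 a, where w = "capP k X t"] U_top
      by simp
    have iK: "i + 1 = K" using True by simp
    show ?thesis unfolding H_def E iK U_top by (simp add: j_eq algebra_simps)
  next
    case False
    then show ?thesis using that family_term_zero[where F = U and G = U, OF U0 U0 K2 a] U0[of "i + 1"] by (simp add: H_def)
  qed
  have V_last: "H V i = 0" if "i > K - 1" for i
    using that family_term_zero[where F = U and G = V, OF U0 V0 K2 a] V0[of "i + 1"] by (simp add: H_def)
  have "defect1 k (field2 K j X) t = H U 0 - (\<Sum>i=1..K-2. - H U i * t ^ nat i)"
    unfolding field2_def defect1_target_tuple[OF k] W1_eq idx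
    by (rule arg_cong2[where f = minus]; (intro sum.cong refl arg_cong2[where f = times])?;
        simp add: H_def family_term_def sum_subtractf[symmetric] algebra_simps del: of_int_diff of_int_add;
        simp add: algebra_simps sum.distrib sum_subtractf sum_distrib_left)
  also have "\<dots> = (\<Sum>i=0..2*K. H U i * t ^ nat i)"
    by (rule defect_sum) (use k U_last in auto)
  also have "\<dots> = dcapP k X t * g" unfolding dcapP_Uc[OF k] by (rule sum_H[OF U0])
  finally show "defect1 k (field2 K j X) t = dcapP k X t * g" .
  have "defect2 k (field2 K j X) t = H V 0 - (\<Sum>i=1..K-1. - H V i * t ^ nat i)"
    unfolding field2_def defect2_target_tuple[OF k] W1_eq idx
    by (rule arg_cong2[where f = minus]; (intro sum.cong refl arg_cong2[where f = times])?;
        simp add: H_def family_term_def algebra_simps)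
  also have "\<dots> = (\<Sum>i=0..2*K. H V i * t ^ nat i)"
    by (rule defect_sum) (use k V_last in auto)
  also have "\<dots> = dcapQ k X t * g" unfolding dcapQ_Vc[OF k] by (rule sum_H[OF V0])
  finally show "defect2 k (field2 K j X) t = dcapQ k X t * g" .
qed

text \<open>With \<open>F = V\<close> and \<open>w = W2\<close> free, the product with
  \<open>w - F(t)\<close> survives and provides \<open>h1\<close> and \<open>h2\<close>.\<close>

lemma field3_defects:
  assumes j: "1 \<le> j" "j \<le> K - 1"
  defines "g \<equiv> of_nat k * (\<Sum>m=K-j..K. V m * t ^ nat (m - (K - j)))"
  defines "T \<equiv> \<lambda>G. \<Sum>m=K-j+1..K. of_int m * G m * t ^ nat (m - (K - j + 1))"
  shows "defect1 k (field3 K j X) t = dcapP k X t * g + (X (2 * k - 1) - capQ k X t) * (of_nat k * T U)"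
    and "defect2 k (field3 K j X) t = dcapQ k X t * g + (X (2 * k - 1) - capQ k X t) * (of_nat k * T V)"
proof -
  define a where "a = K - j"
  have a: "1 \<le> a" "a \<le> K" using j by (auto simp: a_def)
  have j_eq: "j = K - a" by (simp add: a_def)
  define w where "w = X (2 * k - 1)"
  define H where "H G i = of_int K * family_term a V G w i + of_int K * V a * (of_int (i + 1) * G (i + 1))" for G i
  have idx: "K + i - j + 1 = a + 1 + i" "K + i - j - r + 1 = a + 1 + i - r" "K - j = a" "K - j + 1 = a + 1"
     "K + i - j - 2 * r + 1 = a + 1 + i - 2 * r" for i r by (auto simp: a_def)
  have ga: "g = of_nat k * (V a + (\<Sum>m=a+1..K. V m * t ^ nat (m - a)))"
  proof -
    have "{K-j..K} = insert a {a+1..K}" using a by (auto simp: a_def)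
    then show ?thesis by (simp add: g_def a_def[symmetric])
  qed
  have sum_H: "(\<Sum>i=0..2*K. H G i * t ^ nat i) = (\<Sum>r=1..K. of_int r * G r * t ^ nat (r - 1)) * g
      + (w - capQ k X t) * (of_nat k * T G)"
    if G: "\<And>r. r \<notin> {1..K} \<Longrightarrow> G r = 0" for G
    unfolding H_def ga T_def
    by (subst family_defect_sum[where F = V and G = G, OF V0 G K2 a]) (auto simp: capQ_Vc[OF k] a_def algebra_simps)
  \<comment> \<open>As \<open>V_K = 0\<close>, the boundary term is \<open>- K * V a\<close> here;
    the constant term \<open>K * V a\<close> of \<open>g\<close> removes it.\<close>
  have U_last: "H U i = 0" if "i > K - 2" for i
  proof (cases "i = K - 1")
    case True
    have "family_term a V U w i = - of_int K * V a"
      unfolding True using family_term_last[where F = V and G = U, OF V0 U0 K2 a, where w = w] U_top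
      by simp
    moreover have "i + 1 = K" using True by simp
    ultimately show ?thesis using U_top by (simp add: H_def)
  next
    case False
    then show ?thesis using that family_term_zero[where F = V and G = U, OF V0 U0 K2 a] U0[of "i + 1"] by (simp add: H_def)
  qed
  have V_last: "H V i = 0" if "i > K - 1" for i
    using that family_term_zero[where F = V and G = V, OF V0 V0 K2 a] V0[of "i + 1"] by (simp add: H_def)
  have "defect1 k (field3 K j X) t = H U 0 - (\<Sum>i=1..K-2. - H U i * t ^ nat i)"
    unfolding field3_def defect1_target_tuple[OF k] W1_eq idx w_def[symmetric]
    by (rule arg_cong2[where f = minus]; (intro sum.cong refl arg_cong2[where f = times])?;
        simp add: H_def family_term_def algebra_simps)
  also have "\<dots> = (\<Sum>i=0..2*K. H U i * t ^ nat i)"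
    by (rule defect_sum) (use k U_last in auto)
  also have "\<dots> = dcapP k X t * g + (w - capQ k X t) * (of_nat k * T U)"
    unfolding dcapP_Uc[OF k] by (rule sum_H[OF U0])
  finally show "defect1 k (field3 K j X) t = dcapP k X t * g + (X (2 * k - 1) - capQ k X t) * (of_nat k * T U)"
    by (simp add: w_def)
  have "defect2 k (field3 K j X) t = H V 0 - (\<Sum>i=1..K-1. - H V i * t ^ nat i)"
    unfolding field3_def defect2_target_tuple[OF k] W1_eq idx w_def[symmetric]
    by (rule arg_cong2[where f = minus]; (intro sum.cong refl arg_cong2[where f = times])?;
        simp add: H_def family_term_def algebra_simps;
        simp add: algebra_simps sum.distrib sum_subtractf sum_distrib_left)
  also have "\<dots> = (\<Sum>i=0..2*K. H V i * t ^ nat i)"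
    by (rule defect_sum) (use k V_last in auto)
  also have "\<dots> = dcapQ k X t * g + (w - capQ k X t) * (of_nat k * T V)"
    unfolding dcapQ_Vc[OF k] by (rule sum_H[OF V0])
  finally show "defect2 k (field3 K j X) t = dcapQ k X t * g + (X (2 * k - 1) - capQ k X t) * (of_nat k * T V)"
    by (simp add: w_def)
qed

text \<open>The first defect is \<open>(K - j) * U j\<close> times Euler's relation. In the second,
  the convolution equal to \<open>P\<close> times the tail of \<open>V\<close> cancels against the
  \<open>W1\<close>-term, while the other one equals \<open>Q * S\<close> and joins the
  \<open>W2\<close>-term to form \<open>graph_eq * S\<close>.\<close>

lemma field1_defects:
  assumes j: "1 \<le> j" "j \<le> K - 1"
  defines "g \<equiv> of_int (K - j) * U j * t"
  defines "S \<equiv> \<Sum>m=j+1..K. U m * t ^ nat (m - j)"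
  shows "defect1 k (field1 K j X) t = dcapP k X t * g"
    and "defect2 k (field1 K j X) t = dcapQ k X t * g
      + (X (2 * k - 1) - capQ k X t) * (of_int (K - j) * U j + of_nat k * S)"
proof -
  have "defect1 k (field1 K j X) t = of_int (K - j) * U j *
      (of_nat k * capP k X t - (\<Sum>i=1..K-2. of_int (K - i) * U i * t ^ nat i))"
    unfolding field1_def defect1_target_tuple[OF k] W1_eq
    by (simp only: of_int_mult) (simp only: right_diff_distrib sum_distrib_left of_int_of_nat_eq mult_ac)
  then show "defect1 k (field1 K j X) t = dcapP k X t * g"
    unfolding euler_U by (simp add: g_def mult_ac)
next
  define w where "w = X (2 * k - 1)"
  \<comment> \<open>Coefficients of the second defect up to one correction in degree 0. The upper
    limits \<open>i - 1\<close> and \<open>i - 0\<close> are in the form \<open>i - e\<close> of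
    \<open>convolution_regroup\<close>.\<close>
  define H where "H i = - of_nat k * (\<Sum>r=1..i-1. V r * U (j + i - r))
     + of_nat k * (\<Sum>r=1..i-0. U r * V (j + i - r))
     + of_int (K - j) * U j * (of_int (i - 1) * V i)
     - of_nat k * capP k X t * V (j + i) + of_nat k * w * U (j + i)" for i
  have H_zero: "H i = 0" if i: "i > K - 1" for i
  proof -
    define g where "g r = V r * U (j + i - r) - U r * V (j + i - r)" for r
    have "(\<Sum>r=1..K. g r) = 0"
    proof (rule sum_antisym[where N = "j + i"])
      show "1 \<le> r \<and> r \<le> K" if "g r \<noteq> 0" for r
        using that U0[of r] V0[of r] by (cases "r \<in> {1..K}") (auto simp: g_def)
    qed (simp add: g_def)
    moreover have "(\<Sum>r=1..i-1. V r * U (j + i - r)) = (\<Sum>r=1..K. V r * U (j + i - r))"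
    proof -
      have "V r = 0" if "r \<notin> {1..K-1}" for r using that by (auto simp: Vc_def)
      then have "(\<Sum>r=1..i-1. V r * U (j + i - r)) = (\<Sum>r=1..K-1. V r * U (j + i - r))"
        "(\<Sum>r=1..K. V r * U (j + i - r)) = (\<Sum>r=1..K-1. V r * U (j + i - r))"
        using i by (auto intro!: sum.mono_neutral_right)
      then show ?thesis by simp
    qed
    moreover have "(\<Sum>r=1..i-0. U r * V (j + i - r)) = (\<Sum>r=1..K. U r * V (j + i - r))"
      by (rule sum.mono_neutral_right) (use i U0 in auto)
    moreover have "V (j + i) = 0" "U (j + i) = 0" "V i = 0"
      using V0[of "j + i"] U0[of "j + i"] V0[of i] V0[of K] U_top i j by (auto simp: Vc_def)
    ultimately show ?thesis by (simp add: H_def g_def sum_subtractf)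
  qed
  have V_sum: "(\<Sum>i=0..2*K. V (j + i) * t ^ nat i) = (\<Sum>m=j+0..K. V m * t ^ nat (m - j))"
    by (rule sum_shift_tail) (use V0 j in auto)
  have U_sum: "(\<Sum>i=0..2*K. U (j + i) * t ^ nat i) = (\<Sum>m=j+0..K. U m * t ^ nat (m - j))"
    by (rule sum_shift_tail) (use U0 j in auto)
  have "{j+0..K} = insert j {j+1..K}" using j by auto
  then have U_split: "(\<Sum>m=j+0..K. U m * t ^ nat (m - j)) = U j + S" by (simp add: S_def)
  have VU: "(\<Sum>i=0..2*K. (\<Sum>r=1..i-1. V r * U (j + i - r)) * t ^ nat i) = capQ k X t * S"
  proof -
    have "(\<Sum>i=0..2*K. (\<Sum>r=1..i-1. V r * U (j + i - r)) * t ^ nat i) =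
      (\<Sum>r=1..K. \<Sum>m=j+1..K. V r * U m * t ^ nat (r + m - j))"
      by (rule convolution_regroup) (use U0 V0 j in fastforce)+
    also have "\<dots> = (\<Sum>r=1..K. V r * t ^ nat (r - 0)) * S"
      unfolding S_def by (subst product_of_sums) auto
    finally show ?thesis by (simp add: capQ_Vc[OF k])
  qed
  have UV: "(\<Sum>i=0..2*K. (\<Sum>r=1..i-0. U r * V (j + i - r)) * t ^ nat i) =
     capP k X t * (\<Sum>m=j+0..K. V m * t ^ nat (m - j))"
  proof -
    have "(\<Sum>i=0..2*K. (\<Sum>r=1..i-0. U r * V (j + i - r)) * t ^ nat i) =
      (\<Sum>r=1..K. \<Sum>m=j+0..K. U r * V m * t ^ nat (r + m - j))"
      by (rule convolution_regroup) (use U0 V0 j in fastforce)+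
    also have "\<dots> = (\<Sum>r=1..K. U r * t ^ nat (r - 0)) * (\<Sum>m=j+0..K. V m * t ^ nat (m - j))"
      by (subst product_of_sums) auto
    finally show ?thesis by (simp add: capP_Uc[OF k])
  qed
  have VV: "(\<Sum>i=0..2*K. (of_int (i - 1) * V i) * t ^ nat i) = t * dcapQ k X t - capQ k X t"
  proof -
    have "(\<Sum>i=0..2*K. (of_int (i - 1) * V i) * t ^ nat i) = (\<Sum>i=1..K. (of_int (i - 1) * V i) * t ^ nat i)"
    proof (rule sum.mono_neutral_right)
      show "\<forall>i\<in>{0..2*K} - {1..K}. of_int (i - 1) * V i * t ^ nat i = 0" using V0 by auto
    qed (use k in auto)
    then show ?thesis unfolding t_dcapQ capQ_Vc[OF k]
      by (simp add: sum_subtractf[symmetric] algebra_simps)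
  qed
  have H_times: "H i * t ^ nat i = - of_nat k * ((\<Sum>r=1..i-1. V r * U (j + i - r)) * t ^ nat i)
     + of_nat k * ((\<Sum>r=1..i-0. U r * V (j + i - r)) * t ^ nat i)
     + of_int (K - j) * U j * ((of_int (i - 1) * V i) * t ^ nat i)
     - of_nat k * capP k X t * (V (j + i) * t ^ nat i) + of_nat k * w * (U (j + i) * t ^ nat i)" for i
    unfolding H_def by (simp add: ring_distribs mult_ac)
  have "(\<Sum>i=0..2*K. H i * t ^ nat i) =
     - of_nat k * (\<Sum>i=0..2*K. (\<Sum>r=1..i-1. V r * U (j + i - r)) * t ^ nat i)
     + of_nat k * (\<Sum>i=0..2*K. (\<Sum>r=1..i-0. U r * V (j + i - r)) * t ^ nat i)
     + of_int (K - j) * U j * (\<Sum>i=0..2*K. (of_int (i - 1) * V i) * t ^ nat i)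
     - of_nat k * capP k X t * (\<Sum>i=0..2*K. V (j + i) * t ^ nat i)
     + of_nat k * w * (\<Sum>i=0..2*K. U (j + i) * t ^ nat i)"
    unfolding H_times sum.distrib sum_subtractf sum_distrib_left[symmetric] ..
  also have "\<dots> = dcapQ k X t * g + (w - capQ k X t) * (of_int (K - j) * U j + of_nat k * S) + of_int j * U j * w"
    unfolding VU UV VV V_sum U_sum U_split by (simp add: g_def algebra_simps)
  finally have sum_H: "(\<Sum>i=0..2*K. H i * t ^ nat i) =
     dcapQ k X t * g + (w - capQ k X t) * (of_int (K - j) * U j + of_nat k * S) + of_int j * U j * w" .
  \<comment> \<open>In degree 0 the uniform formula yields \<open>k * U j * w\<close>, whereas the
    field has \<open>(k - j) * U j * w\<close>; the excess is subtracted here and reappears in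
    \<open>sum_H\<close>.\<close>
  have "defect2 k (field1 K j X) t = (H 0 - of_int j * U j * w) - (\<Sum>i=1..K-1. - H i * t ^ nat i)"
    unfolding field1_def defect2_target_tuple[OF k] W1_eq w_def[symmetric]
    by (rule arg_cong2[where f = minus]; (intro sum.cong refl arg_cong2[where f = times])?;
        simp add: H_def U_top algebra_simps)
  also have "\<dots> = (\<Sum>i=0..2*K. H i * t ^ nat i) - of_int j * U j * w"
    by (subst defect_sum[of "K - 1" K H "\<lambda>i. - H i" t, symmetric]) (use k H_zero in auto)
  finally show "defect2 k (field1 K j X) t = dcapQ k X t * g
      + (X (2 * k - 1) - capQ k X t) * (of_int (K - j) * U j + of_nat k * S)"
    by (simp add: sum_H w_def)
qed

end

section \<open>Division by the unfolded polynomial\<close>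

text \<open>\<open>power_rem k x m j\<close> is the coefficient of \<open>y ^ j\<close> in the remainder of \<open>y ^ m\<close> modulo
  \<open>capP k x y - w\<close>, where \<open>w\<close> is stored in the place \<open>2 * k - 2\<close> of \<open>y\<close>.\<close>

function power_rem :: "nat \<Rightarrow> (nat \<Rightarrow> complex) \<Rightarrow> nat \<Rightarrow> nat \<Rightarrow> complex" where
  "power_rem k x m j = (if m < k \<or> k = 0 then (if m = j then 1 else 0)
     else x (2 * k - 2) * power_rem k x (m - k) j - (\<Sum>i=1..k-2. x i * power_rem k x (m - k + i) j))"
  by auto
termination by (relation "Wellfounded.measure (\<lambda>(k, x, m, j). m)") auto

declare power_rem.simps [simp del]

lemma power_rem_less: "m < k \<or> k = 0 \<Longrightarrow> power_rem k x m j = (if m = j then 1 else 0)"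
  by (subst power_rem.simps) simp

lemma power_rem_step:
  "\<not> (m < k \<or> k = 0) \<Longrightarrow> power_rem k x m j = x (2 * k - 2) * power_rem k x (m - k) j
     - (\<Sum>i=1..k-2. x i * power_rem k x (m - k + i) j)"
  by (subst power_rem.simps) simp

lemma power_eq_power_rem:
  assumes k: "k \<ge> 2" and w: "capP k x t = x (2 * k - 2)"
  shows "t ^ m = (\<Sum>j<k. power_rem k x m j * t ^ j)"
proof (induction m rule: less_induct)
  case (less m)
  show ?case
  proof (cases "m < k")
    case True
    then show ?thesis by (simp add: power_rem_less if_distrib[of "\<lambda>c. c * _"] cong: if_cong)
  next
    case False
    have step: "power_rem k x m j = x (2 * k - 2) * power_rem k x (m - k) j
        - (\<Sum>i=1..k-2. x i * power_rem k x (m - k + i) j)" for j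
      using False k by (intro power_rem_step) simp
    have "t ^ m = t ^ (m - k) * t ^ k" using False by (simp flip: power_add)
    also have "t ^ k = x (2 * k - 2) - (\<Sum>i=1..k-2. x i * t ^ i)"
      using w by (simp add: capP_def algebra_simps)
    also have "t ^ (m - k) * \<dots> = x (2 * k - 2) * t ^ (m - k) - (\<Sum>i=1..k-2. x i * t ^ (m - k + i))"
      by (simp add: algebra_simps power_add sum_distrib_left)
    also have "t ^ (m - k) = (\<Sum>j<k. power_rem k x (m - k) j * t ^ j)"
      by (rule less) (use False k in auto)
    also have "(\<Sum>i=1..k-2. x i * t ^ (m - k + i)) =
        (\<Sum>i=1..k-2. x i * (\<Sum>j<k. power_rem k x (m - k + i) j * t ^ j))"
    proof (intro sum.cong refl)
      fix i assume "i \<in> {1..k-2}"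
      then have "m - k + i < m" using False by auto
      from less[OF this] show "x i * t ^ (m - k + i) = x i * (\<Sum>j<k. power_rem k x (m - k + i) j * t ^ j)"
        by simp
    qed
    also have "\<dots> = (\<Sum>j<k. (\<Sum>i=1..k-2. x i * power_rem k x (m - k + i) j) * t ^ j)"
      unfolding sum_distrib_left sum_distrib_right by (subst sum.swap) (simp add: mult.assoc)
    finally show ?thesis
      unfolding step by (simp add: left_diff_distrib sum_subtractf sum_distrib_left mult.assoc)
  qed
qed

lemma power_rem_holomorphic: "(\<lambda>t. power_rem k (x(l := t)) m j) holomorphic_on S"
proof (induction m rule: less_induct)
  case (less m)
  have c: "(\<lambda>t. (x(l := t)) i) holomorphic_on S" for i
    by (cases "i = l") (auto intro: holomorphic_intros)
  show ?case
  proof (cases "m < k \<or> k = 0")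
    case True
    then show ?thesis by (auto simp: power_rem_less)
  next
    case False
    have IH: "(\<lambda>t. power_rem k (x(l := t)) (m - k + i) j) holomorphic_on S" if "i < k" for i
      using False that by (intro less) auto
    have "(\<lambda>t. (x(l := t)) (2 * k - 2) * power_rem k (x(l := t)) (m - k) j
       - (\<Sum>i=1..k-2. (x(l := t)) i * power_rem k (x(l := t)) (m - k + i) j)) holomorphic_on S"
      using IH[of 0] False by (intro holomorphic_intros c IH) auto
    moreover have "power_rem k (x(l := t)) m j = (x(l := t)) (2 * k - 2) * power_rem k (x(l := t)) (m - k) j
       - (\<Sum>i=1..k-2. (x(l := t)) i * power_rem k (x(l := t)) (m - k + i) j)" for t
      using False by (intro power_rem_step) simp
    ultimately show ?thesis by presburger
  qed
qed

text \<open>A reduction step replaces \<open>y ^ m\<close> by \<open>k - 1\<close> terms with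
  factors of size at most \<open>d\<close> and exponents at least \<open>m - k\<close>. By induction
  they contribute at most \<open>d * k * q ^ (m - k)\<close>, and \<open>d * k \<le> q ^ k\<close>
  restores \<open>q ^ m\<close>. The factor \<open>q ^ k\<close> on the left accommodates the powers
  below \<open>k\<close>, where the coefficient is 1.\<close>

lemma power_rem_bound:
  fixes q d :: real
  assumes q: "0 < q" "q \<le> 1" and d: "\<And>i. norm (x i) \<le> d" "d * k \<le> q ^ k" and k: "k \<ge> 2"
  shows "norm (power_rem k x m j) * q ^ k \<le> q ^ m"
proof (induction m rule: less_induct)
  case (less m)
  have d0: "d \<ge> 0" using d(1) norm_ge_zero order_trans by blast
  show ?case
  proof (cases "m < k")
    case True
    then have "q ^ k \<le> q ^ m" using q by (intro power_decreasing) auto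
    then show ?thesis using True q by (auto simp: power_rem_less)
  next
    case False
    have IH: "norm (power_rem k x (m - k + i) j) * q ^ k \<le> q ^ (m - k)" if "i < k" for i
    proof -
      have "norm (power_rem k x (m - k + i) j) * q ^ k \<le> q ^ (m - k + i)"
        using False that by (intro less) auto
      also have "\<dots> \<le> q ^ (m - k)" using q by (intro power_decreasing) auto
      finally show ?thesis .
    qed
    have t: "norm (x l * power_rem k x (m - k + i) j) * q ^ k \<le> d * q ^ (m - k)" if "i < k" for l i
    proof -
      have "norm (x l) * (norm (power_rem k x (m - k + i) j) * q ^ k) \<le> d * q ^ (m - k)"
        using d(1)[of l] IH[OF that] d0 q by (intro mult_mono) auto
      then show ?thesis by (simp add: norm_mult mult.assoc)
    qed
    have "power_rem k x m j = x (2 * k - 2) * power_rem k x (m - k) j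
        - (\<Sum>i=1..k-2. x i * power_rem k x (m - k + i) j)"
      using False k by (intro power_rem_step) simp
    then have "norm (power_rem k x m j) \<le> norm (x (2 * k - 2) * power_rem k x (m - k) j)
        + norm (\<Sum>i=1..k-2. x i * power_rem k x (m - k + i) j)"
      using norm_triangle_ineq4 by metis
    also have "\<dots> \<le> norm (x (2 * k - 2) * power_rem k x (m - k) j)
        + (\<Sum>i=1..k-2. norm (x i * power_rem k x (m - k + i) j))"
      by (intro add_left_mono norm_sum)
    finally have "norm (power_rem k x m j) * q ^ k \<le> (norm (x (2 * k - 2) * power_rem k x (m - k) j)
        + (\<Sum>i=1..k-2. norm (x i * power_rem k x (m - k + i) j))) * q ^ k"
      using q by (intro mult_right_mono) auto
    also have "\<dots> = norm (x (2 * k - 2) * power_rem k x (m - k) j) * q ^ k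
        + (\<Sum>i=1..k-2. norm (x i * power_rem k x (m - k + i) j) * q ^ k)"
      by (simp add: distrib_right sum_distrib_right)
    also have "\<dots> \<le> d * q ^ (m - k) + (\<Sum>i=1..k-2. d * q ^ (m - k))"
      using t[of 0 "2 * k - 2"] k by (intro add_mono sum_mono t) auto
    also have "\<dots> = (d * real (k - 1)) * q ^ (m - k)" using k by (simp add: of_nat_diff algebra_simps)
    also have "\<dots> \<le> (d * k) * q ^ (m - k)" using d0 q by (intro mult_right_mono mult_left_mono) auto
    also have "\<dots> \<le> q ^ k * q ^ (m - k)" using d(2) q by (intro mult_right_mono) auto
    also have "\<dots> = q ^ m" using False by (simp flip: power_add)
    finally show ?thesis .
  qed
qed

lemma analytic_germ_power_rem: "analytic_germ n (\<lambda>x. power_rem k x m j)"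
proof (induction m rule: less_induct)
  case (less m)
  show ?case
  proof (cases "m < k \<or> k = 0")
    case True
    then show ?thesis by (auto simp: power_rem_less)
  next
    case False
    have IH: "analytic_germ n (\<lambda>x. power_rem k x (m - k + i) j)" if "i < k" for i
      using False that by (intro less) auto
    have "analytic_germ n (\<lambda>x. x (2 * k - 2) * power_rem k x (m - k) j
       - (\<Sum>i=1..k-2. x i * power_rem k x (m - k + i) j))"
      using IH[of 0] False by (intro analytic_germ_intros IH) auto
    moreover have "power_rem k x m j = x (2 * k - 2) * power_rem k x (m - k) j
       - (\<Sum>i=1..k-2. x i * power_rem k x (m - k + i) j)" for x
      using False by (intro power_rem_step) simp
    ultimately show ?thesis by presburger
  qed
qed

text \<open>The map \<open>(u, v, y, w\<^sub>2) \<mapsto> (u, v, P(u, y), w\<^sub>2)\<close>; the germs on its source form a free module over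
  the germs on its target with basis \<open>1, y, \<dots>, y\<^bsup>k-1\<^esup>\<close>.\<close>

definition unfold_map :: "nat \<Rightarrow> (nat \<Rightarrow> complex) \<Rightarrow> nat \<Rightarrow> complex" where
  "unfold_map k x = x(2 * k - 2 := capP k x (x (2 * k - 2)))"

lemma capP_update [simp]: "k \<ge> 2 \<Longrightarrow> l > k - 2 \<Longrightarrow> capP k (x(l := s)) t = capP k x t"
  unfolding capP_def by (intro arg_cong2[where f = plus] refl sum.cong) auto

lemma analytic_germ_capP: "analytic_germ n (\<lambda>x. capP k x (x l))"
  unfolding capP_def by (intro analytic_germ_intros)

lemma capP_zero: "k \<ge> 1 \<Longrightarrow> capP k (\<lambda>_. 0) 0 = 0"
  by (simp add: capP_def)

lemma unfold_map_eq:
  assumes "k \<ge> 2"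
  shows "capP k (unfold_map k x) (x (2 * k - 2)) = unfold_map k x (2 * k - 2)"
  using assms by (simp add: unfold_map_def)

lemma germ_map_unfold_map: "k \<ge> 1 \<Longrightarrow> 2 * k - 2 \<in> {1..n} \<Longrightarrow> germ_map n n (unfold_map k)"
  unfolding unfold_map_def[abs_def] by (rule germ_map_update) (simp_all add: analytic_germ_capP capP_zero)

text \<open>Expand \<open>F\<close> in powers of \<open>y\<close> and reduce each power.\<close>

theorem unfold_map_division:
  assumes k: "k \<ge> 2" and n: "2 * k - 2 \<in> {1..n}" and F: "analytic_germ n F"
  obtains \<alpha> where "\<And>j. analytic_germ n (\<alpha> j)"
    "eventually (\<lambda>x. F x = (\<Sum>j<k. \<alpha> j (unfold_map k x) * x (2 * k - 2) ^ j)) (at_0 n)"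
proof -
  obtain r M where r: "r > 0" and F: "bholo n r M F" using F by (rule analytic_germE)
  have M0: "M \<ge> 0" using bholoD(1)[OF F zero_in_polydisc[OF r]] norm_ge_zero order_trans by blast
  define \<rho> where "\<rho> = r / 2"
  \<comment> \<open>Taylor coefficients are at most \<open>M / \<rho> ^ m\<close> and remainders at
    most \<open>q ^ m / q ^ k\<close>; thus \<open>q < \<rho>\<close> yields a convergent geometric
    majorant.\<close>
  define q where "q = min 1 (r / 4)"
  have q: "0 < q" "q \<le> 1" "q < \<rho>" and \<rho>: "0 < \<rho>" "\<rho> < r" using r by (auto simp: q_def \<rho>_def)
  \<comment> \<open>The radius on the target: small against \<open>q ^ k / k\<close> for the
    remainder bound and inside the domain of the Taylor coefficients.\<close>
  define d where "d = min r (q ^ k / k)"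
  have d: "0 < d" "d \<le> r" "d * k \<le> q ^ k" using r q k by (auto simp: d_def min_def field_simps)
  define a where "a m = taylor_coeff (2 * k - 2) m F" for m
  define C where "C m = (M / \<rho> ^ m) * (q ^ m / q ^ k)" for m
  have a: "bholo n d (M / \<rho> ^ m) (a m)" for m
    unfolding a_def by (rule bholo_subset[OF bholo_taylor_coeff[OF F n \<rho>] d(2)])
  have p: "bholo n d (q ^ m / q ^ k) (\<lambda>x. power_rem k x m j)" for m j
    unfolding bholo_def
  proof (intro ballI conjI power_rem_holomorphic)
    fix x assume "x \<in> polydisc n d"
    then have "norm (x i) \<le> d" for i using polydisc_norm d(1) less_imp_le by blast
    from power_rem_bound[OF q(1,2) this d(3) k]
    show "norm (power_rem k x m j) \<le> q ^ m / q ^ k" using q by (simp add: field_simps)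
  qed
  have ap: "bholo n d (C m) (\<lambda>x. a m x * power_rem k x m j)" for m j
    unfolding C_def by (rule bholo_mult[OF a p])
  have C: "C summable_on UNIV"
  proof (rule norm_summable_imp_summable_on)
    have "norm (C m) = M / q ^ k * (q / \<rho>) ^ m" for m
      using M0 q \<rho> by (simp add: C_def power_divide)
    then show "summable (\<lambda>m. norm (C m))"
      using q \<rho> by (auto intro!: summable_mult summable_geometric)
  qed
  define \<alpha> where "\<alpha> j x = (\<Sum>\<^sub>\<infinity>m. a m x * power_rem k x m j)" for j x
  have \<alpha>_sum: "((\<lambda>m. a m x * power_rem k x m j) has_sum \<alpha> j x) UNIV" if "x \<in> polydisc n d" for j x
  proof -
    have "(\<lambda>m. a m x * power_rem k x m j) summable_on UNIV"
      by (rule Infinite_Sum.abs_summable_summable, rule summable_on_comparison_test[OF C])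
         (use bholoD(1)[OF ap that] in auto)
    then show ?thesis by (simp add: \<alpha>_def)
  qed
  have "bholo n d (infsum C UNIV) (\<alpha> j)" for j
    by (rule bholo_has_sum[OF ap C \<alpha>_sum])
  then have "analytic_germ n (\<alpha> j)" for j using d(1) by (rule analytic_germI)
  moreover have "eventually (\<lambda>x. F x = (\<Sum>j<k. \<alpha> j (unfold_map k x) * x (2 * k - 2) ^ j)) (at_0 n)"
  proof -
    have "eventually (\<lambda>x. unfold_map k x \<in> polydisc n d) (at_0 n)"
      by (rule eventually_germ_map[OF eventually_polydisc germ_map_unfold_map]) (use d k n in auto)
    moreover have "eventually (\<lambda>x. x \<in> polydisc n r) (at_0 n)" using r by (rule eventually_polydisc)
    ultimately show ?thesis
    proof eventually_elim
      case (elim x)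
      let ?y = "x (2 * k - 2)"
      have "((\<lambda>m. \<Sum>j<k. (a m (unfold_map k x) * power_rem k (unfold_map k x) m j) * ?y ^ j) has_sum
          (\<Sum>j<k. \<alpha> j (unfold_map k x) * ?y ^ j)) UNIV"
        by (intro has_sum_finite_sum has_sum_cmult_left \<alpha>_sum elim)
      moreover have "(\<Sum>j<k. (a m (unfold_map k x) * power_rem k (unfold_map k x) m j) * ?y ^ j) = a m x * ?y ^ m" for m
      proof -
        \<comment> \<open>The only coordinate changed by \<open>unfold_map\<close> is the one in
          which the Taylor expansion was taken, so the coefficients do not see it.\<close>
        have "a m (unfold_map k x) = a m x" by (simp add: a_def unfold_map_def)
        then show ?thesis
          using power_eq_power_rem[OF k unfold_map_eq[OF k], of x m] by (simp add: sum_distrib_left mult.assoc)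
      qed
      moreover have "((\<lambda>m. a m x * ?y ^ m) has_sum F x) UNIV"
        unfolding a_def by (rule taylor_series[OF F n elim(2) r])
      ultimately show ?case using has_sum_unique by fastforce
    qed
  qed
  ultimately show ?thesis using that by blast
qed

text \<open>For \<open>norm t \<ge> q\<close> each lower power satisfies
  \<open>norm t ^ i \<le> norm t ^ k / q ^ k\<close>; the \<open>k - 1\<close> lower terms then
  amount to less than \<open>norm t ^ k\<close> and cannot cancel the leading one.\<close>

lemma capP_root_small:
  fixes q s :: real
  assumes k: "k \<ge> 2" and q: "0 < q" "q \<le> 1" and s: "s * k < q ^ k" and x: "\<And>i. norm (x i) \<le> s"
    and root: "capP k x t = w" and w: "norm w \<le> s"
  shows "norm t < q"
proof (rule ccontr)
  assume "\<not> norm t < q"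
  then have t: "q \<le> norm t" by simp
  have s0: "s \<ge> 0" using w norm_ge_zero order_trans by blast
  have le: "norm t ^ i * q ^ k \<le> norm t ^ k" if "i < k" for i
  proof -
    have "q ^ k \<le> q ^ (k - i)" using q by (intro power_decreasing) auto
    also have "\<dots> \<le> norm t ^ (k - i)" using q t by (intro power_mono) auto
    finally have "norm t ^ i * q ^ k \<le> norm t ^ i * norm t ^ (k - i)" by (intro mult_left_mono) auto
    then show ?thesis using that by (simp flip: power_add)
  qed
  have "t ^ k = w - (\<Sum>i=1..k-2. x i * t ^ i)" using root by (simp add: capP_def algebra_simps)
  then have "norm t ^ k \<le> norm w + norm (\<Sum>i=1..k-2. x i * t ^ i)"
    by (metis norm_power norm_triangle_ineq4)
  also have "\<dots> \<le> s + (\<Sum>i=1..k-2. s * norm t ^ i)"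
    using w by (intro add_mono order_trans[OF norm_sum] sum_mono) (auto simp: norm_mult norm_power intro!: mult_right_mono x)
  finally have "norm t ^ k * q ^ k \<le> (s + (\<Sum>i=1..k-2. s * norm t ^ i)) * q ^ k"
    using q by (intro mult_right_mono) auto
  also have "\<dots> = s * (norm t ^ 0 * q ^ k) + (\<Sum>i=1..k-2. s * (norm t ^ i * q ^ k))"
    by (simp add: distrib_right sum_distrib_right mult.assoc)
  also have "\<dots> \<le> s * norm t ^ k + (\<Sum>i=1..k-2. s * norm t ^ k)"
    using k s0 by (intro add_mono mult_left_mono sum_mono le) auto
  also have "\<dots> = (s * real (k - 1)) * norm t ^ k" using k by (simp add: of_nat_diff algebra_simps)
  also have "\<dots> \<le> (s * k) * norm t ^ k" using s0 by (intro mult_right_mono mult_left_mono) auto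
  also have "\<dots> < q ^ k * norm t ^ k"
    using s t q by (intro mult_strict_right_mono zero_less_power) auto
  finally show False by (simp add: mult.commute)
qed

definition capP_poly :: "nat \<Rightarrow> (nat \<Rightarrow> complex) \<Rightarrow> complex poly" where
  "capP_poly k x = monom 1 k + (\<Sum>i=1..k-2. monom (x i) i)"

lemma poly_capP_poly: "poly (capP_poly k x) t = capP k x t"
  by (simp add: capP_poly_def capP_def poly_monom poly_sum)

lemma capP_poly_degree:
  assumes "k \<ge> 2"
  shows "degree (capP_poly k x - [:w:]) = k" "coeff (capP_poly k x) k = 1"
proof -
  have c: "coeff (capP_poly k x) i = (if i = k then 1 else if i \<in> {1..k-2} then x i else 0)" for i
    using assms by (simp add: capP_poly_def coeff_sum sum.delta) linarith
  then show "coeff (capP_poly k x) k = 1" by simp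
  show "degree (capP_poly k x - [:w:]) = k"
  proof (rule antisym)
    show "degree (capP_poly k x - [:w:]) \<le> k"
    proof (rule degree_le, intro allI impI)
      fix i assume "k < i"
      then show "coeff (capP_poly k x - [:w:]) i = 0" using c[of i] assms by (cases i) auto
    qed
    show "k \<le> degree (capP_poly k x - [:w:])"
      by (rule le_degree) (use c[of k] assms in \<open>cases k; simp\<close>)
  qed
qed

lemma vanish_off_finite:
  fixes h :: "complex \<Rightarrow> complex"
  assumes h: "h holomorphic_on ball 0 s" and B: "finite B" "\<And>t. t \<in> ball 0 s - B \<Longrightarrow> h t = 0"
    and t: "t \<in> ball 0 s"
  shows "h t = 0"
proof (rule ccontr)
  assume nz: "h t \<noteq> 0"
  have "open (h -` (- {0}) \<inter> ball 0 s)"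
    by (rule continuous_on_open_vimage[THEN iffD1, rule_format, OF open_ball])
       (use h holomorphic_on_imp_continuous_on in auto)
  moreover have "h -` (- {0}) \<inter> ball 0 s \<subseteq> B" using B(2) by auto
  moreover have "t \<in> h -` (- {0}) \<inter> ball 0 s" using nz t by auto
  ultimately show False
    using B(1) finite_subset interior_limit_point[of t] interior_open islimpt_finite by metis
qed

lemma rsquarefree_card_roots:
  fixes p :: "complex poly"
  assumes "rsquarefree p"
  shows "card {z. poly p z = 0} = degree p"
proof -
  have p: "p \<noteq> 0" using assms by (simp add: rsquarefree_def)
  have "degree p = degree (Polynomial.smult (lead_coeff p) (\<Prod>z|poly p z = 0. [:-z, 1:]))"
    using complex_poly_decompose_rsquarefree[OF assms] by simp
  also have "\<dots> = degree (\<Prod>z|poly p z = 0. [:-z, 1:])" using p by simp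
  also have "\<dots> = card {z. poly p z = 0}" by (subst degree_prod_sum_eq) auto
  finally show ?thesis by simp
qed

text \<open>For fixed \<open>u\<close> the polynomial \<open>P(u, \<cdot>) - w\<close> has \<open>k\<close> distinct roots unless \<open>w\<close> is one of finitely
  many critical values.\<close>

theorem unfold_map_independent:
  assumes k: "k \<ge> 2" and n: "2 * k - 2 \<in> {1..n}" and \<beta>: "\<And>j. analytic_germ n (\<beta> j)"
    and zero: "eventually (\<lambda>x. (\<Sum>j<k. \<beta> j (unfold_map k x) * x (2 * k - 2) ^ j) = 0) (at_0 n)"
    and j: "j < k"
  shows "eventually (\<lambda>x. \<beta> j x = 0) (at_0 n)"
proof -
  obtain r where r: "r > 0" "\<And>x. x \<in> polydisc n r \<Longrightarrow> (\<Sum>j<k. \<beta> j (unfold_map k x) * x (2 * k - 2) ^ j) = 0"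
    using zero by (auto simp: eventually_at_0)
  obtain r' M where r': "r' > 0" "bholo n r' M (\<beta> j)" using \<beta> by (rule analytic_germE)
  define q where "q = min 1 r"
  have q: "0 < q" "q \<le> 1" "q \<le> r" using r by (auto simp: q_def)
  define s where "s = min (min r r') (q ^ k / (2 * k))"
  have s: "s > 0" "s \<le> r" "s \<le> r'" using r r' q k by (auto simp: s_def)
  have "s \<le> q ^ k / (2 * k)" by (simp add: s_def)
  then have "s * k \<le> q ^ k / 2" using k by (simp add: field_simps)
  also have "\<dots> < q ^ k" using q by simp
  finally have sk: "s * k < q ^ k" .
  \<comment> \<open>For noncritical \<open>w\<close> the \<open>k\<close> distinct roots
    \<open>t\<close> yield small points with one common image under \<open>unfold_map\<close>. A
    polynomial of degree below \<open>k\<close> with coefficients \<open>\<beta> l\<close> at this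
    image has all of them as zeros.\<close>
  have good: "\<beta> j (X(2 * k - 2 := w)) = 0"
    if X: "X \<in> polydisc n s" and w: "norm w < s" and
      w': "w \<notin> poly (capP_poly k X) ` {t. poly (pderiv (capP_poly k X)) t = 0}" for X w
  proof -
    let ?X = "X(2 * k - 2 := w)" and ?p = "capP_poly k X - [:w:]"
    have p0: "?p \<noteq> 0" using capP_poly_degree(1)[OF k, of X w] k by auto
    have "rsquarefree ?p" unfolding rsquarefree_roots
      using w' by (auto simp: pderiv_diff)
    then have cardk: "card {t. poly ?p t = 0} = k"
      using capP_poly_degree(1)[OF k, of X w] by (metis rsquarefree_card_roots)
    have "poly (\<Sum>l<k. monom (\<beta> l ?X) l) t = 0" if "poly ?p t = 0" for t
    proof -
      have Pt: "capP k X t = w" using that by (simp add: poly_capP_poly)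
      have "norm t < q"
        by (rule capP_root_small[OF k q(1,2) sk _ Pt]) (use polydisc_norm[OF X s(1)] w less_imp_le in blast)+
      then have "X(2 * k - 2 := t) \<in> polydisc n r"
        using polydisc_update[OF _ n, of X r t] polydisc_mono[OF s(2)] X q by auto
      from r(2)[OF this] have "(\<Sum>l<k. \<beta> l (unfold_map k (X(2 * k - 2 := t))) * t ^ l) = 0" by simp
      moreover have "unfold_map k (X(2 * k - 2 := t)) = ?X"
        using Pt k by (simp add: unfold_map_def)
      ultimately show ?thesis by (simp add: poly_sum poly_monom)
    qed
    then have sub: "{t. poly ?p t = 0} \<subseteq> {t. poly (\<Sum>l<k. monom (\<beta> l ?X) l) t = 0}" by blast
    have "(\<Sum>l<k. monom (\<beta> l ?X) l) = 0"
    proof (rule ccontr)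
      assume nz: "(\<Sum>l<k. monom (\<beta> l ?X) l) \<noteq> 0"
      have "k \<le> card {t. poly (\<Sum>l<k. monom (\<beta> l ?X) l) t = 0}"
        using card_mono[OF poly_roots_finite[OF nz] sub] cardk by simp
      also have "\<dots> \<le> degree (\<Sum>l<k. monom (\<beta> l ?X) l)" by (rule card_poly_roots_bound[OF nz])
      also have "\<dots> < k"
      proof -
        have "degree (\<Sum>l<k. monom (\<beta> l ?X) l) \<le> k - 1"
          by (rule degree_sum_le) (auto intro: order_trans[OF degree_monom_le])
        then show ?thesis using k by linarith
      qed
      finally show False by simp
    qed
    then have "coeff (\<Sum>l<k. monom (\<beta> l ?X) l) j = 0" by simp
    then show ?thesis using j by (simp add: coeff_sum)
  qed
  have "\<beta> j X = 0" if X: "X \<in> polydisc n s" for X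
  proof -
    let ?B = "poly (capP_poly k X) ` {t. poly (pderiv (capP_poly k X)) t = 0}"
    \<comment> \<open>The derivative has leading coefficient \<open>k\<close>, so there are finitely
      many critical values; holomorphy in the coordinate \<open>w\<close> extends the vanishing
      across them.\<close>
    have "coeff (pderiv (capP_poly k X)) (k - 1) = of_nat k"
      using capP_poly_degree(2)[OF k, of X] k by (simp add: coeff_pderiv)
    then have "pderiv (capP_poly k X) \<noteq> 0" using k by auto
    then have B: "finite ?B" using poly_roots_finite by blast
    have X': "X \<in> polydisc n r'" using X polydisc_mono[OF s(3)] by blast
    have "(\<lambda>w. \<beta> j (X(2 * k - 2 := w))) holomorphic_on ball 0 s"
      using bholoD(2)[OF r'(2) X' n] s(3) by (meson holomorphic_on_subset subset_ball)
    from vanish_off_finite[OF this B, of "X (2 * k - 2)"] good[OF X] polydisc_norm[OF X s(1)]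
    show ?thesis by auto
  qed
  then show ?thesis using s(1) by (auto simp: eventually_at_0)
qed

section \<open>Liftable vector fields\<close>

lemma cross_cap_coord:
  assumes "k \<ge> 2"
  shows "cross_cap k x i = (if 1 \<le> i \<and> i \<le> 2 * k - 3 then x i else if i = 2 * k - 2 then capP k x (x (2 * k - 2))
     else if i = 2 * k - 1 then capQ k x (x (2 * k - 2)) else 0)"
proof -
  consider "i = 0" | "1 \<le> i" "i \<le> k - 2" | "k - 1 \<le> i" "1 \<le> i" "i \<le> 2 * k - 3" | "i = 2 * k - 2" | "i = 2 * k - 1" | "i \<ge> 2 * k"
    by linarith
  then show ?thesis
  proof cases
    case 3
    have "k - 2 + nat (int i - (int k - 2)) = i" using 3 assms by auto
    then show ?thesis using 3 assms by (auto simp: cross_cap_def target_tuple_def Let_def)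
  qed (use assms in \<open>auto simp: cross_cap_def target_tuple_def Let_def capP_def capQ_def\<close>)
qed

lemma cross_cap_coords:
  assumes "k \<ge> 2"
  shows "1 \<le> i \<Longrightarrow> i \<le> 2 * k - 3 \<Longrightarrow> cross_cap k x i = x i"
    "cross_cap k x (2 * k - 2) = capP k x (x (2 * k - 2))"
    "cross_cap k x (2 * k - 1) = capQ k x (x (2 * k - 2))"
proof -
  have "\<not> 2 * k - 2 \<le> 2 * k - 3" "\<not> 2 * k - 1 \<le> 2 * k - 3" "2 * k - 1 \<noteq> 2 * k - 2" using assms by linarith+
  then show "cross_cap k x (2 * k - 2) = capP k x (x (2 * k - 2))"
    "cross_cap k x (2 * k - 1) = capQ k x (x (2 * k - 2))"
    "1 \<le> i \<Longrightarrow> i \<le> 2 * k - 3 \<Longrightarrow> cross_cap k x i = x i"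
    unfolding cross_cap_coord[OF assms] by simp_all
qed

text \<open>Embeds the source as the hypersurface \<open>W2 = Q\<close> in the space of
  \<open>(u, v, y, W2)\<close>, so that \<open>cross_cap\<close> factors through
  \<open>unfold_map\<close>.\<close>

definition graph_map :: "nat \<Rightarrow> (nat \<Rightarrow> complex) \<Rightarrow> nat \<Rightarrow> complex" where
  "graph_map k x = x(2 * k - 1 := capQ k x (x (2 * k - 2)))"

lemma capQ_update [simp]: "k \<ge> 2 \<Longrightarrow> l < k - 1 \<or> l > 2 * k - 3 \<Longrightarrow> capQ k (x(l := s)) t = capQ k x t"
  unfolding capQ_def by (intro sum.cong) auto

lemma dcapP_update [simp]: "k \<ge> 2 \<Longrightarrow> l > k - 2 \<Longrightarrow> dcapP k (x(l := s)) t = dcapP k x t"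
  unfolding dcapP_def by (intro arg_cong2[where f = plus] refl sum.cong) auto

lemma dcapQ_update [simp]: "k \<ge> 2 \<Longrightarrow> l < k - 1 \<or> l > 2 * k - 3 \<Longrightarrow> dcapQ k (x(l := s)) t = dcapQ k x t"
  unfolding dcapQ_def by (intro sum.cong) auto

lemma unfold_map_simps:
  assumes "k \<ge> 2"
  shows "unfold_map k x (2 * k - 1) = x (2 * k - 1)" "dcapP k (unfold_map k x) t = dcapP k x t"
    "capQ k (unfold_map k x) t = capQ k x t" "dcapQ k (unfold_map k x) t = dcapQ k x t"
proof -
  have "2 * k - 3 < 2 * k - 2" "k - 2 < 2 * k - 2" "2 * k - 1 \<noteq> 2 * k - 2" using assms by linarith+
  then show "unfold_map k x (2 * k - 1) = x (2 * k - 1)" "dcapP k (unfold_map k x) t = dcapP k x t"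
    "capQ k (unfold_map k x) t = capQ k x t" "dcapQ k (unfold_map k x) t = dcapQ k x t"
    unfolding unfold_map_def using assms by simp_all
qed

lemma cross_cap_eq_unfold_graph:
  assumes "k \<ge> 2" "x \<in> cspace (2 * k - 2)"
  shows "cross_cap k x = unfold_map k (graph_map k x)"
proof
  fix i
  show "cross_cap k x i = unfold_map k (graph_map k x) i"
    using assms unfolding cross_cap_coord[OF assms(1)]
    by (auto simp: unfold_map_def graph_map_def cspace_def)
qed

lemma analytic_germ_capQ: "analytic_germ n (\<lambda>x. capQ k x (x l))"
  unfolding capQ_def by (intro analytic_germ_intros)

lemma analytic_germ_dcapP: "analytic_germ n (\<lambda>x. dcapP k x (x l))"
  unfolding dcapP_def by (intro analytic_germ_intros)

lemma analytic_germ_dcapQ: "analytic_germ n (\<lambda>x. dcapQ k x (x l))"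
  unfolding dcapQ_def by (intro analytic_germ_intros)

lemma germ_map_graph_map:
  assumes "k \<ge> 2" shows "germ_map (2 * k - 2) (2 * k - 1) (graph_map k)"
proof -
  have "2 * k - 2 \<le> 2 * k - 1" "2 * k - 1 \<in> {1..2*k-1}" using assms by auto
  then show ?thesis
    unfolding graph_map_def[abs_def] by (rule germ_map_update[OF _ _ analytic_germ_capQ]) (simp add: capQ_def)
qed

lemma germ_map_cross_cap:
  assumes "k \<ge> 2" shows "germ_map (2 * k - 2) (2 * k - 1) (cross_cap k)"
proof -
  have "analytic_germ n (\<lambda>x. cross_cap k x i)" for n i
    unfolding cross_cap_coord[OF assms]
    by (cases "1 \<le> i \<and> i \<le> 2 * k - 3"; cases "i = 2 * k - 2"; cases "i = 2 * k - 1")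
       (auto intro: analytic_germ_capP analytic_germ_capQ)
  moreover have "cross_cap k (\<lambda>_. 0) i = 0" "cross_cap k x \<in> cspace (2 * k - 1)" for x i
    using assms by (auto simp: cross_cap_coord cspace_def capP_def capQ_def)
  ultimately show ?thesis unfolding germ_map_def by blast
qed

lemmas analytic_germ_cross_cap = analytic_germ_compose[OF _ germ_map_cross_cap]

section \<open>The Jacobian of the cross cap and the lifting equations\<close>

lemma partial_deriv_coord: "partial_deriv l (\<lambda>z. z i) x = (if l = i then 1 else 0)"
  by (cases "l = i") (auto simp: partial_deriv_def)

lemma partial_deriv_capP:
  assumes "k \<ge> 2" "1 \<le> l"
  shows "partial_deriv l (\<lambda>z. capP k z (z (2 * k - 2))) x = (if l \<le> k - 2 then x (2 * k - 2) ^ l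
    else if l = 2 * k - 2 then dcapP k x (x (2 * k - 2)) else 0)"
proof -
  let ?y = "x (2 * k - 2)"
  consider "l \<le> k - 2" | "l = 2 * k - 2" | "l > k - 2" "l \<noteq> 2 * k - 2" by linarith
  then show ?thesis
  proof cases
    case 1
    have "((\<lambda>t. ?y ^ k + (\<Sum>i=1..k-2. (x(l := t)) i * ?y ^ i)) has_field_derivative
       0 + (\<Sum>i=1..k-2. (if i = l then 1 else 0) * ?y ^ i)) (at (x l))"
      by (intro derivative_intros DERIV_cmult_right) (auto intro: derivative_eq_intros)
    moreover have "(\<Sum>i=1..k-2. (if i = l then 1 else 0) * ?y ^ i) = ?y ^ l"
      using 1 assms by (simp add: if_distrib[of "\<lambda>c. c * _"] cong: if_cong)
    moreover have "2 * k - 2 \<noteq> l" using 1 assms by linarith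
    ultimately have "partial_deriv l (\<lambda>z. capP k z (z (2 * k - 2))) x = ?y ^ l"
      unfolding partial_deriv_def capP_def by (intro DERIV_imp_deriv) simp
    then show ?thesis using 1 by simp
  next
    case 2
    have "((\<lambda>t. t ^ k + (\<Sum>i=1..k-2. x i * t ^ i)) has_field_derivative
        dcapP k x ?y) (at ?y)"
      unfolding dcapP_def
      by (rule derivative_eq_intros refl | simp add: mult_ac)+
    then have "((\<lambda>t. capP k x t) has_field_derivative dcapP k x ?y) (at ?y)" by (simp add: capP_def)
    then show ?thesis using 2 assms by (auto simp: partial_deriv_def intro!: DERIV_imp_deriv)
  next
    case 3
    then show ?thesis using assms by (simp add: partial_deriv_def)
  qed
qed

lemma partial_deriv_capQ:
  assumes "k \<ge> 2" "1 \<le> l"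
  shows "partial_deriv l (\<lambda>z. capQ k z (z (2 * k - 2))) x = (if k - 1 \<le> l \<and> l \<le> 2 * k - 3 then x (2 * k - 2) ^ (l - (k - 2))
    else if l = 2 * k - 2 then dcapQ k x (x (2 * k - 2)) else 0)"
proof -
  let ?y = "x (2 * k - 2)"
  consider "k - 1 \<le> l" "l \<le> 2 * k - 3" | "l = 2 * k - 2" | "l < k - 1 \<or> l > 2 * k - 3" "l \<noteq> 2 * k - 2" by linarith
  then show ?thesis
  proof cases
    case 1
    have "((\<lambda>t. \<Sum>i=1..k-1. (x(l := t)) (k - 2 + i) * ?y ^ i) has_field_derivative
       (\<Sum>i=1..k-1. (if i = l - (k - 2) then 1 else 0) * ?y ^ i)) (at (x l))"
    proof (intro derivative_intros DERIV_cmult_right)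
      fix i
      show "((\<lambda>t. (x(l := t)) (k - 2 + i)) has_field_derivative (if i = l - (k - 2) then 1 else 0)) (at (x l))"
      proof (cases "i = l - (k - 2)")
        case True
        then have "k - 2 + i = l" using 1 assms by linarith
        then show ?thesis using True by simp
      next
        case False
        then have "k - 2 + i \<noteq> l" using 1 assms by linarith
        then show ?thesis using False by simp
      qed
    qed
    moreover have "l - (k - 2) \<in> {1..k-1}" using 1 assms by auto
    then have "(\<Sum>i=1..k-1. (if i = l - (k - 2) then 1 else 0) * ?y ^ i) = ?y ^ (l - (k - 2))"
      by (simp add: if_distrib[of "\<lambda>c. c * _"] cong: if_cong)
    moreover have "2 * k - 2 \<noteq> l" using 1 assms by linarith
    ultimately have "partial_deriv l (\<lambda>z. capQ k z (z (2 * k - 2))) x = ?y ^ (l - (k - 2))"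
      unfolding partial_deriv_def capQ_def by (intro DERIV_imp_deriv) simp
    then show ?thesis using 1 by simp
  next
    case 2
    have "((\<lambda>t. \<Sum>i=1..k-1. x (k - 2 + i) * t ^ i) has_field_derivative
        dcapQ k x ?y) (at ?y)"
      unfolding dcapQ_def
      by (rule derivative_eq_intros refl | simp add: mult_ac)+
    then have "((\<lambda>t. capQ k x t) has_field_derivative dcapQ k x ?y) (at ?y)" by (simp add: capQ_def)
    then show ?thesis using 2 assms by (auto simp: partial_deriv_def intro!: DERIV_imp_deriv)
  next
    case 3
    then show ?thesis using assms by (auto simp: partial_deriv_def)
  qed
qed

lemma sum_source_split:
  fixes f :: "nat \<Rightarrow> complex"
  assumes "k \<ge> 2"
  shows "(\<Sum>l=1..2*k-2. f l) = (\<Sum>l=1..k-2. f l) + (\<Sum>l=1..k-1. f (k - 2 + l)) + f (2 * k - 2)"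
proof -
  have "{1..2*k-2} = {1..k-2} \<union> ({k-1..2*k-3} \<union> {2 * k - 2})" using assms by auto
  then have "(\<Sum>l=1..2*k-2. f l) = (\<Sum>l=1..k-2. f l) + (\<Sum>l\<in>{k-1..2*k-3} \<union> {2 * k - 2}. f l)"
    using assms by (simp only:) (rule sum.union_disjoint; auto)
  also have "(\<Sum>l\<in>{k-1..2*k-3} \<union> {2 * k - 2}. f l) = (\<Sum>l=k-1..2*k-3. f l) + f (2 * k - 2)"
    using assms by (subst sum.union_disjoint) auto
  also have "(\<Sum>l=k-1..2*k-3. f l) = (\<Sum>l=1..k-1. f (k - 2 + l))"
    by (rule sum.reindex_bij_witness[of _ "\<lambda>l. k - 2 + l" "\<lambda>l. l - (k - 2)"]) (use assms in auto)
  finally show ?thesis by (simp add: add.assoc)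
qed

lemma jacobian_cross_cap:
  fixes e x :: "nat \<Rightarrow> complex"
  assumes k: "k \<ge> 2"
  defines "J \<equiv> \<lambda>i. \<Sum>l=1..2*k-2. partial_deriv l (\<lambda>z. cross_cap k z i) x * e l"
  shows "1 \<le> i \<Longrightarrow> i \<le> 2 * k - 3 \<Longrightarrow> J i = e i"
    and "J (2 * k - 2) = (\<Sum>l=1..k-2. e l * x (2 * k - 2) ^ l) + dcapP k x (x (2 * k - 2)) * e (2 * k - 2)"
    and "J (2 * k - 1) = (\<Sum>l=1..k-1. e (k - 2 + l) * x (2 * k - 2) ^ l) + dcapQ k x (x (2 * k - 2)) * e (2 * k - 2)"
proof -
  show "J i = e i" if "1 \<le> i" "i \<le> 2 * k - 3"
  proof -
    have "(\<lambda>z. cross_cap k z i) = (\<lambda>z. z i)" using cross_cap_coords(1)[OF k that] by blast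
    moreover have "i \<in> {1..2*k-2}" using that by auto
    ultimately show ?thesis
      by (simp add: J_def partial_deriv_coord if_distrib[of "\<lambda>c. c * _"] cong: if_cong)
  qed
  have P: "(\<lambda>z. cross_cap k z (2 * k - 2)) = (\<lambda>z. capP k z (z (2 * k - 2)))"
    and Q: "(\<lambda>z. cross_cap k z (2 * k - 1)) = (\<lambda>z. capQ k z (z (2 * k - 2)))"
    using cross_cap_coords[OF k] by blast+
  have "(\<Sum>l=1..k-2. partial_deriv l (\<lambda>z. capP k z (z (2 * k - 2))) x * e l) = (\<Sum>l=1..k-2. e l * x (2 * k - 2) ^ l)"
    by (intro sum.cong) (simp_all add: partial_deriv_capP[OF k])
  moreover have "(\<Sum>l=1..k-1. partial_deriv (k - 2 + l) (\<lambda>z. capP k z (z (2 * k - 2))) x * e (k - 2 + l)) = 0"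
  proof (intro sum.neutral ballI)
    fix l assume "l \<in> {1..k-1}"
    then have "\<not> k - 2 + l \<le> k - 2" "k - 2 + l \<noteq> 2 * k - 2" "1 \<le> k - 2 + l" using k by auto
    then show "partial_deriv (k - 2 + l) (\<lambda>z. capP k z (z (2 * k - 2))) x * e (k - 2 + l) = 0"
      by (simp only: partial_deriv_capP[OF k] if_False) simp
  qed
  moreover have "partial_deriv (2 * k - 2) (\<lambda>z. capP k z (z (2 * k - 2))) x = dcapP k x (x (2 * k - 2))"
  proof -
    have "\<not> 2 * k - 2 \<le> k - 2" "1 \<le> 2 * k - 2" using k by linarith+
    then show ?thesis by (simp add: partial_deriv_capP[OF k])
  qed
  ultimately show "J (2 * k - 2) = (\<Sum>l=1..k-2. e l * x (2 * k - 2) ^ l) + dcapP k x (x (2 * k - 2)) * e (2 * k - 2)"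
    unfolding J_def P sum_source_split[OF k] by simp
  have "(\<Sum>l=1..k-2. partial_deriv l (\<lambda>z. capQ k z (z (2 * k - 2))) x * e l) = 0"
  proof (intro sum.neutral ballI)
    fix l assume "l \<in> {1..k-2}"
    then have "\<not> k - 1 \<le> l" "l \<noteq> 2 * k - 2" "1 \<le> l" using k by auto
    then show "partial_deriv l (\<lambda>z. capQ k z (z (2 * k - 2))) x * e l = 0"
      by (simp add: partial_deriv_capQ[OF k])
  qed
  moreover have "(\<Sum>l=1..k-1. partial_deriv (k - 2 + l) (\<lambda>z. capQ k z (z (2 * k - 2))) x * e (k - 2 + l))
     = (\<Sum>l=1..k-1. e (k - 2 + l) * x (2 * k - 2) ^ l)"
  proof (intro sum.cong refl)
    fix l assume "l \<in> {1..k-1}"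
    then have "k - 1 \<le> k - 2 + l \<and> k - 2 + l \<le> 2 * k - 3" "1 \<le> k - 2 + l" "k - 2 + l - (k - 2) = l"
      using k by auto
    then show "partial_deriv (k - 2 + l) (\<lambda>z. capQ k z (z (2 * k - 2))) x * e (k - 2 + l) = e (k - 2 + l) * x (2 * k - 2) ^ l"
      by (simp only: partial_deriv_capQ[OF k] if_True simp_thms) (rule mult.commute)
  qed
  moreover have "partial_deriv (2 * k - 2) (\<lambda>z. capQ k z (z (2 * k - 2))) x = dcapQ k x (x (2 * k - 2))"
  proof -
    have "\<not> 2 * k - 2 \<le> 2 * k - 3" "1 \<le> 2 * k - 2" using k by linarith+
    then show ?thesis by (simp add: partial_deriv_capQ[OF k])
  qed
  ultimately show "J (2 * k - 1) = (\<Sum>l=1..k-1. e (k - 2 + l) * x (2 * k - 2) ^ l) + dcapQ k x (x (2 * k - 2)) * e (2 * k - 2)"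
    unfolding J_def Q sum_source_split[OF k] by simp
qed

text \<open>The first \<open>2 * k - 3\<close> components of \<open>cross_cap\<close> are
  coordinates, which forces the matching components of a lift to be those of the field. Only the
  \<open>y\<close>-component \<open>g\<close> is left to choose, and the last two rows of the
  Jacobian become the defect equations.\<close>

lemma liftable_iff:
  assumes k: "k \<ge> 2"
  shows "liftable (2 * k - 2) (2 * k - 1) (cross_cap k) \<xi> \<longleftrightarrow> vector_field_germ (2 * k - 1) \<xi> \<and>
    (\<exists>g. analytic_germ (2 * k - 2) g \<and> eventually (\<lambda>x.
       defect1 k (\<xi> (cross_cap k x)) (x (2 * k - 2)) = dcapP k x (x (2 * k - 2)) * g x \<and>
       defect2 k (\<xi> (cross_cap k x)) (x (2 * k - 2)) = dcapQ k x (x (2 * k - 2)) * g x) (at_0 (2 * k - 2)))"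
    (is "?L \<longleftrightarrow> ?R")
proof
  assume ?L
  then obtain \<eta> where \<xi>: "vector_field_germ (2 * k - 1) \<xi>" and \<eta>: "vector_field_germ (2 * k - 2) \<eta>" and
    ev: "eventually (\<lambda>x. \<forall>i\<in>{1..2*k-1}.
       (\<Sum>l=1..2*k-2. partial_deriv l (\<lambda>z. cross_cap k z i) x * \<eta> x l) = \<xi> (cross_cap k x) i) (at_0 (2 * k - 2))"
    by (auto simp: liftable_def near_0_eventually)
  from ev have "eventually (\<lambda>x.
       defect1 k (\<xi> (cross_cap k x)) (x (2 * k - 2)) = dcapP k x (x (2 * k - 2)) * \<eta> x (2 * k - 2) \<and>
       defect2 k (\<xi> (cross_cap k x)) (x (2 * k - 2)) = dcapQ k x (x (2 * k - 2)) * \<eta> x (2 * k - 2)) (at_0 (2 * k - 2))"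
  proof eventually_elim
    case (elim x)
    let ?J = "\<lambda>i. \<Sum>l=1..2*k-2. partial_deriv l (\<lambda>z. cross_cap k z i) x * \<eta> x l"
    have eta: "\<eta> x i = \<xi> (cross_cap k x) i" if "1 \<le> i" "i \<le> 2 * k - 3" for i
    proof -
      have "i \<in> {1..2*k-1}" using that by auto
      with elim have "?J i = \<xi> (cross_cap k x) i" by blast
      then show ?thesis using jacobian_cross_cap(1)[OF k that, where x = x and e = "\<eta> x"] by simp
    qed
    have "2 * k - 2 \<in> {1..2*k-1}" "2 * k - 1 \<in> {1..2*k-1}" using k by auto
    then have "?J (2 * k - 2) = \<xi> (cross_cap k x) (2 * k - 2)" "?J (2 * k - 1) = \<xi> (cross_cap k x) (2 * k - 1)"
      using elim by blast+
    moreover have "(\<Sum>l=1..k-2. \<xi> (cross_cap k x) l * t ^ l) = (\<Sum>l=1..k-2. \<eta> x l * t ^ l)" for t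
    proof (intro sum.cong refl)
      fix l assume "l \<in> {1..k-2}"
      then have "1 \<le> l" "l \<le> 2 * k - 3" using k by auto
      then show "\<xi> (cross_cap k x) l * t ^ l = \<eta> x l * t ^ l" using eta by simp
    qed
    moreover have "(\<Sum>l=1..k-1. \<xi> (cross_cap k x) (k - 2 + l) * t ^ l) = (\<Sum>l=1..k-1. \<eta> x (k - 2 + l) * t ^ l)" for t
    proof (intro sum.cong refl)
      fix l assume "l \<in> {1..k-1}"
      then have "1 \<le> k - 2 + l" "k - 2 + l \<le> 2 * k - 3" using k by auto
      from eta[OF this] show "\<xi> (cross_cap k x) (k - 2 + l) * t ^ l = \<eta> x (k - 2 + l) * t ^ l" by simp
    qed
    ultimately show ?case
      unfolding defect1_def defect2_def jacobian_cross_cap(2,3)[OF k] by (simp add: diff_eq_eq add.commute)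
  qed
  moreover have "analytic_germ (2 * k - 2) (\<lambda>x. \<eta> x (2 * k - 2))"
    using \<eta> k by (auto simp: vector_field_germ_def)
  ultimately show ?R using \<xi> by blast
next
  assume ?R
  then obtain g where \<xi>: "vector_field_germ (2 * k - 1) \<xi>" and g: "analytic_germ (2 * k - 2) g" and
    ev: "eventually (\<lambda>x.
       defect1 k (\<xi> (cross_cap k x)) (x (2 * k - 2)) = dcapP k x (x (2 * k - 2)) * g x \<and>
       defect2 k (\<xi> (cross_cap k x)) (x (2 * k - 2)) = dcapQ k x (x (2 * k - 2)) * g x) (at_0 (2 * k - 2))" by blast
  define \<eta> where "\<eta> x l = (if l = 2 * k - 2 then g x else \<xi> (cross_cap k x) l)" for x l
  have "analytic_germ (2 * k - 2) (\<lambda>x. \<eta> x l)" if "l \<in> {1..2*k-2}" for l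
  proof (cases "l = 2 * k - 2")
    case False
    then show ?thesis using that \<xi> k
      by (auto simp: \<eta>_def vector_field_germ_def intro!: analytic_germ_cross_cap)
  qed (simp add: \<eta>_def g)
  then have "vector_field_germ (2 * k - 2) \<eta>" by (simp add: vector_field_germ_def)
  moreover from ev have "eventually (\<lambda>x. \<forall>i\<in>{1..2*k-1}.
       (\<Sum>l=1..2*k-2. partial_deriv l (\<lambda>z. cross_cap k z i) x * \<eta> x l) = \<xi> (cross_cap k x) i) (at_0 (2 * k - 2))"
  proof eventually_elim
    case (elim x)
    have s: "(\<Sum>l=1..k-2. \<eta> x l * y ^ l) = (\<Sum>l=1..k-2. \<xi> (cross_cap k x) l * y ^ l)"
      "(\<Sum>l=1..k-1. \<eta> x (k - 2 + l) * y ^ l) = (\<Sum>l=1..k-1. \<xi> (cross_cap k x) (k - 2 + l) * y ^ l)" for y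
      using k by (auto simp: \<eta>_def intro!: sum.cong)
    show ?case
    proof
      fix i assume "i \<in> {1..2*k-1}"
      then consider "1 \<le> i" "i \<le> 2 * k - 3" | "i = 2 * k - 2" | "i = 2 * k - 1" by force
      then show "(\<Sum>l=1..2*k-2. partial_deriv l (\<lambda>z. cross_cap k z i) x * \<eta> x l) = \<xi> (cross_cap k x) i"
      proof cases
        case 1
        then have "i \<noteq> 2 * k - 2" using k by linarith
        then show ?thesis using jacobian_cross_cap(1)[OF k 1, where x = x and e = "\<eta> x"] by (simp add: \<eta>_def)
      next
        case 2
        have "\<eta> x (2 * k - 2) = g x" by (simp add: \<eta>_def)
        then show ?thesis unfolding 2 jacobian_cross_cap(2)[OF k] s(1)
          using elim by (simp add: defect1_def diff_eq_eq add.commute)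
      next
        case 3
        have "\<eta> x (2 * k - 2) = g x" by (simp add: \<eta>_def)
        then show ?thesis unfolding 3 jacobian_cross_cap(3)[OF k] s(2)
          using elim by (simp add: defect2_def diff_eq_eq add.commute)
      qed
    qed
  qed
  ultimately show ?L using \<xi> by (auto simp: liftable_def near_0_eventually)
qed

lemma finite_cross_cap_fields: "finite (cross_cap_fields k)"
  by (simp add: cross_cap_fields_def)

lemma generated_module_iff:
  assumes G: "finite G"
  shows "\<xi> \<in> generated_module n G \<longleftrightarrow> vector_field_germ n \<xi> \<and>
    (\<exists>a. (\<forall>\<zeta>\<in>G. analytic_germ n (a \<zeta>)) \<and>
      eventually (\<lambda>x. \<forall>i\<in>{1..n}. \<xi> x i = (\<Sum>\<zeta>\<in>G. a \<zeta> x * \<zeta> x i)) (at_0 n))"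
proof
  assume "\<xi> \<in> generated_module n G"
  then obtain S a where \<xi>: "vector_field_germ n \<xi>" and S: "S \<subseteq> G" and a: "\<forall>\<zeta>\<in>S. analytic_germ n (a \<zeta>)"
    and ev: "eventually (\<lambda>x. \<forall>i\<in>{1..n}. \<xi> x i = (\<Sum>\<zeta>\<in>S. a \<zeta> x * \<zeta> x i)) (at_0 n)"
    by (auto simp: generated_module_def near_0_eventually)
  define a' where "a' \<zeta> = (if \<zeta> \<in> S then a \<zeta> else (\<lambda>_. 0))" for \<zeta>
  have "(\<Sum>\<zeta>\<in>S. a \<zeta> x * \<zeta> x i) = (\<Sum>\<zeta>\<in>G. a' \<zeta> x * \<zeta> x i)" for x i
    using S G by (intro sum.mono_neutral_cong_left) (auto simp: a'_def)
  moreover have "\<forall>\<zeta>\<in>G. analytic_germ n (a' \<zeta>)" using a by (auto simp: a'_def)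
  ultimately show "vector_field_germ n \<xi> \<and> (\<exists>a. (\<forall>\<zeta>\<in>G. analytic_germ n (a \<zeta>)) \<and>
      eventually (\<lambda>x. \<forall>i\<in>{1..n}. \<xi> x i = (\<Sum>\<zeta>\<in>G. a \<zeta> x * \<zeta> x i)) (at_0 n))"
    using \<xi> ev by auto
next
  assume "vector_field_germ n \<xi> \<and> (\<exists>a. (\<forall>\<zeta>\<in>G. analytic_germ n (a \<zeta>)) \<and>
      eventually (\<lambda>x. \<forall>i\<in>{1..n}. \<xi> x i = (\<Sum>\<zeta>\<in>G. a \<zeta> x * \<zeta> x i)) (at_0 n))"
  then show "\<xi> \<in> generated_module n G"
    unfolding generated_module_def near_0_eventually using G by blast
qed

lemma defect_sum_scaled:
  "defect1 k (\<lambda>i. \<Sum>\<zeta>\<in>G. a \<zeta> * c \<zeta> i) t = (\<Sum>\<zeta>\<in>G. a \<zeta> * defect1 k (c \<zeta>) t)"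
  "defect2 k (\<lambda>i. \<Sum>\<zeta>\<in>G. a \<zeta> * c \<zeta> i) t = (\<Sum>\<zeta>\<in>G. a \<zeta> * defect2 k (c \<zeta>) t)"
proof -
  have "(\<Sum>l\<in>L. (\<Sum>\<zeta>\<in>G. a \<zeta> * c \<zeta> (f l)) * t ^ l) = (\<Sum>\<zeta>\<in>G. a \<zeta> * (\<Sum>l\<in>L. c \<zeta> (f l) * t ^ l))" for L f
    unfolding sum_distrib_right sum_distrib_left by (subst sum.swap) (simp add: mult.assoc)
  from this[of "\<lambda>l. l"] this[of "\<lambda>l. k - 2 + l"]
  show "defect1 k (\<lambda>i. \<Sum>\<zeta>\<in>G. a \<zeta> * c \<zeta> i) t = (\<Sum>\<zeta>\<in>G. a \<zeta> * defect1 k (c \<zeta>) t)"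
  "defect2 k (\<lambda>i. \<Sum>\<zeta>\<in>G. a \<zeta> * c \<zeta> i) t = (\<Sum>\<zeta>\<in>G. a \<zeta> * defect2 k (c \<zeta>) t)"
    by (simp_all add: defect1_def defect2_def right_diff_distrib sum_subtractf)
qed

lemma defect_cong:
  assumes "\<And>i. 1 \<le> i \<Longrightarrow> i \<le> 2 * k - 1 \<Longrightarrow> c i = c' i" "k \<ge> 2"
  shows "defect1 k c t = defect1 k c' t" "defect2 k c t = defect2 k c' t"
proof -
  have "(\<Sum>l=1..k-2. c l * t ^ l) = (\<Sum>l=1..k-2. c' l * t ^ l)"
    "(\<Sum>l=1..k-1. c (k - 2 + l) * t ^ l) = (\<Sum>l=1..k-1. c' (k - 2 + l) * t ^ l)"
    using assms by (auto intro!: sum.cong)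
  then show "defect1 k c t = defect1 k c' t" "defect2 k c t = defect2 k c' t"
    using assms by (auto simp: defect1_def defect2_def)
qed

lemma defect_diff:
  "defect1 k (\<lambda>i. c i - c' i) t = defect1 k c t - defect1 k c' t"
  "defect2 k (\<lambda>i. c i - c' i) t = defect2 k c t - defect2 k c' t"
  by (simp_all add: defect1_def defect2_def left_diff_distrib sum_subtractf)

section \<open>Generation: the module of triples \<open>(g, h1, h2)\<close> over the germs on the
  target\<close>

locale cross_cap_setup =
  fixes k :: nat
  assumes k: "k \<ge> 2"
begin

abbreviation "N \<equiv> 2 * k - 1"
abbreviation "G \<equiv> cross_cap_fields k"
abbreviation "\<psi> \<equiv> unfold_map k"
abbreviation y :: "(nat \<Rightarrow> complex) \<Rightarrow> complex" where "y x \<equiv> x (2 * k - 2)"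
abbreviation graph_eq :: "(nat \<Rightarrow> complex) \<Rightarrow> complex" where "graph_eq x \<equiv> x (2 * k - 1) - capQ k x (y x)"

lemma yN: "2 * k - 2 \<in> {1..N}" using k by auto

lemma germ_map_psi: "germ_map N N \<psi>"
  using germ_map_unfold_map[OF _ yN] k by simp

lemmas analytic_germ_psi = analytic_germ_compose[OF _ germ_map_psi]

text \<open>The germs in \<open>(u, v, y, w\<^sub>2)\<close> form a module over the germs on the target via \<open>\<psi>\<close>.\<close>

definition psi_module :: "((nat \<Rightarrow> complex) \<Rightarrow> complex) set \<Rightarrow> bool" where
  "psi_module S \<longleftrightarrow> (\<lambda>_. 0) \<in> S \<and> (\<forall>f\<in>S. \<forall>g\<in>S. (\<lambda>x. f x + g x) \<in> S) \<and>
     (\<forall>c f. analytic_germ N c \<longrightarrow> f \<in> S \<longrightarrow> (\<lambda>x. c (\<psi> x) * f x) \<in> S) \<and>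
     (\<forall>f g. f \<in> S \<longrightarrow> eventually (\<lambda>x. f x = g x) (at_0 N) \<longrightarrow> g \<in> S)"

lemma psi_module_sum:
  assumes "psi_module S" "\<And>i. i \<in> I \<Longrightarrow> f i \<in> S"
  shows "(\<lambda>x. \<Sum>i\<in>I. f i x) \<in> S"
  using assms(2)
  by (induction I rule: infinite_finite_induct) (use assms(1) in \<open>auto simp: psi_module_def\<close>)

lemma psi_module_scale: "psi_module S \<Longrightarrow> analytic_germ N c \<Longrightarrow> f \<in> S \<Longrightarrow> (\<lambda>x. c (\<psi> x) * f x) \<in> S"
  by (simp add: psi_module_def)

lemma psi_module_add: "psi_module S \<Longrightarrow> f \<in> S \<Longrightarrow> g \<in> S \<Longrightarrow> (\<lambda>x. f x + g x) \<in> S"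
  by (simp add: psi_module_def)

lemma psi_module_cong: "psi_module S \<Longrightarrow> f \<in> S \<Longrightarrow> eventually (\<lambda>x. f x = g x) (at_0 N) \<Longrightarrow> g \<in> S"
  by (auto simp: psi_module_def)

text \<open>Triangularity yields all powers of \<open>y\<close> below \<open>k\<close>; then the division theorem applies.\<close>

lemma psi_module_everything:
  assumes S: "psi_module S"
    and p: "\<And>j. j < k \<Longrightarrow> \<exists>c e. e \<noteq> 0 \<and> (\<forall>i\<le>j. analytic_germ N (c i)) \<and> (\<forall>x. c j x = e) \<and>
       (\<lambda>x. \<Sum>i\<le>j. c i (\<psi> x) * y x ^ i) \<in> S"
    and f: "analytic_germ N f"
  shows "f \<in> S"
proof -
  have pow: "(\<lambda>x. y x ^ j) \<in> S" if "j < k" for j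
    using that
  proof (induction j rule: less_induct)
    case (less j)
    obtain c e where e: "e \<noteq> 0" and c: "\<And>i. i \<le> j \<Longrightarrow> analytic_germ N (c i)" and top: "\<And>x. c j x = e"
      and mem: "(\<lambda>x. \<Sum>i\<le>j. c i (\<psi> x) * y x ^ i) \<in> S"
      using p[OF less.prems] by blast
    have low: "(\<lambda>x. \<Sum>i<j. c i (\<psi> x) * y x ^ i) \<in> S"
      using c less by (intro psi_module_sum[OF S] psi_module_scale[OF S]) auto
    have "(\<lambda>x. 1 / e * (\<Sum>i\<le>j. c i (\<psi> x) * y x ^ i) + - 1 / e * (\<Sum>i<j. c i (\<psi> x) * y x ^ i)) \<in> S"
      using psi_module_scale[OF S analytic_germ_const mem, of "1 / e"]
        psi_module_scale[OF S analytic_germ_const low, of "- 1 / e"]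
      by (intro psi_module_add[OF S])
    moreover have "1 / e * (\<Sum>i\<le>j. c i (\<psi> x) * y x ^ i) + - 1 / e * (\<Sum>i<j. c i (\<psi> x) * y x ^ i) = y x ^ j" for x
      using e by (simp add: lessThan_Suc_atMost[symmetric] top field_simps)
    ultimately show ?case by simp
  qed
  obtain \<alpha> where \<alpha>: "\<And>j. analytic_germ N (\<alpha> j)"
    "eventually (\<lambda>x. f x = (\<Sum>j<k. \<alpha> j (\<psi> x) * y x ^ j)) (at_0 N)"
    using unfold_map_division[OF k yN f] by blast
  have "(\<lambda>x. \<Sum>j<k. \<alpha> j (\<psi> x) * y x ^ j) \<in> S"
    using pow by (intro psi_module_sum[OF S] psi_module_scale[OF S] \<alpha>) auto
  then show ?thesis
    by (rule psi_module_cong[OF S]) (use \<alpha>(2) in \<open>auto elim: eventually_mono\<close>)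
qed

text \<open>The pair of defects of a target field at \<open>\<psi> x\<close> has the shape
  \<open>(dcapP * g + graph_eq * h1, dcapQ * g + graph_eq * h2)\<close> if the field is liftable. The predicate says that
  such a pair is attained by a combination of the generators, up to a correction \<open>l\<close> of \<open>g\<close> coming from the
  target.\<close>

definition attained_by where
  "attained_by a l g h1 h2 = (\<lambda>x.
     (\<Sum>\<zeta>\<in>G. a \<zeta> (\<psi> x) * defect1 k (\<zeta> (\<psi> x)) (y x)) = dcapP k x (y x) * (g x + l (\<psi> x)) + graph_eq x * h1 x \<and>
     (\<Sum>\<zeta>\<in>G. a \<zeta> (\<psi> x) * defect2 k (\<zeta> (\<psi> x)) (y x)) = dcapQ k x (y x) * (g x + l (\<psi> x)) + graph_eq x * h2 x)"

definition attained :: "((nat \<Rightarrow> complex) \<Rightarrow> complex) \<Rightarrow> ((nat \<Rightarrow> complex) \<Rightarrow> complex) \<Rightarrow> ((nat \<Rightarrow> complex) \<Rightarrow> complex) \<Rightarrow> bool" where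
  "attained g h1 h2 \<longleftrightarrow> (\<exists>a l. (\<forall>\<zeta>\<in>G. analytic_germ N (a \<zeta>)) \<and> analytic_germ N l \<and>
     eventually (attained_by a l g h1 h2) (at_0 N))"

lemma attainedI:
  "\<forall>\<zeta>\<in>G. analytic_germ N (a \<zeta>) \<Longrightarrow> analytic_germ N l \<Longrightarrow>
   eventually (attained_by a l g h1 h2) (at_0 N) \<Longrightarrow> attained g h1 h2"
  unfolding attained_def by blast

lemma attainedE:
  assumes "attained g h1 h2"
  obtains a l where "\<forall>\<zeta>\<in>G. analytic_germ N (a \<zeta>)" "analytic_germ N l"
    "eventually (attained_by a l g h1 h2) (at_0 N)"
  using assms unfolding attained_def by blast

lemma attained_zero: "attained (\<lambda>_. 0) (\<lambda>_. 0) (\<lambda>_. 0)"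
  by (rule attainedI[of "\<lambda>_ _. 0" "\<lambda>_. 0"]) (simp_all add: attained_by_def)

text \<open>The triple \<open>(1, 0, 0)\<close> is attained through the correction \<open>l\<close>
  alone; that no field is lost this way is settled by
  \<open>defects_determine_field\<close>.\<close>

lemma attained_one: "attained (\<lambda>_. 1) (\<lambda>_. 0) (\<lambda>_. 0)"
  by (rule attainedI[of "\<lambda>_ _. 0" "\<lambda>_. -1"]) (simp_all add: attained_by_def)

text \<open>The Koszul triple produces zero defects, so the empty combination of generators attains
  it.\<close>

lemma attained_koszul: "attained graph_eq (\<lambda>x. - dcapP k x (y x)) (\<lambda>x. - dcapQ k x (y x))"
  by (rule attainedI[of "\<lambda>_ _. 0" "\<lambda>_. 0"]) (simp_all add: attained_by_def)

lemma attained_add: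
  assumes "attained g h1 h2" "attained g' h1' h2'"
  shows "attained (\<lambda>x. g x + g' x) (\<lambda>x. h1 x + h1' x) (\<lambda>x. h2 x + h2' x)"
proof -
  obtain a l where a: "\<forall>\<zeta>\<in>G. analytic_germ N (a \<zeta>)" "analytic_germ N l"
    and ev: "eventually (attained_by a l g h1 h2) (at_0 N)"
    using assms(1) by (rule attainedE)
  obtain a' l' where a': "\<forall>\<zeta>\<in>G. analytic_germ N (a' \<zeta>)" "analytic_germ N l'"
    and ev': "eventually (attained_by a' l' g' h1' h2') (at_0 N)"
    using assms(2) by (rule attainedE)
  show ?thesis
  proof (rule attainedI)
    from ev ev' show "eventually (attained_by (\<lambda>\<zeta> x. a \<zeta> x + a' \<zeta> x) (\<lambda>x. l x + l' x)
       (\<lambda>x. g x + g' x) (\<lambda>x. h1 x + h1' x) (\<lambda>x. h2 x + h2' x)) (at_0 N)"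
      unfolding attained_by_def
      by eventually_elim (simp only: distrib_right[of _ _ "defect1 k _ _"] distrib_right[of _ _ "defect2 k _ _"] sum.distrib, simp add: algebra_simps)
  qed (use a a' in \<open>auto intro: analytic_germ_add\<close>)
qed

lemma attained_scale:
  assumes "attained g h1 h2" and c: "analytic_germ N c"
  shows "attained (\<lambda>x. c (\<psi> x) * g x) (\<lambda>x. c (\<psi> x) * h1 x) (\<lambda>x. c (\<psi> x) * h2 x)"
proof -
  obtain a l where a: "\<forall>\<zeta>\<in>G. analytic_germ N (a \<zeta>)" "analytic_germ N l"
    and ev: "eventually (attained_by a l g h1 h2) (at_0 N)"
    using assms(1) by (rule attainedE)
  show ?thesis
  proof (rule attainedI)
    from ev show "eventually (attained_by (\<lambda>\<zeta> x. c x * a \<zeta> x) (\<lambda>x. c x * l x)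
       (\<lambda>x. c (\<psi> x) * g x) (\<lambda>x. c (\<psi> x) * h1 x) (\<lambda>x. c (\<psi> x) * h2 x)) (at_0 N)"
      unfolding attained_by_def
      by eventually_elim (simp only: mult.assoc[of "c _"] sum_distrib_left[symmetric], simp add: algebra_simps)
  qed (use a c in \<open>auto intro: analytic_germ_mult\<close>)
qed

lemma attained_cong:
  assumes "attained g h1 h2" "eventually (\<lambda>x. g x = g' x \<and> h1 x = h1' x \<and> h2 x = h2' x) (at_0 N)"
  shows "attained g' h1' h2'"
proof -
  obtain a l where a: "\<forall>\<zeta>\<in>G. analytic_germ N (a \<zeta>)" "analytic_germ N l"
    and ev: "eventually (attained_by a l g h1 h2) (at_0 N)"
    using assms(1) by (rule attainedE)
  have "eventually (attained_by a l g' h1' h2') (at_0 N)"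
    using ev assms(2) by eventually_elim (simp add: attained_by_def)
  then show ?thesis using a attainedI by blast
qed

lemma attained_generator:
  assumes \<zeta>: "\<zeta> \<in> G"
    and eq: "\<And>x. defect1 k (\<zeta> (\<psi> x)) (y x) = dcapP k x (y x) * g x + graph_eq x * h1 x"
      "\<And>x. defect2 k (\<zeta> (\<psi> x)) (y x) = dcapQ k x (y x) * g x + graph_eq x * h2 x"
  shows "attained g h1 h2"
proof -
  have "(\<Sum>\<zeta>'\<in>G. (if \<zeta>' = \<zeta> then 1 else 0) * f \<zeta>') = f \<zeta>" for f :: "vfield \<Rightarrow> complex"
    using \<zeta> finite_cross_cap_fields[of k] by (simp add: if_distrib[of "\<lambda>c. c * _"] cong: if_cong)
  then show ?thesis
    by (intro attainedI[of "\<lambda>\<zeta>' _. if \<zeta>' = \<zeta> then 1 else 0" "\<lambda>_. 0"]) (simp_all add: attained_by_def eq)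
qed

lemma psi_module_g: "psi_module {g. attained g (\<lambda>_. 0) (\<lambda>_. 0)}"
  unfolding psi_module_def
  using attained_zero attained_add[of _ "\<lambda>_. 0" "\<lambda>_. 0" _ "\<lambda>_. 0" "\<lambda>_. 0"]
    attained_scale[of _ "\<lambda>_. 0" "\<lambda>_. 0"] attained_cong[of _ "\<lambda>_. 0" "\<lambda>_. 0" _ "\<lambda>_. 0" "\<lambda>_. 0"]
  by auto

lemma psi_module_h1: "psi_module {h. attained (\<lambda>_. 0) h (\<lambda>_. 0)}"
  unfolding psi_module_def
  using attained_zero attained_add[of "\<lambda>_. 0" _ "\<lambda>_. 0" "\<lambda>_. 0" _ "\<lambda>_. 0"]
    attained_scale[of "\<lambda>_. 0" _ "\<lambda>_. 0"] attained_cong[of "\<lambda>_. 0" _ "\<lambda>_. 0" "\<lambda>_. 0" _ "\<lambda>_. 0"]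
  by auto

lemma psi_module_h2: "psi_module {h. attained (\<lambda>_. 0) (\<lambda>_. 0) h}"
  unfolding psi_module_def
  using attained_zero attained_add[of "\<lambda>_. 0" "\<lambda>_. 0" _ "\<lambda>_. 0" "\<lambda>_. 0"]
    attained_scale[of "\<lambda>_. 0" "\<lambda>_. 0"] attained_cong[of "\<lambda>_. 0" "\<lambda>_. 0" _ "\<lambda>_. 0" "\<lambda>_. 0"]
  by auto

lemma analytic_germ_Uc: "analytic_germ n (\<lambda>X. Uc p X r)"
  by (cases "1 \<le> r \<and> r \<le> p - 2"; cases "r = p") (auto simp: Uc_def)

lemma analytic_germ_Vc: "analytic_germ n (\<lambda>X. Vc p X r)"
  by (cases "1 \<le> r \<and> r \<le> p - 1") (auto simp: Vc_def)

lemma Uc_psi: "Uc (int k) (\<psi> x) r = Uc (int k) x r"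
  using k by (auto simp: Uc_def unfold_map_def)

lemma Vc_psi: "Vc (int k) (\<psi> x) r = Vc (int k) x r"
  using k by (auto simp: Vc_def unfold_map_def)

lemma sum_tail_nat:
  fixes f :: "int \<Rightarrow> complex"
  assumes "a + int j = int k"
  shows "(\<Sum>m=a..int k. f m * t ^ nat (m - a)) = (\<Sum>i\<le>j. f (a + int i) * t ^ i)"
  by (rule sum.reindex_bij_witness[of _ "\<lambda>i. a + int i" "\<lambda>m. nat (m - a)"]) (use assms in auto)

lemma sum_tail_nat1:
  fixes f :: "int \<Rightarrow> complex"
  assumes "a + int j = int k"
  shows "(\<Sum>m=a+1..int k. f m * t ^ nat (m - a)) = (\<Sum>i=1..j. f (a + int i) * t ^ i)"
  by (rule sum.reindex_bij_witness[of _ "\<lambda>i. a + int i" "\<lambda>m. nat (m - a)"]) (use assms in auto)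

lemma sum_atMost_head: "(\<Sum>i\<le>j. f i :: complex) = f 0 + (\<Sum>i=1..j. f i)" for j :: nat
proof -
  have "{..j} = insert 0 {1..j}" by auto
  then show ?thesis by simp
qed

text \<open>In the slot of \<open>g\<close>, \<open>y ^ 0\<close> comes from
  \<open>(1, 0, 0)\<close> and \<open>y ^ j\<close> with \<open>j > 0\<close> from
  \<open>field2\<close> at index \<open>j\<close>, whose \<open>g\<close> has degree
  \<open>j\<close> and whose \<open>h1\<close>, \<open>h2\<close> are zero.\<close>

lemma attained_g:
  assumes "analytic_germ N g" shows "attained g (\<lambda>_. 0) (\<lambda>_. 0)"
proof -
  have "g \<in> {g. attained g (\<lambda>_. 0) (\<lambda>_. 0)}"
  proof (rule psi_module_everything[OF psi_module_g _ assms])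
    fix j assume j: "j < k"
    show "\<exists>c e. e \<noteq> 0 \<and> (\<forall>i\<le>j. analytic_germ N (c i)) \<and> (\<forall>x. c j x = e) \<and>
       (\<lambda>x. \<Sum>i\<le>j. c i (\<psi> x) * y x ^ i) \<in> {g. attained g (\<lambda>_. 0) (\<lambda>_. 0)}"
    proof (cases "j = 0")
      case True
      then show ?thesis using attained_one
        by (intro exI[of _ "\<lambda>_ _. 1"] exI[of _ 1]) simp
    next
      case False
      define a where "a = int k - int j"
      define c where "c i X = (if i = 0 then of_int (int j) * Uc (int k) X a else of_nat k * Uc (int k) X (a + int i))" for i :: nat and X
      have j': "1 \<le> int j" "int j \<le> int k - 1" using j False by auto
      have "attained (\<lambda>x. of_int (int j) * Uc (int k) (\<psi> x) (int k - int j) +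
          of_nat k * (\<Sum>m=int k-int j+1..int k. Uc (int k) (\<psi> x) m * y x ^ nat (m - (int k - int j)))) (\<lambda>_. 0) (\<lambda>_. 0)"
      proof (rule attained_generator)
        show "field2 (int k) (int j) \<in> G" using j' unfolding cross_cap_fields_def by auto
      qed (use field2_defects[OF k unfold_map_eq[OF k, symmetric] j'] unfold_map_simps[OF k] in simp_all)
      moreover have "of_int (int j) * Uc (int k) (\<psi> x) (int k - int j) +
          of_nat k * (\<Sum>m=int k-int j+1..int k. Uc (int k) (\<psi> x) m * y x ^ nat (m - (int k - int j)))
          = (\<Sum>i\<le>j. c i (\<psi> x) * y x ^ i)" for x
      proof -
        have "(\<Sum>m=a+1..int k. Uc (int k) (\<psi> x) m * y x ^ nat (m - a)) = (\<Sum>i=1..j. Uc (int k) (\<psi> x) (a + int i) * y x ^ i)"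
          by (rule sum_tail_nat1) (simp add: a_def)
        moreover have "(\<Sum>i=1..j. c i (\<psi> x) * y x ^ i) = of_nat k * (\<Sum>i=1..j. Uc (int k) (\<psi> x) (a + int i) * y x ^ i)"
          unfolding sum_distrib_left by (intro sum.cong) (auto simp: c_def)
        ultimately show ?thesis unfolding sum_atMost_head by (simp add: c_def a_def)
      qed
      \<comment> \<open>The top index is \<open>a + j = k\<close>, where \<open>U_k = 1\<close>;
        this makes the leading coefficient constant.\<close>
      moreover have "c j X = of_nat k" for X using False k by (simp add: c_def a_def Uc_def)
      moreover have "analytic_germ N (c i)" for i
        unfolding c_def by (cases "i = 0") (auto intro!: analytic_germ_mult analytic_germ_Uc)
      ultimately show ?thesis using k by (intro exI[of _ c] exI[of _ "of_nat k"]) auto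
    qed
  qed
  then show ?thesis by simp
qed

text \<open>Both the Euler field (for \<open>y ^ 0\<close>) and \<open>field1\<close> at index
  \<open>k - j\<close> (for \<open>y ^ j\<close>) have \<open>h1 = 0\<close>; their \<open>g\<close>
  is removed by \<open>attained_g\<close>.\<close>

lemma attained_h2:
  assumes "analytic_germ N h" shows "attained (\<lambda>_. 0) (\<lambda>_. 0) h"
proof -
  have reduce: "attained (\<lambda>_. 0) (\<lambda>_. 0) h" if "attained g (\<lambda>_. 0) h" "analytic_germ N g" for g h
    using attained_add[OF that(1) attained_g[of "\<lambda>x. - g x"]] analytic_germ_minus[OF that(2)] by simp
  have "h \<in> {h. attained (\<lambda>_. 0) (\<lambda>_. 0) h}"
  proof (rule psi_module_everything[OF psi_module_h2 _ assms])
    fix j assume j: "j < k"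
    show "\<exists>c e. e \<noteq> 0 \<and> (\<forall>i\<le>j. analytic_germ N (c i)) \<and> (\<forall>x. c j x = e) \<and>
       (\<lambda>x. \<Sum>i\<le>j. c i (\<psi> x) * y x ^ i) \<in> {h. attained (\<lambda>_. 0) (\<lambda>_. 0) h}"
    proof (cases "j = 0")
      case True
      have "attained y (\<lambda>_. 0) (\<lambda>_. of_nat k)"
      proof (rule attained_generator)
        show "euler_field (int k) \<in> G" unfolding cross_cap_fields_def by auto
      qed (use euler_field_defects[OF k unfold_map_eq[OF k, symmetric]] unfold_map_simps[OF k] in simp_all)
      then have "attained (\<lambda>_. 0) (\<lambda>_. 0) (\<lambda>_. of_nat k)" by (rule reduce) simp
      then show ?thesis using True k
        by (intro exI[of _ "\<lambda>_ _. of_nat k"] exI[of _ "of_nat k"]) simp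
    next
      case False
      define a where "a = int k - int j"
      define c where "c i X = (if i = 0 then of_int (int k - a) * Uc (int k) X a else of_nat k * Uc (int k) X (a + int i))" for i :: nat and X
      have a: "1 \<le> a" "a \<le> int k - 1" using j False by (auto simp: a_def)
      have "attained (\<lambda>x. of_int (int k - a) * Uc (int k) (\<psi> x) a * y x) (\<lambda>_. 0) (\<lambda>x. of_int (int k - a) * Uc (int k) (\<psi> x) a +
          of_nat k * (\<Sum>m=a+1..int k. Uc (int k) (\<psi> x) m * y x ^ nat (m - a)))"
      proof (rule attained_generator)
        show "field1 (int k) a \<in> G" using a unfolding cross_cap_fields_def by auto
      qed (use field1_defects[OF k unfold_map_eq[OF k, symmetric] a] unfold_map_simps[OF k] in simp_all)
      then have "attained (\<lambda>_. 0) (\<lambda>_. 0) (\<lambda>x. of_int (int k - a) * Uc (int k) (\<psi> x) a +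
          of_nat k * (\<Sum>m=a+1..int k. Uc (int k) (\<psi> x) m * y x ^ nat (m - a)))"
        by (rule reduce) (auto intro!: analytic_germ_intros analytic_germ_Uc simp: Uc_psi)
      moreover have "of_int (int k - a) * Uc (int k) (\<psi> x) a +
          of_nat k * (\<Sum>m=a+1..int k. Uc (int k) (\<psi> x) m * y x ^ nat (m - a))
          = (\<Sum>i\<le>j. c i (\<psi> x) * y x ^ i)" for x
      proof -
        have "(\<Sum>m=a+1..int k. Uc (int k) (\<psi> x) m * y x ^ nat (m - a)) = (\<Sum>i=1..j. Uc (int k) (\<psi> x) (a + int i) * y x ^ i)"
          by (rule sum_tail_nat1) (simp add: a_def)
        moreover have "(\<Sum>i=1..j. c i (\<psi> x) * y x ^ i) = of_nat k * (\<Sum>i=1..j. Uc (int k) (\<psi> x) (a + int i) * y x ^ i)"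
          unfolding sum_distrib_left by (intro sum.cong) (auto simp: c_def)
        ultimately show ?thesis unfolding sum_atMost_head by (simp add: c_def)
      qed
      moreover have "c j X = of_nat k" for X using False k by (simp add: c_def a_def Uc_def)
      moreover have "analytic_germ N (c i)" for i
        unfolding c_def by (cases "i = 0") (auto intro!: analytic_germ_mult analytic_germ_Uc)
      ultimately show ?thesis using k by (intro exI[of _ c] exI[of _ "of_nat k"]) auto
    qed
  qed
  then show ?thesis by simp
qed

text \<open>Coefficients of \<open>P'\<close> in powers of \<open>y\<close>. Below \<open>k\<close>
  the final branch concerns only \<open>j = k - 2\<close>, where \<open>U_{k-1} = 0\<close>.\<close>

definition dcapP_coeff :: "nat \<Rightarrow> (nat \<Rightarrow> complex) \<Rightarrow> complex" where
  "dcapP_coeff j X = (if j = k - 1 then of_nat k else if j + 1 \<le> k - 2 then of_nat (j + 1) * X (j + 1) else 0)"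

lemma analytic_germ_dcapP_coeff: "analytic_germ n (dcapP_coeff j)"
  unfolding dcapP_coeff_def by (cases "j = k - 1"; cases "j + 1 \<le> k - 2") (auto intro!: analytic_germ_intros)

lemma dcapP_expansion: "dcapP k x (y x) = (\<Sum>j<k. dcapP_coeff j (\<psi> x) * y x ^ j)"
proof -
  have "{..<k} = insert (k - 1) {..<k - 1}" using k by auto
  then have "(\<Sum>j<k. dcapP_coeff j (\<psi> x) * y x ^ j) =
     dcapP_coeff (k - 1) (\<psi> x) * y x ^ (k - 1) + (\<Sum>j<k-1. dcapP_coeff j (\<psi> x) * y x ^ j)"
    by simp
  also have "(\<Sum>j<k-1. dcapP_coeff j (\<psi> x) * y x ^ j) = (\<Sum>j<k-2. dcapP_coeff j (\<psi> x) * y x ^ j)"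
    by (rule sum.mono_neutral_right) (use k in \<open>auto simp: dcapP_coeff_def\<close>)
  also have "\<dots> = (\<Sum>i=1..k-2. of_nat i * x i * y x ^ (i - 1))"
    by (rule sum.reindex_bij_witness[of _ "\<lambda>i. i - 1" Suc]) (use k in \<open>auto simp: dcapP_coeff_def unfold_map_def\<close>)
  finally show ?thesis by (simp add: dcapP_def dcapP_coeff_def)
qed

text \<open>\<open>field3\<close> at index \<open>j + 1\<close> gives \<open>y ^ j\<close> for
  \<open>j < k - 1\<close>, with leading coefficient \<open>k * k\<close>. The power
  \<open>k - 1\<close> would need an index \<open>k\<close> outside the family; the Koszul triple
  with \<open>h1 = - P'\<close> fills this gap. The other two slots are cleared by the preceding
  lemmas.\<close>

lemma attained_h1:
  assumes "analytic_germ N h" shows "attained (\<lambda>_. 0) h (\<lambda>_. 0)"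
proof -
  have reduce: "attained (\<lambda>_. 0) h (\<lambda>_. 0)" if "attained g h h2" "analytic_germ N g" "analytic_germ N h2" for g h h2
    using attained_add[OF attained_add[OF that(1) attained_g[of "\<lambda>x. - g x"]] attained_h2[of "\<lambda>x. - h2 x"]]
      analytic_germ_minus that by simp
  have "h \<in> {h. attained (\<lambda>_. 0) h (\<lambda>_. 0)}"
  proof (rule psi_module_everything[OF psi_module_h1 _ assms])
    fix j assume j: "j < k"
    show "\<exists>c e. e \<noteq> 0 \<and> (\<forall>i\<le>j. analytic_germ N (c i)) \<and> (\<forall>x. c j x = e) \<and>
       (\<lambda>x. \<Sum>i\<le>j. c i (\<psi> x) * y x ^ i) \<in> {h. attained (\<lambda>_. 0) h (\<lambda>_. 0)}"
    proof (cases "j = k - 1")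
      case True
      have "attained (\<lambda>_. 0) (\<lambda>x. - dcapP k x (y x)) (\<lambda>_. 0)"
        by (rule reduce[OF attained_koszul]) (auto intro!: analytic_germ_intros analytic_germ_capQ analytic_germ_dcapQ)
      moreover have "{..j} = {..<k}" using True k by auto
      then have "- dcapP k x (y x) = (\<Sum>i\<le>j. - dcapP_coeff i (\<psi> x) * y x ^ i)" for x
        by (simp add: dcapP_expansion sum_negf)
      moreover have "analytic_germ N (\<lambda>X. - dcapP_coeff i X)" for i
        by (intro analytic_germ_minus analytic_germ_dcapP_coeff)
      moreover have "- dcapP_coeff j X = - of_nat k" for X using True by (simp add: dcapP_coeff_def)
      ultimately show ?thesis using k by (intro exI[of _ "\<lambda>i X. - dcapP_coeff i X"] exI[of _ "- of_nat k"]) auto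
    next
      case False
      define a where "a = int k - int j"
      define c where "c i X = of_nat k * (of_int (a + int i) * Uc (int k) X (a + int i))" for i :: nat and X
      have j': "1 \<le> int j + 1" "int j + 1 \<le> int k - 1" using j False by auto
      have ka: "int k - (int j + 1) + 1 = a" by (simp add: a_def)
      let ?T = "\<lambda>F x. of_nat k * (\<Sum>m=a..int k. of_int m * F m * y x ^ nat (m - a))"
      have "attained (\<lambda>x. of_nat k * (\<Sum>m=int k-(int j+1)..int k. Vc (int k) (\<psi> x) m * y x ^ nat (m - (int k - (int j+1)))))
          (\<lambda>x. ?T (Uc (int k) (\<psi> x)) x) (\<lambda>x. ?T (Vc (int k) (\<psi> x)) x)"
      proof (rule attained_generator)
        show "field3 (int k) (int j + 1) \<in> G" using j' unfolding cross_cap_fields_def by auto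
      qed (use field3_defects[OF k unfold_map_eq[OF k, symmetric] j'] unfold_map_simps[OF k] ka in simp_all)
      then have "attained (\<lambda>_. 0) (\<lambda>x. ?T (Uc (int k) (\<psi> x)) x) (\<lambda>_. 0)"
        by (rule reduce) (auto intro!: analytic_germ_intros analytic_germ_Vc simp: Vc_psi)
      moreover have "?T (Uc (int k) (\<psi> x)) x = (\<Sum>i\<le>j. c i (\<psi> x) * y x ^ i)" for x
        by (subst sum_tail_nat[where j = j]) (simp_all add: a_def c_def sum_distrib_left mult.assoc)
      moreover have "c j X = of_nat k * of_nat k" for X using k by (simp add: c_def a_def Uc_def)
      moreover have "analytic_germ N (c i)" for i
        unfolding c_def by (auto intro!: analytic_germ_mult analytic_germ_Uc)
      ultimately show ?thesis using k by (intro exI[of _ c] exI[of _ "of_nat k * of_nat k"]) auto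
    qed
  qed
  then show ?thesis by simp
qed

lemma attained_all:
  assumes "analytic_germ N g" "analytic_germ N h1" "analytic_germ N h2"
  shows "attained g h1 h2"
  using attained_add[OF attained_add[OF attained_g[OF assms(1)] attained_h1[OF assms(2)]] attained_h2[OF assms(3)]]
  by simp

section \<open>From triples back to fields: liftability and generation\<close>

lemma analytic_germ_target_tuple:
  assumes "\<And>i. analytic_germ n (\<lambda>X. A X i)" "\<And>i. analytic_germ n (\<lambda>X. B X i)"
    "analytic_germ n C1" "analytic_germ n C2"
  shows "analytic_germ n (\<lambda>X. target_tuple p (A X) (B X) (C1 X) (C2 X) m)"
proof (cases "1 \<le> int m \<and> int m \<le> p - 2")
  case False
  then show ?thesis
    using assms unfolding target_tuple_def
    by (cases "p - 1 \<le> int m \<and> int m \<le> 2 * p - 3"; cases "int m = 2 * p - 2"; cases "int m = 2 * p - 1") auto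
qed (use assms in \<open>simp add: target_tuple_def\<close>)

lemma analytic_germ_W: "analytic_germ n (\<lambda>X. W1 p X)" "analytic_germ n (\<lambda>X. W2 p X)"
  by (simp_all add: W1_def W2_def)

lemma analytic_germ_generator:
  assumes "\<zeta> \<in> G" shows "analytic_germ n (\<lambda>X. \<zeta> X i)"
proof -
  have "\<zeta> = euler_field (int k) \<or> (\<exists>j. \<zeta> = field1 (int k) j \<or> \<zeta> = field2 (int k) j \<or> \<zeta> = field3 (int k) j)"
    using assms unfolding cross_cap_fields_def by auto
  moreover have "analytic_germ n (\<lambda>X. euler_field (int k) X i)"
    unfolding euler_field_def
    by (intro analytic_germ_target_tuple analytic_germ_intros analytic_germ_Uc analytic_germ_Vc analytic_germ_W)
  moreover have "analytic_germ n (\<lambda>X. field1 (int k) j X i)" for j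
    unfolding field1_def
    by (intro analytic_germ_target_tuple analytic_germ_intros analytic_germ_Uc analytic_germ_Vc analytic_germ_W)
  moreover have "analytic_germ n (\<lambda>X. field2 (int k) j X i)" for j
    unfolding field2_def
    by (intro analytic_germ_target_tuple analytic_germ_intros analytic_germ_Uc analytic_germ_Vc analytic_germ_W)
  moreover have "analytic_germ n (\<lambda>X. field3 (int k) j X i)" for j
    unfolding field3_def
    by (intro analytic_germ_target_tuple analytic_germ_intros analytic_germ_Uc analytic_germ_Vc analytic_germ_W)
  ultimately show ?thesis by auto
qed

text \<open>On the graph \<open>W2 = Q\<close> the terms with \<open>h1\<close> and
  \<open>h2\<close> vanish, and \<open>g\<close> becomes the \<open>y\<close>-component of a lift of
  the generator.\<close>

lemma generator_defects:
  assumes "\<zeta> \<in> G"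
  shows "\<exists>g h1 h2. analytic_germ N g \<and>
    (\<forall>x. defect1 k (\<zeta> (\<psi> x)) (y x) = dcapP k x (y x) * g x + graph_eq x * h1 x \<and>
         defect2 k (\<zeta> (\<psi> x)) (y x) = dcapQ k x (y x) * g x + graph_eq x * h2 x)"
proof -
  have I: ?thesis if "analytic_germ N g"
    "\<And>x. defect1 k (\<zeta> (\<psi> x)) (y x) = dcapP k x (y x) * g x + graph_eq x * h1 x"
    "\<And>x. defect2 k (\<zeta> (\<psi> x)) (y x) = dcapQ k x (y x) * g x + graph_eq x * h2 x" for g h1 h2
    using that by blast
  consider "\<zeta> = euler_field (int k)"
    | j where "1 \<le> j" "j \<le> int k - 1" "\<zeta> = field1 (int k) j"
    | j where "1 \<le> j" "j \<le> int k - 1" "\<zeta> = field2 (int k) j"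
    | j where "1 \<le> j" "j \<le> int k - 1" "\<zeta> = field3 (int k) j"
    using assms unfolding cross_cap_fields_def by auto
  then show ?thesis
  proof cases
    case 1
    show ?thesis
      by (rule I[where g = y and ?h1.0 = "\<lambda>_. 0" and ?h2.0 = "\<lambda>_. of_nat k"])
         (use 1 euler_field_defects[OF k unfold_map_eq[OF k, symmetric]] unfold_map_simps[OF k] in simp_all)
  next
    case (2 j)
    let ?g = "\<lambda>x. of_int (int k - j) * Uc (int k) (\<psi> x) j * y x"
    have "analytic_germ N ?g" unfolding Uc_psi by (intro analytic_germ_intros analytic_germ_Uc)
    then show ?thesis
      by (rule I[where ?h1.0 = "\<lambda>_. 0" and ?h2.0 = "\<lambda>x. of_int (int k - j) * Uc (int k) (\<psi> x) j
            + of_nat k * (\<Sum>m=j+1..int k. Uc (int k) (\<psi> x) m * y x ^ nat (m - j))"])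
         (use 2(3) field1_defects[OF k unfold_map_eq[OF k, symmetric] 2(1,2)] unfold_map_simps[OF k] in simp_all)
  next
    case (3 j)
    let ?g = "\<lambda>x. of_int j * Uc (int k) (\<psi> x) (int k - j)
      + of_nat k * (\<Sum>m=int k-j+1..int k. Uc (int k) (\<psi> x) m * y x ^ nat (m - (int k - j)))"
    have "analytic_germ N ?g" unfolding Uc_psi by (intro analytic_germ_intros analytic_germ_Uc)
    then show ?thesis
      by (rule I[where ?h1.0 = "\<lambda>_. 0" and ?h2.0 = "\<lambda>_. 0"])
         (use 3(3) field2_defects[OF k unfold_map_eq[OF k, symmetric] 3(1,2)] unfold_map_simps[OF k] in simp_all)
  next
    case (4 j)
    let ?g = "\<lambda>x. of_nat k * (\<Sum>m=int k-j..int k. Vc (int k) (\<psi> x) m * y x ^ nat (m - (int k - j)))"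
    let ?T = "\<lambda>F x. of_nat k * (\<Sum>m=int k-j+1..int k. of_int m * F m * y x ^ nat (m - (int k - j + 1)))"
    have "analytic_germ N ?g" unfolding Vc_psi by (intro analytic_germ_intros analytic_germ_Vc)
    then show ?thesis
      by (rule I[where ?h1.0 = "\<lambda>x. ?T (Uc (int k) (\<psi> x)) x" and ?h2.0 = "\<lambda>x. ?T (Vc (int k) (\<psi> x)) x"])
         (use 4(3) field3_defects[OF k unfold_map_eq[OF k, symmetric] 4(1,2)] unfold_map_simps[OF k] in simp_all)
  qed
qed

lemma graph_map_simps:
  "y (graph_map k x) = y x" "graph_eq (graph_map k x) = 0"
  "dcapP k (graph_map k x) t = dcapP k x t" "dcapQ k (graph_map k x) t = dcapQ k x t"
proof -
  have "2 * k - 3 < 2 * k - 1" "k - 2 < 2 * k - 1" "2 * k - 2 \<noteq> 2 * k - 1" using k by linarith+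
  then show "y (graph_map k x) = y x" "graph_eq (graph_map k x) = 0"
    "dcapP k (graph_map k x) t = dcapP k x t" "dcapQ k (graph_map k x) t = dcapQ k x t"
    unfolding graph_map_def using k by simp_all
qed

lemma module_imp_liftable:
  assumes "\<xi> \<in> generated_module N G"
  shows "liftable (2 * k - 2) N (cross_cap k) \<xi>"
proof -
  obtain a where \<xi>: "vector_field_germ N \<xi>" and a: "\<And>\<zeta>. \<zeta> \<in> G \<Longrightarrow> analytic_germ N (a \<zeta>)" and
    ev: "eventually (\<lambda>x. \<forall>i\<in>{1..N}. \<xi> x i = (\<Sum>\<zeta>\<in>G. a \<zeta> x * \<zeta> x i)) (at_0 N)"
    using assms unfolding generated_module_iff[OF finite_cross_cap_fields] by blast
  have "\<forall>\<zeta>\<in>G. \<exists>g h1 h2. analytic_germ N g \<and>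
    (\<forall>x. defect1 k (\<zeta> (\<psi> x)) (y x) = dcapP k x (y x) * g x + graph_eq x * h1 x \<and>
         defect2 k (\<zeta> (\<psi> x)) (y x) = dcapQ k x (y x) * g x + graph_eq x * h2 x)"
    using generator_defects by blast
  then obtain g where "\<forall>\<zeta>\<in>G. \<exists>h1 h2. analytic_germ N (g \<zeta>) \<and>
    (\<forall>x. defect1 k (\<zeta> (\<psi> x)) (y x) = dcapP k x (y x) * g \<zeta> x + graph_eq x * h1 x \<and>
         defect2 k (\<zeta> (\<psi> x)) (y x) = dcapQ k x (y x) * g \<zeta> x + graph_eq x * h2 x)"
    by (rule bchoice[THEN exE])
  then have g: "analytic_germ N (g \<zeta>)"
    "defect1 k (\<zeta> (\<psi> (graph_map k x))) (y x) = dcapP k x (y x) * g \<zeta> (graph_map k x)"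
    "defect2 k (\<zeta> (\<psi> (graph_map k x))) (y x) = dcapQ k x (y x) * g \<zeta> (graph_map k x)" if "\<zeta> \<in> G" for \<zeta> x
    using that graph_map_simps by (metis, metis add.right_neutral mult_zero_left, metis add.right_neutral mult_zero_left)
  \<comment> \<open>The \<open>y\<close>-component of the lift, combined from those of the
    generators with the coefficients pulled back along \<open>cross_cap\<close>.\<close>
  define l where "l x = (\<Sum>\<zeta>\<in>G. a \<zeta> (cross_cap k x) * g \<zeta> (graph_map k x))" for x
  have "analytic_germ (2 * k - 2) l"
    unfolding l_def
    using a g(1) by (intro analytic_germ_sum analytic_germ_mult analytic_germ_cross_cap[OF _ k]
        analytic_germ_compose[OF _ germ_map_graph_map[OF k]]) auto
  moreover have "eventually (\<lambda>x.
       defect1 k (\<xi> (cross_cap k x)) (y x) = dcapP k x (y x) * l x \<and>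
       defect2 k (\<xi> (cross_cap k x)) (y x) = dcapQ k x (y x) * l x) (at_0 (2 * k - 2))"
    using eventually_germ_map[OF ev germ_map_cross_cap[OF k]] eventually_cspace
  proof eventually_elim
    case (elim x)
    have eq: "cross_cap k x = \<psi> (graph_map k x)" by (rule cross_cap_eq_unfold_graph[OF k elim(2)])
    have d: "defect1 k (\<xi> (cross_cap k x)) (y x) = defect1 k (\<lambda>i. \<Sum>\<zeta>\<in>G. a \<zeta> (cross_cap k x) * \<zeta> (cross_cap k x) i) (y x)"
      "defect2 k (\<xi> (cross_cap k x)) (y x) = defect2 k (\<lambda>i. \<Sum>\<zeta>\<in>G. a \<zeta> (cross_cap k x) * \<zeta> (cross_cap k x) i) (y x)"
      using elim(1) by (auto intro!: defect_cong k)
    have "(\<Sum>\<zeta>\<in>G. a \<zeta> (cross_cap k x) * defect1 k (\<zeta> (cross_cap k x)) (y x)) = dcapP k x (y x) * l x"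
      "(\<Sum>\<zeta>\<in>G. a \<zeta> (cross_cap k x) * defect2 k (\<zeta> (cross_cap k x)) (y x)) = dcapQ k x (y x) * l x"
      unfolding l_def sum_distrib_left eq using g(2,3) by (auto intro!: sum.cong)
    then show ?case unfolding d defect_sum_scaled by blast
  qed
  ultimately show ?thesis unfolding liftable_iff[OF k] using \<xi> by blast
qed

text \<open>The shear \<open>W2 \<mapsto> W2 + Q\<close> moves the hyperplane \<open>W2 = 0\<close>
  onto the graph, which reduces the claim to division by a coordinate.\<close>

lemma factor_graph_eq:
  assumes F: "analytic_germ N F" and z: "eventually (\<lambda>x. F (graph_map k x) = 0) (at_0 (2 * k - 2))"
  obtains H where "analytic_germ N H" "eventually (\<lambda>x. F x = graph_eq x * H x) (at_0 N)"
proof -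
  define shear where "shear s x = x(2 * k - 1 := x (2 * k - 1) + s * capQ k x (y x))" for s and x :: "nat \<Rightarrow> complex"
  have N1: "2 * k - 1 \<in> {1..N}" using k by auto
  have shear: "germ_map N N (shear s)" for s
    unfolding shear_def[abs_def]
    by (intro germ_map_update N1 analytic_germ_intros analytic_germ_capQ) (simp_all add: capQ_def)
  obtain r where r: "r > 0" "\<And>x. x \<in> polydisc (2 * k - 2) r \<Longrightarrow> F (graph_map k x) = 0"
    using z by (auto simp: eventually_at_0)
  have "F (shear 1 x) = 0" if "x \<in> polydisc N r" "x (2 * k - 1) = 0" for x
  proof -
    have "x i = 0" if "i \<notin> {1..2*k-2}" for i
    proof (cases "i = 2 * k - 1")
      case False
      then have "i \<notin> {1..N}" using that by auto
      then show ?thesis using \<open>x \<in> polydisc N r\<close> by (simp add: polydisc_def cspace_def)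
    qed (use \<open>x (2 * k - 1) = 0\<close> in simp)
    then have "x \<in> polydisc (2 * k - 2) r"
      using polydisc_norm[OF that(1) r(1)] by (simp add: polydisc_def cspace_def)
    from r(2)[OF this] show ?thesis using that by (simp add: shear_def graph_map_def)
  qed
  then have "eventually (\<lambda>x. x (2 * k - 1) = 0 \<longrightarrow> F (shear 1 x) = 0) (at_0 N)"
    using r(1) unfolding eventually_at_0 by blast
  from analytic_germ_factor_coord[OF analytic_germ_compose[OF F shear] N1 this]
  obtain H where H: "analytic_germ N H" "eventually (\<lambda>x. F (shear 1 x) = x (2 * k - 1) * H x) (at_0 N)" by blast
  have "shear 1 (shear (-1) x) = x" "shear (-1) x (2 * k - 1) = graph_eq x" for x
  proof -
    have "2 * k - 3 < 2 * k - 1" "2 * k - 2 \<noteq> 2 * k - 1" using k by linarith+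
    then show "shear 1 (shear (-1) x) = x" "shear (-1) x (2 * k - 1) = graph_eq x"
      unfolding shear_def using k by simp_all
  qed
  then have "eventually (\<lambda>x. F x = graph_eq x * H (shear (-1) x)) (at_0 N)"
    using eventually_germ_map[OF H(2) shear[of "-1"]] by simp
  then show ?thesis using that analytic_germ_compose[OF H(1) shear] by blast
qed

lemma analytic_germ_defects:
  assumes "\<And>i. i \<in> {1..N} \<Longrightarrow> analytic_germ n (\<lambda>x. c x i)" "analytic_germ n t"
  shows "analytic_germ n (\<lambda>x. defect1 k (c x) (t x))" "analytic_germ n (\<lambda>x. defect2 k (c x) (t x))"
proof -
  have "2 * k - 2 \<in> {1..N}" "2 * k - 1 \<in> {1..N}" "l \<in> {1..k-2} \<Longrightarrow> l \<in> {1..N}"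
    "l \<in> {1..k-1} \<Longrightarrow> k - 2 + l \<in> {1..N}" for l using k by auto
  then show "analytic_germ n (\<lambda>x. defect1 k (c x) (t x))" "analytic_germ n (\<lambda>x. defect2 k (c x) (t x))"
    unfolding defect1_def defect2_def using assms(2)
    by (auto intro!: analytic_germ_diff analytic_germ_sum analytic_germ_mult analytic_germ_power assms(1) simp del: atLeastAtMost_iff)
qed

lemma sum_lessThan_head: "(\<Sum>j<k. f j :: complex) = f 0 + (\<Sum>j=1..k-1. f j)"
proof -
  have "{..<k} = insert 0 {1..k-1}" using k by auto
  then show ?thesis by simp
qed

text \<open>\<open>dcapP\<close> contains the term \<open>k y\<^bsup>k-1\<^esup>\<close>, which does not occur in \<open>defect1\<close>.\<close>

lemma defects_determine_field:
  assumes D: "\<And>i. i \<in> {1..N} \<Longrightarrow> analytic_germ N (\<lambda>X. D X i)" and l: "analytic_germ N l"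
    and ev: "eventually (\<lambda>x. defect1 k (D (\<psi> x)) (y x) = - (l (\<psi> x) * dcapP k x (y x)) \<and>
       defect2 k (D (\<psi> x)) (y x) = - (l (\<psi> x) * dcapQ k x (y x))) (at_0 N)"
  shows "eventually (\<lambda>X. \<forall>i\<in>{1..N}. D X i = 0) (at_0 N)"
proof -
  have inN: "2 * k - 2 \<in> {1..N}" "2 * k - 1 \<in> {1..N}" "1 \<le> j \<Longrightarrow> j \<le> k - 2 \<Longrightarrow> j \<in> {1..N}"
    "1 \<le> j \<Longrightarrow> j < k \<Longrightarrow> k - 2 + j \<in> {1..N}" for j using k by auto
  \<comment> \<open>Coefficients of the powers of \<open>y\<close> in
    \<open>defect1 + l * dcapP\<close>. In degree \<open>k - 1\<close> no component of
    \<open>D\<close> enters, so that coefficient is \<open>k * l\<close>.\<close>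
  define b1 where "b1 j X = (if j = 0 then D X (2 * k - 2) else if j \<le> k - 2 then - D X j else 0) + l X * dcapP_coeff j X" for j X
  \<comment> \<open>Without an \<open>l\<close>-term: \<open>b2\<close> is used only after
    \<open>b1\<close> has shown that \<open>l\<close> vanishes.\<close>
  define b2 where "b2 j X = (if j = 0 then D X (2 * k - 1) else if j < k then - D X (k - 2 + j) else 0)" for j X
  have b1: "analytic_germ N (b1 j)" for j
  proof -
    have "analytic_germ N (\<lambda>X. if j = 0 then D X (2 * k - 2) else if j \<le> k - 2 then - D X j else 0)"
      using D inN by (cases "j = 0"; cases "j \<le> k - 2") (auto intro!: analytic_germ_minus simp del: atLeastAtMost_iff)
    then show ?thesis unfolding b1_def
      by (intro analytic_germ_add analytic_germ_mult l analytic_germ_dcapP_coeff)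
  qed
  have b2: "analytic_germ N (b2 j)" for j
    unfolding b2_def using D inN
    by (cases "j = 0"; cases "j < k") (auto intro!: analytic_germ_minus simp del: atLeastAtMost_iff)
  have "(\<Sum>j<k. b1 j (\<psi> x) * y x ^ j) = defect1 k (D (\<psi> x)) (y x) + l (\<psi> x) * dcapP k x (y x)" for x
  proof -
    have "(\<Sum>j=1..k-1. (if j = 0 then D X (2 * k - 2) else if j \<le> k - 2 then - D X j else 0) * t ^ j)
       = - (\<Sum>j=1..k-2. D X j * t ^ j)" for X t
      unfolding sum_negf[symmetric] using k by (intro sum.mono_neutral_cong_right) auto
    then have "(\<Sum>j<k. (if j = 0 then D (\<psi> x) (2 * k - 2) else if j \<le> k - 2 then - D (\<psi> x) j else 0) * y x ^ j)
       = defect1 k (D (\<psi> x)) (y x)"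
      unfolding sum_lessThan_head by (simp add: defect1_def)
    then show ?thesis
      unfolding b1_def dcapP_expansion by (simp add: distrib_right sum.distrib sum_distrib_left mult.assoc)
  qed
  with ev have "eventually (\<lambda>x. (\<Sum>j<k. b1 j (\<psi> x) * y x ^ j) = 0) (at_0 N)" by (auto elim: eventually_mono)
  then have b1_zero: "eventually (\<lambda>X. b1 j X = 0) (at_0 N)" if "j < k" for j
    using unfold_map_independent[OF k yN b1 _ that] by simp
  have "b1 (k - 1) X = l X * of_nat k" for X using k by (simp add: b1_def dcapP_coeff_def)
  then have l_zero: "eventually (\<lambda>X. l X = 0) (at_0 N)" using b1_zero[of "k - 1"] k by simp
  have b2_sum: "(\<Sum>j<k. b2 j (\<psi> x) * y x ^ j) = defect2 k (D (\<psi> x)) (y x)" for x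
  proof -
    have "(\<Sum>j=1..k-1. b2 j X * t ^ j) = - (\<Sum>j=1..k-1. D X (k - 2 + j) * t ^ j)" for X t
      unfolding sum_negf[symmetric] by (intro sum.cong) (auto simp: b2_def)
    then show ?thesis unfolding sum_lessThan_head by (simp add: b2_def defect2_def)
  qed
  from ev eventually_germ_map[OF l_zero germ_map_psi] have "eventually (\<lambda>x. (\<Sum>j<k. b2 j (\<psi> x) * y x ^ j) = 0) (at_0 N)"
    by eventually_elim (simp add: b2_sum)
  then have b2_zero: "eventually (\<lambda>X. b2 j X = 0) (at_0 N)" if "j < k" for j
    using unfold_map_independent[OF k yN b2 _ that] by simp
  have "eventually (\<lambda>X. \<forall>j\<in>{..<k}. b1 j X = 0 \<and> b2 j X = 0) (at_0 N)"
    using b1_zero b2_zero by (intro eventually_ball_finite) (auto intro: eventually_conj)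
  with l_zero show ?thesis
  proof eventually_elim
    case (elim X)
    show ?case
    proof
      fix i assume "i \<in> {1..N}"
      then consider "1 \<le> i" "i \<le> k - 2" | "k - 1 \<le> i" "i \<le> 2 * k - 3" | "i = 2 * k - 2" | "i = 2 * k - 1" by force
      then show "D X i = 0"
      proof cases
        case 1
        then have "b1 i X = 0" using elim(2) by auto
        then show ?thesis using 1 elim(1) by (simp add: b1_def)
      next
        case 2
        define m where "m = i - (k - 2)"
        have m: "m < k" "m \<noteq> 0" "k - 2 + m = i" using 2 k unfolding m_def by linarith+
        have "b2 m X = 0" using elim(2) m(1) by blast
        then show ?thesis using m unfolding b2_def by simp
      next
        case 3
        have "b1 0 X = 0" using elim(2) k by auto
        then show ?thesis using 3 elim(1) by (simp add: b1_def)
      next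
        case 4
        have "b2 0 X = 0" using elim(2) k by auto
        then show ?thesis using 4 by (simp add: b2_def)
      qed
    qed
  qed
qed

text \<open>The lifting equations hold on the graph; off the graph their errors are divisible by
  \<open>graph_eq\<close>, which defines \<open>h1\<close> and \<open>h2\<close>. Since every triple
  is attained, subtracting the corresponding combination of generators leaves a field whose defects
  come from \<open>l\<close> only.\<close>

lemma liftable_imp_module:
  assumes "liftable (2 * k - 2) N (cross_cap k) \<xi>"
  shows "\<xi> \<in> generated_module N G"
proof -
  obtain g where \<xi>: "vector_field_germ N \<xi>" and g: "analytic_germ (2 * k - 2) g" and
    ev: "eventually (\<lambda>x.
       defect1 k (\<xi> (cross_cap k x)) (y x) = dcapP k x (y x) * g x \<and>
       defect2 k (\<xi> (cross_cap k x)) (y x) = dcapQ k x (y x) * g x) (at_0 (2 * k - 2))"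
    using assms unfolding liftable_iff[OF k] by blast
  have \<xi>i: "analytic_germ N (\<lambda>x. \<xi> x i)" if "i \<in> {1..N}" for i
    using \<xi> that by (simp add: vector_field_germ_def)
  \<comment> \<open>Extends \<open>g\<close> from the graph to all of
    \<open>(u, v, y, W2)\<close>-space, independently of \<open>W2\<close>.\<close>
  define g' where "g' x = g (x(2 * k - 1 := 0))" for x
  have g': "analytic_germ N g'"
    unfolding g'_def
  proof (rule analytic_germ_compose[OF g])
    have "analytic_germ N (\<lambda>x. (x(2 * k - 1 := 0)) i)" for i by (cases "i = 2 * k - 1") auto
    moreover have "x(2 * k - 1 := 0) \<in> cspace (2 * k - 2)" if "x \<in> cspace N" for x
    proof -
      have "(x(2 * k - 1 := 0)) i = 0" if "i \<notin> {1..2*k-2}" for i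
        using that \<open>x \<in> cspace N\<close> by (cases "i = 2 * k - 1") (auto simp: cspace_def)
      then show ?thesis by (simp add: cspace_def)
    qed
    ultimately show "germ_map N (2 * k - 2) (\<lambda>x. x(2 * k - 1 := 0))" by (auto simp: germ_map_def)
  qed
  have g'_graph: "g' (graph_map k x) = g x" if "x \<in> cspace (2 * k - 2)" for x
  proof -
    have "2 * k - 1 \<notin> {1..2*k-2}" using k by simp linarith
    then have "x (2 * k - 1) = 0" using that unfolding cspace_def by blast
    then show ?thesis by (simp add: g'_def graph_map_def fun_upd_idem)
  qed
  have an: "analytic_germ N (\<lambda>x. defect1 k (\<xi> (\<psi> x)) (y x) - dcapP k x (y x) * g' x)"
    "analytic_germ N (\<lambda>x. defect2 k (\<xi> (\<psi> x)) (y x) - dcapQ k x (y x) * g' x)"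
    by (intro analytic_germ_diff analytic_germ_mult g' analytic_germ_dcapP analytic_germ_dcapQ
        analytic_germ_defects analytic_germ_psi \<xi>i analytic_germ_coord; assumption)+
  have zero: "eventually (\<lambda>x. defect1 k (\<xi> (\<psi> (graph_map k x))) (y (graph_map k x))
      - dcapP k (graph_map k x) (y (graph_map k x)) * g' (graph_map k x) = 0) (at_0 (2 * k - 2))"
    "eventually (\<lambda>x. defect2 k (\<xi> (\<psi> (graph_map k x))) (y (graph_map k x))
      - dcapQ k (graph_map k x) (y (graph_map k x)) * g' (graph_map k x) = 0) (at_0 (2 * k - 2))"
    using ev eventually_cspace
    by (eventually_elim, simp only: graph_map_simps g'_graph cross_cap_eq_unfold_graph[OF k, symmetric], simp)+
  obtain h1 where h1: "analytic_germ N h1"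
    "eventually (\<lambda>x. defect1 k (\<xi> (\<psi> x)) (y x) - dcapP k x (y x) * g' x = graph_eq x * h1 x) (at_0 N)"
    using factor_graph_eq[OF an(1) zero(1)] by blast
  obtain h2 where h2: "analytic_germ N h2"
    "eventually (\<lambda>x. defect2 k (\<xi> (\<psi> x)) (y x) - dcapQ k x (y x) * g' x = graph_eq x * h2 x) (at_0 N)"
    using factor_graph_eq[OF an(2) zero(2)] by blast
  obtain a l where a: "\<forall>\<zeta>\<in>G. analytic_germ N (a \<zeta>)" and l: "analytic_germ N l"
    and att: "eventually (attained_by a l g' h1 h2) (at_0 N)"
    using attained_all[OF g' h1(1) h2(1)] by (rule attainedE)
  \<comment> \<open>The remainder after subtracting the combination; its defects are
    \<open>- l\<close> times \<open>dcapP\<close> and \<open>dcapQ\<close>, as \<open>h1\<close> and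
    \<open>h2\<close> have been matched.\<close>
  define D where "D X i = \<xi> X i - (\<Sum>\<zeta>\<in>G. a \<zeta> X * \<zeta> X i)" for X i
  have "eventually (\<lambda>X. \<forall>i\<in>{1..N}. D X i = 0) (at_0 N)"
  proof (rule defects_determine_field[OF _ l])
    show "analytic_germ N (\<lambda>X. D X i)" if "i \<in> {1..N}" for i
      unfolding D_def
      by (intro analytic_germ_diff analytic_germ_sum analytic_germ_mult \<xi>i that a[rule_format] analytic_germ_generator)
    from h1(2) h2(2) att show "eventually (\<lambda>x. defect1 k (D (\<psi> x)) (y x) = - (l (\<psi> x) * dcapP k x (y x)) \<and>
       defect2 k (D (\<psi> x)) (y x) = - (l (\<psi> x) * dcapQ k x (y x))) (at_0 N)"
    proof eventually_elim
      case (elim x)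
      have "D (\<psi> x) = (\<lambda>i. \<xi> (\<psi> x) i - (\<Sum>\<zeta>\<in>G. a \<zeta> (\<psi> x) * \<zeta> (\<psi> x) i))" by (simp add: D_def fun_eq_iff)
      then show ?case using elim unfolding attained_by_def
        by (simp only: defect_diff defect_sum_scaled) (simp add: algebra_simps)
    qed
  qed
  then have "eventually (\<lambda>x. \<forall>i\<in>{1..N}. \<xi> x i = (\<Sum>\<zeta>\<in>G. a \<zeta> x * \<zeta> x i)) (at_0 N)"
    by eventually_elim (simp add: D_def)
  then show ?thesis unfolding generated_module_iff[OF finite_cross_cap_fields] using \<xi> a by blast
qed

end

section \<open>Vector fields tangent to the image\<close>

context cross_cap_setup begin

abbreviation "\<phi> \<equiv> cross_cap k"
abbreviation "M \<equiv> 2 * k - 2"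

lemma analytic_germ_phi: "analytic_germ N f \<Longrightarrow> analytic_germ M (\<lambda>x. f (\<phi> x))"
  by (rule analytic_germ_cross_cap[OF _ k])

text \<open>The passage from the source to the image rests on \<open>cross_cap_image_germ\<close>:
  image points close to 0 have preimages close to 0.\<close>

lemma eventually_image_iff:
  "eventually (\<lambda>X. X \<in> cross_cap_image k \<longrightarrow> P X) (at_0 N) \<longleftrightarrow> eventually (\<lambda>x. P (\<phi> x)) (at_0 M)"
proof
  assume "eventually (\<lambda>X. X \<in> cross_cap_image k \<longrightarrow> P X) (at_0 N)"
  from eventually_germ_map[OF this germ_map_cross_cap[OF k]] eventually_cspace[of M]
  show "eventually (\<lambda>x. P (\<phi> x)) (at_0 M)"
    by eventually_elim (auto simp: cross_cap_image_def)
next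
  assume "eventually (\<lambda>x. P (\<phi> x)) (at_0 M)"
  then obtain r where r: "r > 0" "\<And>x. x \<in> polydisc M r \<Longrightarrow> P (\<phi> x)"
    by (auto simp: eventually_at_0)
  obtain s where "s > 0" "cross_cap_image k \<inter> polydisc N s \<subseteq> \<phi> ` polydisc M r"
    using cross_cap_image_germ[OF k r(1)] by blast
  then show "eventually (\<lambda>X. X \<in> cross_cap_image k \<longrightarrow> P X) (at_0 N)"
    unfolding eventually_at_0 using r(2) by (intro exI[of _ s]) auto
qed

lemma vanishing_ideal_iff:
  "h \<in> vanishing_ideal N (cross_cap_image k) \<longleftrightarrow> analytic_germ N h \<and> eventually (\<lambda>x. h (\<phi> x) = 0) (at_0 M)"
  unfolding vanishing_ideal_def near_0_eventually eventually_image_iff mem_Collect_eq ..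

lemma cross_cap_holomorphic: "(\<lambda>t. \<phi> (x(l := t)) i) holomorphic_on S"
proof -
  have c: "(\<lambda>t. (x(l := t)) j) holomorphic_on S" for j
    by (cases "j = l") (auto intro: holomorphic_intros)
  show ?thesis
    unfolding cross_cap_coord[OF k] capP_def capQ_def
    by (cases "1 \<le> i \<and> i \<le> 2 * k - 3"; cases "i = 2 * k - 2"; cases "i = 2 * k - 1";
        simp only: if_True if_False simp_thms; intro holomorphic_intros c)
qed

text \<open>Differentiate \<open>h \<circ> \<phi> = 0\<close>.\<close>

lemma ideal_gradient:
  assumes "h \<in> vanishing_ideal N (cross_cap_image k)"
  shows "eventually (\<lambda>x. \<forall>e. (\<Sum>i=1..N. partial_deriv i h (\<phi> x) *
     (\<Sum>l=1..M. partial_deriv l (\<lambda>z. \<phi> z i) x * e l)) = 0) (at_0 M)"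
proof -
  have h: "analytic_germ N h" and ev: "eventually (\<lambda>x. h (\<phi> x) = 0) (at_0 M)"
    using assms unfolding vanishing_ideal_iff by blast+
  obtain r where r: "r > 0" and chain: "\<And>S \<gamma> t. holo_curve N r S \<gamma> \<Longrightarrow> t \<in> S \<Longrightarrow>
      ((\<lambda>t. h (\<gamma> t)) has_field_derivative
         (\<Sum>i=1..N. partial_deriv i h (\<gamma> t) * deriv (\<lambda>t. \<gamma> t i) t)) (at t)"
    using analytic_germ_curve[OF h] by blast
  have "eventually (\<lambda>x. \<phi> x \<in> polydisc N r) (at_0 M)"
    by (rule eventually_germ_map[OF eventually_polydisc[OF r] germ_map_cross_cap[OF k]])
  from eventually_conj[OF this ev] obtain \<rho> where \<rho>: "\<rho> > 0"
    "\<And>x. x \<in> polydisc M \<rho> \<Longrightarrow> \<phi> x \<in> polydisc N r" "\<And>x. x \<in> polydisc M \<rho> \<Longrightarrow> h (\<phi> x) = 0"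
    unfolding eventually_at_0 by blast
  have zero: "(\<Sum>i=1..N. partial_deriv i h (\<phi> x) * partial_deriv l (\<lambda>z. \<phi> z i) x) = 0"
    if x: "x \<in> polydisc M \<rho>" and l: "l \<in> {1..M}" for x l
  proof -
    have xl: "x l \<in> ball 0 \<rho>" using polydisc_norm[OF x \<rho>(1)] by simp
    have upd: "x(l := t) \<in> polydisc M \<rho>" if "t \<in> ball 0 \<rho>" for t
      using polydisc_update[OF x l] that by simp
    have "((\<lambda>t. h (\<phi> (x(l := t)))) has_field_derivative
         (\<Sum>i=1..N. partial_deriv i h (\<phi> (x(l := x l))) * deriv (\<lambda>t. \<phi> (x(l := t)) i) (x l))) (at (x l))"
      using cross_cap_holomorphic \<rho>(2)[OF upd] by (intro chain[of "ball 0 \<rho>"] xl) (auto simp: holo_curve_def)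
    moreover have "((\<lambda>t. h (\<phi> (x(l := t)))) has_field_derivative 0) (at (x l))"
      by (rule has_field_derivative_transform_within_open[OF DERIV_const[of 0] open_ball xl])
         (simp add: \<rho>(3)[OF upd])
    ultimately show ?thesis
      using DERIV_unique unfolding partial_deriv_def fun_upd_triv by blast
  qed
  have "(\<Sum>i=1..N. partial_deriv i h (\<phi> x) * (\<Sum>l=1..M. partial_deriv l (\<lambda>z. \<phi> z i) x * e l)) = 0"
    if x: "x \<in> polydisc M \<rho>" for x e
  proof -
    have "(\<Sum>i=1..N. partial_deriv i h (\<phi> x) * (\<Sum>l=1..M. partial_deriv l (\<lambda>z. \<phi> z i) x * e l)) =
      (\<Sum>l=1..M. e l * (\<Sum>i=1..N. partial_deriv i h (\<phi> x) * partial_deriv l (\<lambda>z. \<phi> z i) x))"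
      unfolding sum_distrib_left by (subst sum.swap) (simp add: mult_ac)
    also have "\<dots> = 0" using zero[OF x] by (intro sum.neutral) simp
    finally show ?thesis .
  qed
  then show ?thesis using \<rho>(1) unfolding eventually_at_0 by blast
qed

lemma analytic_germ_apply_field:
  assumes "vector_field_germ N \<xi>" "analytic_germ N h"
  shows "analytic_germ N (apply_field N \<xi> h)"
proof -
  have "analytic_germ N (\<lambda>x. \<Sum>i=1..N. \<xi> x i * partial_deriv i h x)"
    using assms by (intro analytic_germ_sum analytic_germ_mult analytic_germ_partial_deriv)
      (auto simp: vector_field_germ_def)
  then show ?thesis by (simp add: apply_field_def[abs_def])
qed

text \<open>Along the image a liftable field is a value of the differential of
  \<open>cross_cap\<close>, and the gradient of any \<open>h\<close> in the ideal annihilates such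
  values.\<close>

lemma liftable_imp_Derlog:
  assumes "liftable M N \<phi> \<xi>"
  shows "\<xi> \<in> Derlog N (cross_cap_image k)"
proof -
  obtain \<eta> where \<xi>: "vector_field_germ N \<xi>" and
    ev: "eventually (\<lambda>x. \<forall>i\<in>{1..N}. (\<Sum>l=1..M. partial_deriv l (\<lambda>z. \<phi> z i) x * \<eta> x l) = \<xi> (\<phi> x) i) (at_0 M)"
    using assms by (auto simp: liftable_def near_0_eventually)
  have "apply_field N \<xi> h \<in> vanishing_ideal N (cross_cap_image k)"
    if h: "h \<in> vanishing_ideal N (cross_cap_image k)" for h
  proof -
    have "analytic_germ N (apply_field N \<xi> h)"
      using analytic_germ_apply_field[OF \<xi>] h unfolding vanishing_ideal_iff by blast
    moreover from ev ideal_gradient[OF h] have "eventually (\<lambda>x. apply_field N \<xi> h (\<phi> x) = 0) (at_0 M)"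
    proof eventually_elim
      case (elim x)
      have "apply_field N \<xi> h (\<phi> x) = (\<Sum>i=1..N. partial_deriv i h (\<phi> x) * (\<Sum>l=1..M. partial_deriv l (\<lambda>z. \<phi> z i) x * \<eta> x l))"
        unfolding apply_field_def
      proof (intro sum.cong refl)
        fix i assume "i \<in> {1..N}"
        with elim(1) have "(\<Sum>l=1..M. partial_deriv l (\<lambda>z. \<phi> z i) x * \<eta> x l) = \<xi> (\<phi> x) i" by blast
        then show "\<xi> (\<phi> x) i * partial_deriv i h (\<phi> x) =
            partial_deriv i h (\<phi> x) * (\<Sum>l=1..M. partial_deriv l (\<lambda>z. \<phi> z i) x * \<eta> x l)"
          by (simp only: mult.commute)
      qed
      then show ?case using elim(2) by simp
    qed
    ultimately show ?thesis unfolding vanishing_ideal_iff by blast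
  qed
  then show ?thesis using \<xi> by (simp add: Derlog_def)
qed

text \<open>The matrix of multiplication by \<open>Q\<close> on the free module with basis \<open>1, y, \<dots>, y\<^bsup>k-1\<^esup>\<close>. Its
  characteristic polynomial at \<open>W\<^sub>2\<close> is an equation of the image.\<close>

definition mult_matrix :: "(nat \<Rightarrow> complex) \<Rightarrow> complex mat" where
  "mult_matrix X = Matrix.mat k k (\<lambda>(i, j). \<Sum>r=1..k-1. X (k - 2 + r) * power_rem k X (r + i) j)"

text \<open>The \<open>m\<close>-th \<open>W2\<close>-derivative of the characteristic equation.
  Since \<open>mult_matrix\<close> does not involve \<open>W2\<close>, it may be taken on the level
  of polynomials.\<close>

definition image_eq :: "nat \<Rightarrow> (nat \<Rightarrow> complex) \<Rightarrow> complex" where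
  "image_eq m X = poly ((pderiv ^^ m) (char_poly (mult_matrix X))) (X (2 * k - 1))"

lemma mult_matrix_carrier: "mult_matrix X \<in> carrier_mat k k"
  by (simp add: mult_matrix_def)

lemma power_rem_update: "l \<noteq> 2 * k - 2 \<Longrightarrow> l > k - 2 \<Longrightarrow> power_rem k (X(l := t)) m j = power_rem k X m j"
proof (induction m rule: less_induct)
  case (less m)
  show ?case
  proof (cases "m < k \<or> k = 0")
    case True
    then show ?thesis by (simp add: power_rem_less)
  next
    case False
    have IH: "power_rem k (X(l := t)) (m - k + i) j = power_rem k X (m - k + i) j" if "i < k" for i
      using False that less.prems by (intro less) auto
    have "(\<Sum>i=1..k-2. (X(l := t)) i * power_rem k (X(l := t)) (m - k + i) j) = (\<Sum>i=1..k-2. X i * power_rem k X (m - k + i) j)"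
    proof (intro sum.cong refl)
      fix i assume "i \<in> {1..k-2}"
      then have "i < k" "i \<noteq> l" using less.prems by auto
      then show "(X(l := t)) i * power_rem k (X(l := t)) (m - k + i) j = X i * power_rem k X (m - k + i) j"
        using IH by simp
    qed
    then show ?thesis
      unfolding power_rem_step[OF False] using IH[of 0] less.prems(1) k by simp
  qed
qed

lemma mult_matrix_update: "mult_matrix (X(2 * k - 1 := t)) = mult_matrix X"
proof -
  have "2 * k - 1 \<noteq> 2 * k - 2" "k - 2 < 2 * k - 1" using k by linarith+
  note p = power_rem_update[OF this]
  have "(X(2 * k - 1 := t)) (k - 2 + r) = X (k - 2 + r)" if "r \<in> {1..k-1}" for r
  proof -
    have "k - 2 + r \<noteq> 2 * k - 1" using that k by auto
    then show ?thesis by simp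
  qed
  then show ?thesis unfolding mult_matrix_def p by (auto intro!: eq_matI sum.cong)
qed

lemma analytic_germ_mult_matrix:
  "i < k \<Longrightarrow> j < k \<Longrightarrow> analytic_germ n (\<lambda>X. mult_matrix X $$ (i, j))"
  unfolding mult_matrix_def by (auto intro!: analytic_germ_intros analytic_germ_power_rem)

text \<open>Leibniz's expansion of the determinant presents the equation as a polynomial expression
  in \<open>W2\<close> and the analytic matrix entries.\<close>

lemma analytic_germ_image_eq_0: "analytic_germ n (image_eq 0)"
proof -
  have "image_eq 0 X = (\<Sum>p\<in>{p. p permutes {0..<k}}. signof p * (\<Prod>i=0..<k.
      (if i = p i then X (2 * k - 1) else 0) - mult_matrix X $$ (i, p i)))" for X
  proof -
    define A where "A = - char_matrix (mult_matrix X) (X (2 * k - 1))"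
    have A: "A \<in> carrier_mat k k" using mult_matrix_carrier[of X] by (simp add: A_def char_matrix_def)
    have "image_eq 0 X = Determinant.det A"
      unfolding image_eq_def A_def using char_poly_matrix[OF mult_matrix_carrier] by simp
    also have "\<dots> = (\<Sum>p\<in>{p. p permutes {0..<k}}. signof p * (\<Prod>i=0..<k. A $$ (i, p i)))"
      using A unfolding Determinant.det_def by auto
    also have "\<dots> = (\<Sum>p\<in>{p. p permutes {0..<k}}. signof p * (\<Prod>i=0..<k.
      (if i = p i then X (2 * k - 1) else 0) - mult_matrix X $$ (i, p i)))"
    proof (intro sum.cong refl arg_cong2[where f = times] prod.cong)
      fix p i assume p: "p \<in> {p. p permutes {0..<k}}" and i: "i \<in> {0..<k}"
      then have "p i < k" using permutes_in_image[of p "{0..<k}" i] by auto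
      then show "A $$ (i, p i) = (if i = p i then X (2 * k - 1) else 0) - mult_matrix X $$ (i, p i)"
        using i mult_matrix_carrier[of X] by (auto simp: A_def char_matrix_def)
    qed
    finally show ?thesis .
  qed
  moreover have "analytic_germ n (\<lambda>X. \<Sum>p\<in>{p. p permutes {0..<k}}. signof p * (\<Prod>i=0..<k.
      (if i = p i then X (2 * k - 1) else 0) - mult_matrix X $$ (i, p i)))"
  proof (intro analytic_germ_sum analytic_germ_mult analytic_germ_const analytic_germ_prod analytic_germ_diff)
    fix p i assume "p \<in> {p. p permutes {0..<k}}" "i \<in> {0..<k}"
    then have "i < k" "p i < k" using permutes_in_image[of p "{0..<k}" i] by auto
    then show "analytic_germ n (\<lambda>X. mult_matrix X $$ (i, p i))" by (rule analytic_germ_mult_matrix)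
    show "analytic_germ n (\<lambda>X. if i = p i then X (2 * k - 1) else 0)" by (cases "i = p i") auto
  qed
  ultimately show ?thesis by presburger
qed

lemma partial_deriv_image_eq: "partial_deriv (2 * k - 1) (image_eq m) X = image_eq (Suc m) X"
  unfolding partial_deriv_def image_eq_def mult_matrix_update
  by (simp add: DERIV_imp_deriv[OF poly_DERIV])

lemma analytic_germ_image_eq: "analytic_germ N (image_eq m)"
proof (induction m)
  case 0
  show ?case by (rule analytic_germ_image_eq_0)
next
  case (Suc m)
  have "2 * k - 1 \<in> {1..N}" using k by auto
  from analytic_germ_partial_deriv[OF Suc this]
  have "analytic_germ N (partial_deriv (2 * k - 1) (image_eq m))" .
  moreover have "partial_deriv (2 * k - 1) (image_eq m) = image_eq (Suc m)"
    by (rule ext) (rule partial_deriv_image_eq)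
  ultimately show ?case by (simp only:)
qed

text \<open>Row \<open>i\<close> of the matrix contains the remainder of \<open>Q * y ^ i\<close>;
  hence at a point of the image the vector of powers of the source coordinate \<open>y\<close> is an
  eigenvector with eigenvalue \<open>Q\<close>, which is the value of \<open>W2\<close>
  there.\<close>

lemma image_eq_0_vanishes:
  assumes "x \<in> cspace M"
  shows "image_eq 0 (\<phi> x) = 0"
proof -
  let ?X = "\<phi> x" and ?y = "y x"
  have P: "capP k ?X ?y = ?X (2 * k - 2)"
    using unfold_map_eq[OF k, of "graph_map k x"]
    unfolding cross_cap_eq_unfold_graph[OF k assms, symmetric] graph_map_simps .
  have Xv: "?X (k - 2 + r) = x (k - 2 + r)" if "r \<in> {1..k-1}" for r
  proof -
    have "1 \<le> k - 2 + r" "k - 2 + r \<le> 2 * k - 3" using that k by auto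
    then show ?thesis by (rule cross_cap_coords(1)[OF k])
  qed
  define v where "v = Matrix.vec k (\<lambda>j. ?y ^ j)"
  have "mult_matrix ?X *\<^sub>v v = capQ k x ?y \<cdot>\<^sub>v v"
  proof (rule eq_vecI)
    fix i assume "i < dim_vec (capQ k x ?y \<cdot>\<^sub>v v)"
    then have i: "i < k" by (simp add: v_def)
    have "vec_index (mult_matrix ?X *\<^sub>v v) i = (\<Sum>j<k. (\<Sum>r=1..k-1. ?X (k - 2 + r) * power_rem k ?X (r + i) j) * ?y ^ j)"
      using i by (simp add: mult_matrix_def v_def scalar_prod_def atLeast0LessThan)
    also have "\<dots> = (\<Sum>r=1..k-1. ?X (k - 2 + r) * (\<Sum>j<k. power_rem k ?X (r + i) j * ?y ^ j))"
      unfolding sum_distrib_right sum_distrib_left by (subst sum.swap) (simp add: mult.assoc)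
    also have "\<dots> = (\<Sum>r=1..k-1. x (k - 2 + r) * ?y ^ (r + i))"
      by (intro sum.cong refl) (simp only: Xv power_eq_power_rem[where x = ?X, OF k P, symmetric])
    also have "\<dots> = capQ k x ?y * ?y ^ i"
      by (simp add: capQ_def sum_distrib_right power_add mult.assoc)
    finally show "vec_index (mult_matrix ?X *\<^sub>v v) i = vec_index (capQ k x ?y \<cdot>\<^sub>v v) i"
      using i by (simp add: v_def)
  qed (simp add: v_def mult_matrix_def)
  moreover have "v \<noteq> 0\<^sub>v k"
  proof
    assume "v = 0\<^sub>v k"
    then have "vec_index v 0 = vec_index (0\<^sub>v k) 0" by simp
    then show False using k by (simp add: v_def)
  qed
  ultimately have "eigenvalue (mult_matrix ?X) (capQ k x ?y)"
    unfolding eigenvalue_def eigenvector_def using mult_matrix_carrier[of ?X]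
    by (intro exI[of _ v]) (auto simp: v_def)
  then have "poly (char_poly (mult_matrix ?X)) (capQ k x ?y) = 0"
    unfolding eigenvalue_root_char_poly[OF mult_matrix_carrier] .
  moreover have "?X (2 * k - 1) = capQ k x ?y" by (rule cross_cap_coords(3)[OF k])
  ultimately show ?thesis by (simp only: image_eq_def funpow_0)
qed

text \<open>The characteristic polynomial is monic of degree \<open>k\<close>, so its
  \<open>k\<close>-th derivative is a nonzero constant. This bounds the search for a derivative that
  does not vanish on the image.\<close>

lemma image_eq_top: "image_eq k X \<noteq> 0"
proof -
  let ?p = "char_poly (mult_matrix X)"
  have "degree ((pderiv ^^ m) ?p) = k - m \<and> (pderiv ^^ m) ?p \<noteq> 0" if "m \<le> k" for m
    using that
  proof (induction m)
    case 0
    then show ?case using degree_monic_char_poly[OF mult_matrix_carrier[of X]] k by auto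
  next
    case (Suc m)
    then have IH: "degree ((pderiv ^^ m) ?p) = k - m" "k - m \<noteq> 0" by auto
    then have "pderiv ((pderiv ^^ m) ?p) \<noteq> 0" by (simp add: pderiv_eq_0_iff)
    then show ?case using IH by (simp add: degree_pderiv)
  qed
  then have "degree ((pderiv ^^ k) ?p) = 0" "(pderiv ^^ k) ?p \<noteq> 0" by auto
  then obtain c where "(pderiv ^^ k) ?p = [:c:]" "c \<noteq> 0" by (metis degree_eq_zeroE pCons_0_0)
  then show ?thesis unfolding image_eq_def by simp
qed

lemma at_0_nontrivial: "\<not> eventually (\<lambda>_. False) (at_0 n)"
  using zero_in_polydisc by (auto simp: eventually_at_0)

text \<open>The highest \<open>W\<^sub>2\<close>-derivative of the equation that vanishes on the image.\<close>

lemma separating_function: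
  obtains h where "h \<in> vanishing_ideal N (cross_cap_image k)"
    "\<not> eventually (\<lambda>x. partial_deriv (2 * k - 1) h (\<phi> x) = 0) (at_0 M)"
proof -
  let ?Z = "\<lambda>m. eventually (\<lambda>x. image_eq m (\<phi> x) = 0) (at_0 M)"
  define m where "m = (LEAST m. \<not> ?Z m)"
  have "\<not> ?Z k" using image_eq_top at_0_nontrivial[of M] by simp
  then have m: "\<not> ?Z m" unfolding m_def by (rule LeastI)
  have "?Z 0" using eventually_cspace by (rule eventually_mono) (rule image_eq_0_vanishes)
  then obtain m' where m': "m = Suc m'" using m by (cases m) auto
  then have "?Z m'" using not_less_Least[of m' "\<lambda>m. \<not> ?Z m"] unfolding m_def by auto
  then have "image_eq m' \<in> vanishing_ideal N (cross_cap_image k)"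
    unfolding vanishing_ideal_iff using analytic_germ_image_eq by blast
  moreover have "\<not> eventually (\<lambda>x. partial_deriv (2 * k - 1) (image_eq m') (\<phi> x) = 0) (at_0 M)"
    unfolding partial_deriv_image_eq using m unfolding m' .
  ultimately show ?thesis by (rule that)
qed

lemma sum_target_split:
  fixes f :: "nat \<Rightarrow> complex"
  shows "(\<Sum>i=1..N. f i) = (\<Sum>i=1..2*k-3. f i) + f (2 * k - 2) + f (2 * k - 1)"
proof -
  have "{1..N} = insert (2 * k - 1) (insert (2 * k - 2) {1..2*k-3})" using k by auto
  moreover have "2 * k - 1 \<noteq> 2 * k - 2" "2 * k - 2 \<notin> {1..2*k-3}" "2 * k - 1 \<notin> {1..2*k-3}" using k by auto
  ultimately show ?thesis by simp
qed

text \<open>The gradient of \<open>h\<close> on the image is orthogonal to \<open>\<xi>\<close> and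
  to all values of the differential. Eliminating its other components leaves the cross difference
  times the \<open>W2\<close>-derivative of \<open>h\<close>, and this derivative cancels because
  the germs form a domain.\<close>

lemma Derlog_cross_relation:
  assumes "\<xi> \<in> Derlog N (cross_cap_image k)"
  shows "eventually (\<lambda>x. defect1 k (\<xi> (\<phi> x)) (y x) * dcapQ k x (y x) = defect2 k (\<xi> (\<phi> x)) (y x) * dcapP k x (y x)) (at_0 M)"
proof -
  have \<xi>: "vector_field_germ N \<xi>" and tangent: "\<And>h. h \<in> vanishing_ideal N (cross_cap_image k) \<Longrightarrow>
      apply_field N \<xi> h \<in> vanishing_ideal N (cross_cap_image k)"
    using assms by (auto simp: Derlog_def)
  obtain h where h: "h \<in> vanishing_ideal N (cross_cap_image k)"
    and sep: "\<not> eventually (\<lambda>x. partial_deriv (2 * k - 1) h (\<phi> x) = 0) (at_0 M)"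
    by (rule separating_function)
  have an_h: "analytic_germ N h" using h unfolding vanishing_ideal_iff by blast
  let ?F = "\<lambda>x. defect1 k (\<xi> (\<phi> x)) (y x) * dcapQ k x (y x) - defect2 k (\<xi> (\<phi> x)) (y x) * dcapP k x (y x)"
  have "eventually (\<lambda>x. apply_field N \<xi> h (\<phi> x) = 0) (at_0 M)"
    using tangent[OF h] unfolding vanishing_ideal_iff by blast
  with ideal_gradient[OF h] have "eventually (\<lambda>x. partial_deriv (2 * k - 1) h (\<phi> x) * ?F x = 0) (at_0 M)"
  proof eventually_elim
    case (elim x)
    define a where "a i = partial_deriv i h (\<phi> x)" for i
    define c where "c = \<xi> (\<phi> x)"
    have grad: "(\<Sum>i=1..N. a i * (\<Sum>l=1..M. partial_deriv l (\<lambda>z. \<phi> z i) x * e l)) = 0" for e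
      using elim(1) by (simp only: a_def)
    have ac: "(\<Sum>i=1..2*k-3. a i * c i) + a (2 * k - 2) * c (2 * k - 2) + a (2 * k - 1) * c (2 * k - 1) = 0"
      using elim(2) unfolding apply_field_def sum_target_split by (simp add: a_def c_def mult.commute)
    have J1: "(\<Sum>i=1..2*k-3. a i * (\<Sum>l=1..M. partial_deriv l (\<lambda>z. \<phi> z i) x * e l)) = (\<Sum>i=1..2*k-3. a i * e i)" for e
      by (intro sum.cong refl) (simp only: atLeastAtMost_iff jacobian_cross_cap(1)[OF k])
    \<comment> \<open>A source vector with the \<open>u\<close>- and \<open>v\<close>-components of
      the field and no \<open>y\<close>-component; its image differs from the field by the two
      defects only.\<close>
    define e1 where "e1 l = (if l = 2 * k - 2 then 0 else c l)" for l
    have ne: "l \<in> {1..2*k-3} \<Longrightarrow> l \<noteq> 2 * k - 2" "l \<in> {1..k-2} \<Longrightarrow> l \<noteq> 2 * k - 2"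
      "l \<in> {1..k-1} \<Longrightarrow> k - 2 + l \<noteq> 2 * k - 2" for l using k by auto
    have "(\<Sum>i=1..2*k-3. a i * e1 i) = (\<Sum>i=1..2*k-3. a i * c i)"
      "(\<Sum>l=1..k-2. e1 l * y x ^ l) = (\<Sum>l=1..k-2. c l * y x ^ l)"
      "(\<Sum>l=1..k-1. e1 (k - 2 + l) * y x ^ l) = (\<Sum>l=1..k-1. c (k - 2 + l) * y x ^ l)"
      unfolding e1_def by (intro sum.cong refl; simp only: ne if_False)+
    moreover have "e1 (2 * k - 2) = 0" by (simp add: e1_def)
    ultimately have "(\<Sum>i=1..2*k-3. a i * c i) + a (2 * k - 2) * (\<Sum>l=1..k-2. c l * y x ^ l)
        + a (2 * k - 1) * (\<Sum>l=1..k-1. c (k - 2 + l) * y x ^ l) = 0"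
      using grad[of e1] unfolding sum_target_split J1 jacobian_cross_cap(2,3)[OF k] by simp
    note this_rel = this
    have lin: "p * (u - v) + q * (w - z) = 0" if "s + p * u + q * w = 0" "s + p * v + q * z = 0"
      for s p u v q w z :: complex
    proof -
      have "p * (u - v) + q * (w - z) = (s + p * u + q * w) - (s + p * v + q * z)" by (simp add: algebra_simps)
      then show ?thesis using that by simp
    qed
    have E: "a (2 * k - 2) * defect1 k c (y x) + a (2 * k - 1) * defect2 k c (y x) = 0"
      unfolding defect1_def defect2_def by (rule lin[OF ac this_rel])
    \<comment> \<open>The unit vector in direction \<open>y\<close>, whose image has the components
      \<open>dcapP\<close> and \<open>dcapQ\<close>.\<close>
    define e2 where "e2 l = (if l = 2 * k - 2 then 1 else 0 :: complex)" for l
    have "(\<Sum>i=1..2*k-3. a i * e2 i) = 0"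
      "(\<Sum>l=1..k-2. e2 l * y x ^ l) = 0"
      "(\<Sum>l=1..k-1. e2 (k - 2 + l) * y x ^ l) = 0"
      unfolding e2_def by (intro sum.neutral ballI; simp only: ne if_False mult_zero_left mult_zero_right)+
    moreover have "e2 (2 * k - 2) = 1" by (simp add: e2_def)
    ultimately have R: "a (2 * k - 2) * dcapP k x (y x) + a (2 * k - 1) * dcapQ k x (y x) = 0"
      using grad[of e2] unfolding sum_target_split J1 jacobian_cross_cap(2,3)[OF k] by simp
    \<comment> \<open>Eliminates the \<open>W1\<close>-derivative \<open>a (2 * k - 2)\<close> from
      the relations \<open>E\<close> and \<open>R\<close>.\<close>
    have "a (2 * k - 1) * (defect1 k c (y x) * dcapQ k x (y x) - defect2 k c (y x) * dcapP k x (y x)) =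
       defect1 k c (y x) * (a (2 * k - 2) * dcapP k x (y x) + a (2 * k - 1) * dcapQ k x (y x))
       - dcapP k x (y x) * (a (2 * k - 2) * defect1 k c (y x) + a (2 * k - 1) * defect2 k c (y x))"
      by (simp add: algebra_simps)
    then show ?case using E R by (simp add: a_def c_def)
  qed
  moreover have "analytic_germ M (\<lambda>x. partial_deriv (2 * k - 1) h (\<phi> x))"
    using k by (intro analytic_germ_phi analytic_germ_partial_deriv an_h) auto
  moreover have "analytic_germ M ?F"
    using \<xi> by (intro analytic_germ_diff analytic_germ_mult analytic_germ_dcapP analytic_germ_dcapQ
        analytic_germ_defects analytic_germ_phi analytic_germ_coord) (auto simp: vector_field_germ_def)
  ultimately have "eventually (\<lambda>x. ?F x = 0) (at_0 M)"
    using analytic_germ_domain[of M "\<lambda>x. partial_deriv (2 * k - 1) h (\<phi> x)" ?F] sep by blast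
  then show ?thesis by (rule eventually_mono) simp
qed

text \<open>\<open>dcapP, dcapQ\<close> is a regular sequence: \<open>dcapQ\<close> can replace the coordinate \<open>v\<^sub>1\<close>, on which \<open>dcapP\<close> does
  not depend.\<close>

lemma cross_relation_quotient:
  assumes E1: "analytic_germ M E1" and E2: "analytic_germ M E2"
    and rel: "eventually (\<lambda>x. E1 x * dcapQ k x (y x) = E2 x * dcapP k x (y x)) (at_0 M)"
  obtains g where "analytic_germ M g"
    "eventually (\<lambda>x. E1 x = dcapP k x (y x) * g x \<and> E2 x = dcapQ k x (y x) * g x) (at_0 M)"
proof -
  \<comment> \<open>The part of \<open>dcapQ\<close> without \<open>v_1\<close>, which is the source
    coordinate \<open>k - 1\<close>. As \<open>R\<close> does not depend on this coordinate, the
    shears by \<open>R\<close> and \<open>- R\<close> are inverse to each other.\<close>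
  define R where "R x = (\<Sum>i=2..k-1. of_nat i * x (k - 2 + i) * y x ^ (i - 1))" for x :: "nat \<Rightarrow> complex"
  define shear where "shear s x = x(k - 1 := x (k - 1) + s * R x)" for s and x :: "nat \<Rightarrow> complex"
  have v1: "k - 1 \<in> {1..M}" "k - 1 \<noteq> 2 * k - 2" "k - 1 > k - 2" using k by auto
  have R_upd: "R (x(k - 1 := t)) = R x" for x t
    unfolding R_def using v1 k by (intro sum.cong refl) auto
  have Q: "dcapQ k x (y x) = x (k - 1) + R x" for x
  proof -
    have "{1..k-1} = insert 1 {2..k-1}" using k by auto
    moreover have "k - 2 + 1 = k - 1" using k by simp
    ultimately show ?thesis unfolding dcapQ_def R_def by (simp del: One_nat_def) simp
  qed
  have an_R: "analytic_germ M R" unfolding R_def[abs_def] by (intro analytic_germ_intros)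
  have shear: "germ_map M M (shear s)" for s
    unfolding shear_def[abs_def]
    by (intro germ_map_update v1 analytic_germ_intros an_R) (simp_all add: R_def)
  have shear_y: "y (shear s x) = y x" "dcapP k (shear s x) t = dcapP k x t" for s x t
    using v1 k by (simp_all add: shear_def)
  have inv: "shear (-1) (shear 1 x) = x" "shear 1 x (k - 1) = dcapQ k x (y x)" for x
    by (simp_all add: shear_def R_upd Q del: One_nat_def)
  have Q_shear: "dcapQ k (shear (-1) x) (y x) = x (k - 1)" for x
    using Q[of "shear (-1) x"] by (simp add: shear_y) (simp add: shear_def R_upd del: One_nat_def)
  define F1 F2 where "F1 x = E1 (shear (-1) x)" and "F2 x = E2 (shear (-1) x)" for x
  have an: "analytic_germ M F1" "analytic_germ M F2" unfolding F1_def F2_def by (intro analytic_germ_compose[OF _ shear] E1 E2)+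
  have rel': "eventually (\<lambda>x. F1 x * x (k - 1) = F2 x * dcapP k x (y x)) (at_0 M)"
    using eventually_germ_map[OF rel shear[of "-1"]] by (simp only: F1_def F2_def shear_y Q_shear)
  have P_nz: "\<not> eventually (\<lambda>x. dcapP k x (y x) = 0) (at_0 M)"
  proof
    assume "eventually (\<lambda>x. dcapP k x (y x) = 0) (at_0 M)"
    then obtain r where r: "r > 0" "\<And>x. x \<in> polydisc M r \<Longrightarrow> dcapP k x (y x) = 0" by (auto simp: eventually_at_0)
    have "2 * k - 2 \<in> {1..M}" using k by auto
    then have "(\<lambda>_. 0)(2 * k - 2 := of_real (r / 2)) \<in> polydisc M r"
      using r(1) by (intro polydisc_update zero_in_polydisc) auto
    from r(2)[OF this] have "dcapP k ((\<lambda>_. 0)(2 * k - 2 := of_real (r / 2))) (of_real (r / 2)) = 0" by simp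
    moreover have "k - 2 < 2 * k - 2" using k by linarith
    ultimately have "dcapP k (\<lambda>_. 0) (of_real (r / 2)) = 0" using k by simp
    then show False using r(1) k by (simp add: dcapP_def)
  qed
  have v_nz: "\<not> eventually (\<lambda>x. x (k - 1) = 0) (at_0 M)"
  proof
    assume "eventually (\<lambda>x. x (k - 1) = 0) (at_0 M)"
    then obtain r where r: "r > 0" "\<And>x. x \<in> polydisc M r \<Longrightarrow> x (k - 1) = 0" by (auto simp: eventually_at_0)
    have "(\<lambda>_. 0)(k - 1 := of_real (r / 2)) \<in> polydisc M r"
      using r(1) v1 by (intro polydisc_update zero_in_polydisc) auto
    from r(2)[OF this] show False using r(1) by simp
  qed
  \<comment> \<open>At \<open>v_1 = 0\<close> the relation reads \<open>F2 * dcapP = 0\<close>,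
    while \<open>dcapP\<close> is unaffected; hence \<open>F2\<close> vanishes there and is
    divisible by \<open>v_1\<close>.\<close>
  define restr where "restr x = x(k - 1 := 0)" for x :: "nat \<Rightarrow> complex"
  have restr: "germ_map M M restr"
    unfolding restr_def[abs_def] by (intro germ_map_update v1) simp_all
  have "y (restr x) = y x" "dcapP k (restr x) t = dcapP k x t" "restr x (k - 1) = 0" for x t
    using v1 k by (simp_all add: restr_def)
  with eventually_germ_map[OF rel' restr]
  have "eventually (\<lambda>x. F2 (restr x) * dcapP k x (y x) = 0) (at_0 M)" by simp
  then have F2_restr: "eventually (\<lambda>x. F2 (restr x) = 0) (at_0 M)"
    using analytic_germ_domain[OF analytic_germ_compose[OF an(2) restr] analytic_germ_dcapP] P_nz by blast
  have "eventually (\<lambda>x. x (k - 1) = 0 \<longrightarrow> F2 x = 0) (at_0 M)"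
    using F2_restr by (rule eventually_mono) (metis restr_def fun_upd_triv)
  from analytic_germ_factor_coord[OF an(2) v1(1) this]
  obtain G' where G': "analytic_germ M G'" "eventually (\<lambda>x. F2 x = x (k - 1) * G' x) (at_0 M)" by blast
  \<comment> \<open>After inserting \<open>F2 = v_1 * G'\<close>, the factor \<open>v_1\<close>
    cancels and \<open>F1 = dcapP * G'\<close> with the same quotient.\<close>
  from rel' G'(2) have "eventually (\<lambda>x. x (k - 1) * (F1 x - dcapP k x (y x) * G' x) = 0) (at_0 M)"
    by eventually_elim (simp add: algebra_simps)
  moreover have "analytic_germ M (\<lambda>x. F1 x - dcapP k x (y x) * G' x)"
    by (intro analytic_germ_diff analytic_germ_mult an G' analytic_germ_dcapP)
  ultimately have "eventually (\<lambda>x. F1 x - dcapP k x (y x) * G' x = 0) (at_0 M)"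
    using analytic_germ_domain[OF analytic_germ_coord[of M "k - 1"]] v_nz by blast
  from eventually_germ_map[OF eventually_conj[OF this G'(2)] shear[of 1]]
  have "eventually (\<lambda>x. E1 x = dcapP k x (y x) * G' (shear 1 x) \<and> E2 x = dcapQ k x (y x) * G' (shear 1 x)) (at_0 M)"
    by (simp add: F1_def F2_def inv shear_y del: One_nat_def)
  then show ?thesis using that analytic_germ_compose[OF G'(1) shear] by blast
qed

lemma Derlog_imp_liftable:
  assumes "\<xi> \<in> Derlog N (cross_cap_image k)"
  shows "liftable M N \<phi> \<xi>"
proof -
  have \<xi>: "vector_field_germ N \<xi>" using assms by (simp add: Derlog_def)
  have "analytic_germ M (\<lambda>x. defect1 k (\<xi> (\<phi> x)) (y x))" "analytic_germ M (\<lambda>x. defect2 k (\<xi> (\<phi> x)) (y x))"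
    using \<xi> by (auto intro!: analytic_germ_defects analytic_germ_phi simp: vector_field_germ_def)
  from cross_relation_quotient[OF this Derlog_cross_relation[OF assms]]
  show ?thesis unfolding liftable_iff[OF k] using \<xi> by blast
qed

end

theorem corollary3p7:
  fixes k :: nat
  assumes "k \<ge> 2"
  shows "Derlog (2 * k - 1) (cross_cap_image k)
           = generated_module (2 * k - 1) (cross_cap_fields k)
       \<and> {\<xi>. liftable (2 * k - 2) (2 * k - 1) (cross_cap k) \<xi>}
           = generated_module (2 * k - 1) (cross_cap_fields k)"
proof -
  interpret cross_cap_setup k by unfold_locales (rule assms)
  show ?thesis
    using module_imp_liftable liftable_imp_module liftable_imp_Derlog Derlog_imp_liftable by blast
qed

end
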